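(* Let $p\in\tfrac12\mathbb Z_{\ge0}$ and $\chi(z)=\sum_{k=-2p}^\infty\chi_{-\frac k2}z^{\frac k2-1}\in\mathbb C((z^{1/2}))$, and suppose that one of the following holds: (i) $p>0$ and $\chi_p\ne0$; (ii) $p=0$ and $\chi_0\in(\mathbb C\setminus\tfrac12\mathbb Z)\cup\{\tfrac12\}$; (iii) $p=0$, $\chi_0-\tfrac12=\ell\in\tfrac12\mathbb Z_{\ge0}$, and $\det A(\chi)\ne0$ (with $A(\chi)$ the $2\ell\times2\ell$ matrix defined in the context). Let $i,j\in\{1,2\}$. Then $F^{T_i}(\chi)$ is an irreducible $\mathcal A^{tw}$-module and the set of vectors $$G(p-n_1)G(p-n_2)\cdots G(p-n_r)\,h(-m_1)\cdots h(-m_s)(\mathbf 1\otimes\mathbf 1)$$ with $r,s\ge0$, $n_a\in\tfrac12\mathbb Z_{>0}$, $m_b\in\tfrac12+\mathbb Z_{\ge0}$, $n_1>n_2>\cdots>n_r>0$, $m_1\ge m_2\ge\cdots\ge m_s>0$, is a basis of the irreducible $\Theta$-twisted $V_{-2}(sl_2)$-module $F^{T_i}(\chi)\otimes F_{-1}^{T_j}$.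
   Context: **The matrix $A(\chi)$.** Let $\chi^{(1)}$ (resp. $\chi^{(2)}$) be the part of $\chi$ with integer (resp. half-odd-integer) powers of $z$, and $S(z)=\frac12(\chi^{(1)}(z)^2+\partial_z\chi^{(1)}(z))=\sum_{n\in\mathbb Z}S(n)z^{-n-2}$. $A(\chi)$ is the $2\ell\times2\ell$ matrix with entry $2S(-(b-a+1))$ in position $(a,b)$ for $b\ge a$, entry $\ell^2-(\ell-a)^2$ in position $(a+1,a)$, and $0$ otherwise (determinant $1$ if $\ell=0$). **The Lie superalgebra $\mathcal A^{tw}$.** It has basis $\mathcal S(n),\mathcal T(n+\tfrac12),\mathcal G(r),C$ ($n\in\mathbb Z$, $r\in\tfrac12\mathbb Z$), with $\mathcal S(n),\mathcal T(n+\frac12),C$ even and central, $\mathcal G(r)$ odd, and $$\{\mathcal G(r),\mathcal G(s)\}=(-1)^{2r+1}\Big(2\delta^{\mathbb Z}_{r+s}\mathcal S(r+s)-\delta^{\frac12+\mathbb Z}_{r+s}(r-s)\mathcal T(r+s)+\tfrac C3\delta^{\mathbb Z}_{r+s}(r^2-\tfrac14)\delta_{r+s,0}\Big),$$ where $\delta_m^X=1$ if $m\in X$, $0$ otherwise. **The modules $F^{T_i}(\chi)$.** Let $CL^{tw}$ be the associative algebra generated by $\Phi(r)$, $r\in\tfrac12\mathbb Z$, with $\{\Phi(r),\Phi(s)\}=-(-1)^{2r}\delta_{r+s,0}$. Let $F^{T_i}$ be the irreducible $CL^{tw}$-module generated by $\mathbf 1$ with $\Phi(r)\mathbf 1=0$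 for $r>0$ and $\Phi(0)\mathbf 1=(-1)^i\frac1{\sqrt{-2}}\mathbf 1$ (where $\sqrt{-2}=\sqrt2\sqrt{-1}$). Put $\Phi(z)=\sum_{r\in\frac12\mathbb Z}\Phi(r)z^{-r-1/2}$. $F^{T_i}(\chi)$ is the space $F^{T_i}$ on which $\mathcal G(r)$ acts as $G(r)$, where $G(z)=\sum_{r\in\frac12\mathbb Z}G(r)z^{-r-3/2}=\partial_z\Phi(z)+\chi(z)\Phi(z)$, $\sum_n\mathcal T(n)z^{-n-1}$ acts as the scalar series $\chi^{(2)}(z)$, $C=-3$, and the $\mathcal S(n)$ act by scalars. **The modules $F_{-1}^{T_j}$.** Let $[\beta(k),\beta(l)]=-k\delta_{k+l,0}$, $k,l\in\frac12+\mathbb Z$. $F_{-1}^{T_j}=\mathbb C[\beta(-\frac12),\beta(-\frac32),\dots]$ (Fock space, vacuum $\mathbf 1$) with $\beta(z)=\sum_{k\in\frac12+\mathbb Z}\beta(k)z^{-k-1}$ and $$Y_{tw}(e^{\beta},z)=-(2\sqrt{-1})(-1)^j z^{1/2}\exp\Big(\sum_{k\in\frac12+\mathbb Z_{\ge0}}\tfrac{\beta(-k)}{k}z^{k}\Big)\exp\Big(-\sum_{k\in\frac12+\mathbb Z_{\ge0}}\tfrac{\beta(k)}{k}z^{-k}\Big).$$ **Twisted $V_{-2}(sl_2)$-module structure.** $V_{-2}(sl_2)$ is the universal affine vertex algebra of level $-2$, $\Theta$ its automorphism $e\leftrightarrow f$, $h\mapsto-h$. $F^{T_i}(\chi)\otimes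 F_{-1}^{T_j}$ is the $\Theta$-twisted module with $Y^{tw}(e,z)=\frac1{\sqrt2}G(z)\otimes Y_{tw}(e^\beta,z)$ (tensored without signs), $Y^{tw}(f,z)$ obtained from $Y^{tw}(e,z)$ by $z^{1/2}\mapsto-z^{1/2}$, and $Y^{tw}(h,z)=\sum_{n\in\frac12+\mathbb Z}h(n)z^{-n-1}=-2\beta(z)+2\chi^{(2)}(z)$. The operators $G(r)$ act on the first tensor factor. *)

theory Defs
  imports
    Complex_Main
    "HOL-Library.Poly_Mapping"
    "HOL-Library.Groups_Big_Fun"
    "HOL-Computational_Algebra.Formal_Laurent_Series"
    "Jordan_Normal_Form.Determinant"
begin

text \<open>
  Convention: a half-integer \<open>r\<close> is represented by the integer \<open>R = 2r\<close>. An index that is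
  an integer in the mathematics is not doubled. \<open>Sum_any\<close> is used for sums that are infinite
  formally but have only finitely many nonzero terms on each vector.

  Vector spaces are complex, given by their scalar multiplication \<open>s\<close> on an additive group.
\<close>

section \<open>Linear algebra\<close>

definition is_subspace :: "(complex \<Rightarrow> 'v::ab_group_add \<Rightarrow> 'v) \<Rightarrow> 'v set \<Rightarrow> bool"
  where "is_subspace = Modules.module.subspace"

definition is_basis_family ::
    "(complex \<Rightarrow> 'v::ab_group_add \<Rightarrow> 'v) \<Rightarrow> 'k set \<Rightarrow> ('k \<Rightarrow> 'v) \<Rightarrow> bool"
  where "is_basis_family s K b \<longleftrightarrow>
    inj_on b K \<and> \<not> Modules.module.dependent s (b ` K) \<and> Modules.module.span s (b ` K) = UNIV"

text \<open>No grading is imposed on submodules: \<open>\<Phi>(0)\<close> is odd and fixes the line of the vacuum,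
  so the modules considered here are not \<open>\<int>/2\<close>-graded.\<close>

definition irreducible_under ::
    "(complex \<Rightarrow> 'v::ab_group_add \<Rightarrow> 'v) \<Rightarrow> ('v \<Rightarrow> 'v) set \<Rightarrow> bool"
  where "irreducible_under s Ops \<longleftrightarrow>
    (\<exists>v::'v. v \<noteq> 0) \<and>
    (\<forall>U. is_subspace s U \<and> (\<forall>T\<in>Ops. T ` U \<subseteq> U) \<longrightarrow> U = {0} \<or> U = UNIV)"

text \<open>Scalar multiplication on the direct sum of copies of a vector space.\<close>

definition pm_scale ::
    "(complex \<Rightarrow> 'v::ab_group_add \<Rightarrow> 'v) \<Rightarrow> complex \<Rightarrow> ('k \<Rightarrow>\<^sub>0 'v) \<Rightarrow> ('k \<Rightarrow>\<^sub>0 'v)"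
  where "pm_scale s c = Poly_Mapping.map (s c)"

text \<open>If \<open>B\<close> is a basis of \<open>U\<close>, so that \<open>U\<close> is the space of finitely supported functions
  \<open>'k \<Rightarrow>\<^sub>0 complex\<close> on it, then \<open>V \<otimes> U\<close> is the space \<open>'k \<Rightarrow>\<^sub>0 'v\<close>, with \<open>v \<otimes> b = single b v\<close>.
  The second operator below is \<open>A \<otimes> B\<close>, without signs.\<close>

definition tens ::
    "(complex \<Rightarrow> 'v::ab_group_add \<Rightarrow> 'v) \<Rightarrow> 'v \<Rightarrow> ('k \<Rightarrow>\<^sub>0 complex) \<Rightarrow> ('k \<Rightarrow>\<^sub>0 'v)"
  where "tens s v u =
    (\<Sum>b\<in>Poly_Mapping.keys u. Poly_Mapping.single b (s (Poly_Mapping.lookup u b) v))"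

definition tens_op ::
    "(complex \<Rightarrow> 'v::ab_group_add \<Rightarrow> 'v) \<Rightarrow> ('v \<Rightarrow> 'v)
      \<Rightarrow> (('k \<Rightarrow>\<^sub>0 complex) \<Rightarrow> ('k \<Rightarrow>\<^sub>0 complex)) \<Rightarrow> ('k \<Rightarrow>\<^sub>0 'v) \<Rightarrow> ('k \<Rightarrow>\<^sub>0 'v)"
  where "tens_op s A B w =
    (\<Sum>b\<in>Poly_Mapping.keys w.
       tens s (A (Poly_Mapping.lookup w b)) (B (Poly_Mapping.single b 1)))"


section \<open>The series \<open>\<chi>\<close> and the matrix \<open>A(\<chi>)\<close>\<close>

text \<open>An element of \<open>\<complex>((z\<^sup>1\<^sup>/\<^sup>2))\<close> is a formal Laurent series in \<open>y = z\<^sup>1\<^sup>/\<^sup>2\<close>.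
  With \<open>\<chi>(z) = \<Sum>n. \<chi>\<^sub>n z\<^bsup>-n-1\<^esup>\<close>, \<open>chi_mode \<chi> N\<close> is \<open>\<chi>\<^sub>n\<close> for \<open>N = 2n\<close>.\<close>

definition chi_mode :: "complex fls \<Rightarrow> int \<Rightarrow> complex"
  where "chi_mode \<chi> N = fls_nth \<chi> (- N - 2)"

definition int_part :: "complex fls \<Rightarrow> complex fls"
  where "int_part \<chi> = Abs_fls (\<lambda>m. if even m then fls_nth \<chi> m else 0)"

definition half_part :: "complex fls \<Rightarrow> complex fls"
  where "half_part \<chi> = Abs_fls (\<lambda>m. if odd m then fls_nth \<chi> m else 0)"

text \<open>\<open>\<partial>\<^sub>z = (2y)\<^sup>-\<^sup>1 \<partial>\<^sub>y\<close>\<close>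

definition deriv_z :: "complex fls \<Rightarrow> complex fls"
  where "deriv_z f = fls_const (1/2) * fls_X_inv * fls_deriv f"

definition S_series :: "complex fls \<Rightarrow> complex fls"
  where "S_series \<chi> = fls_const (1/2) * ((int_part \<chi>)\<^sup>2 + deriv_z (int_part \<chi>))"

definition S_mode :: "complex fls \<Rightarrow> int \<Rightarrow> complex"
  where "S_mode \<chi> n = fls_nth (S_series \<chi>) (2 * (- n - 2))"

text \<open>Here \<open>L = 2\<ell>\<close>; the matrix indices of the library start at 0.\<close>

definition A_matrix :: "nat \<Rightarrow> complex fls \<Rightarrow> complex mat"
  where "A_matrix L \<chi> = mat L L (\<lambda>(a0, b0).
    let a = a0 + 1; b = b0 + 1; l = of_nat L / 2 in
      if a \<le> b then 2 * S_mode \<chi> (- (int b - int a + 1))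
      else if a = b + 1 then l\<^sup>2 - (l - of_nat b)\<^sup>2
      else 0)"


section \<open>The Lie superalgebra \<open>A\<^sup>t\<^sup>w\<close> and its modules\<close>

text \<open>\<open>S_gen n = S(n)\<close>, \<open>T_gen n = T(n + 1/2)\<close>, \<open>G_gen R = G(R/2)\<close>.\<close>

datatype atw_gen = S_gen int | T_gen int | G_gen int | C_gen

type_synonym atw = "atw_gen \<Rightarrow>\<^sub>0 complex"

definition atw_even :: "atw \<Rightarrow> bool"
  where "atw_even x \<longleftrightarrow> Poly_Mapping.keys x \<inter> range G_gen = {}"

definition atw_odd :: "atw \<Rightarrow> bool"
  where "atw_odd x \<longleftrightarrow> Poly_Mapping.keys x \<subseteq> range G_gen"

fun atw_gen_bracket :: "atw_gen \<Rightarrow> atw_gen \<Rightarrow> atw" where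
  "atw_gen_bracket (G_gen R) (G_gen Q) =
    pm_scale (*) ((-1) powi (R + 1))
      (if even (R + Q)
       then Poly_Mapping.single (S_gen ((R + Q) div 2)) 2
          + Poly_Mapping.single C_gen
              (if R + Q = 0 then (1/3) * ((of_int R / 2)\<^sup>2 - 1/4) else 0)
       else Poly_Mapping.single (T_gen ((R + Q - 1) div 2)) (- (of_int (R - Q) / 2)))"
| "atw_gen_bracket _ _ = 0"

definition atw_bracket :: "atw \<Rightarrow> atw \<Rightarrow> atw"
  where "atw_bracket x y =
    (\<Sum>a\<in>Poly_Mapping.keys x. \<Sum>b\<in>Poly_Mapping.keys y.
       pm_scale (*) (Poly_Mapping.lookup x a * Poly_Mapping.lookup y b) (atw_gen_bracket a b))"

definition atw_module ::
    "(complex \<Rightarrow> 'v::ab_group_add \<Rightarrow> 'v) \<Rightarrow> (atw \<Rightarrow> 'v \<Rightarrow> 'v) \<Rightarrow> bool"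
  where "atw_module s \<rho> \<longleftrightarrow>
    vector_space s \<and>
    (\<forall>v. Vector_Spaces.linear (pm_scale (*)) s (\<lambda>x. \<rho> x v)) \<and>
    (\<forall>x. Vector_Spaces.linear s s (\<rho> x)) \<and>
    (\<forall>x y v. atw_even x \<or> atw_even y \<longrightarrow>
        \<rho> (atw_bracket x y) v = \<rho> x (\<rho> y v) - \<rho> y (\<rho> x v)) \<and>
    (\<forall>x y v. atw_odd x \<and> atw_odd y \<longrightarrow>
        \<rho> (atw_bracket x y) v = \<rho> x (\<rho> y v) + \<rho> y (\<rho> x v))"

definition atw_irreducible_module ::
    "(complex \<Rightarrow> 'v::ab_group_add \<Rightarrow> 'v) \<Rightarrow> (atw \<Rightarrow> 'v \<Rightarrow> 'v) \<Rightarrow> bool"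
  where "atw_irreducible_module s \<rho> \<longleftrightarrow> atw_module s \<rho> \<and> irreducible_under s (range \<rho>)"


section \<open>The modules \<open>F\<^sup>T\<^sup>i\<close> and \<open>F\<^sup>T\<^sup>i(\<chi>)\<close>\<close>

text \<open>A module for the associative algebra \<open>CL\<^sup>t\<^sup>w\<close>, which is given by generators and relations,
  is a family of operators \<open>\<Phi>(r)\<close> that satisfy the relations. The conditions determine
  \<open>F\<^sup>T\<^sup>i\<close> up to isomorphism. \<open>Phi R\<close> is \<open>\<Phi>(R/2)\<close>.\<close>

definition CLtw_module ::
    "(complex \<Rightarrow> 'v::ab_group_add \<Rightarrow> 'v) \<Rightarrow> (int \<Rightarrow> 'v \<Rightarrow> 'v) \<Rightarrow> bool"
  where "CLtw_module s Phi \<longleftrightarrow>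
    vector_space s \<and>
    (\<forall>R. Vector_Spaces.linear s s (Phi R)) \<and>
    (\<forall>R Q v. Phi R (Phi Q v) + Phi Q (Phi R v) =
       s (if R + Q = 0 then - ((-1) powi R) else 0) v)"

definition is_FT ::
    "nat \<Rightarrow> (complex \<Rightarrow> 'v::ab_group_add \<Rightarrow> 'v) \<Rightarrow> (int \<Rightarrow> 'v \<Rightarrow> 'v) \<Rightarrow> 'v \<Rightarrow> bool"
  where "is_FT i s Phi vac \<longleftrightarrow>
    CLtw_module s Phi \<and>
    irreducible_under s (range Phi) \<and>
    vac \<noteq> 0 \<and>
    (\<forall>R>0. Phi R vac = 0) \<and>
    Phi 0 vac = s ((-1) ^ i / (complex_of_real (sqrt 2) * \<i>)) vac"

text \<open>\<open>G_mode s Phi \<chi> R\<close> is \<open>G(R/2)\<close>. As \<open>\<Phi>(z) = \<Sum>r. \<Phi>(r) z\<^bsup>-r-1/2\<^esup>\<close>, the coefficient of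
  \<open>z\<^bsup>-r-3/2\<^esup>\<close> in \<open>\<partial>\<^sub>z\<Phi>(z) + \<chi>(z)\<Phi>(z)\<close> is \<open>(-r - 1/2) \<Phi>(r) + \<Sum>n. \<chi>\<^sub>n \<Phi>(r - n)\<close>.\<close>

definition G_mode ::
    "(complex \<Rightarrow> 'v::ab_group_add \<Rightarrow> 'v) \<Rightarrow> (int \<Rightarrow> 'v \<Rightarrow> 'v) \<Rightarrow> complex fls \<Rightarrow> int \<Rightarrow> 'v \<Rightarrow> 'v"
  where "G_mode s Phi \<chi> R v =
    s (- (of_int R / 2) - 1/2) (Phi R v) +
    Sum_any (\<lambda>N. s (chi_mode \<chi> N) (Phi (R - N) v))"

text \<open>The scalars by which the \<open>S(n)\<close> act are forced by the bracket of the \<open>G(r)\<close>. They are the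
  coefficients of \<open>(1/2)(\<chi>\<^sup>1(z)\<^sup>2 + \<partial>\<^sub>z\<chi>\<^sup>1(z) - \<chi>\<^sup>2(z)\<^sup>2)\<close>, where \<open>\<chi>\<^sup>1, \<chi>\<^sup>2\<close> are the parts of \<open>\<chi>\<close> with
  integer and half-odd-integer powers; this series differs from \<open>S_series \<chi>\<close> by the last term.\<close>

definition S_scalar :: "complex fls \<Rightarrow> int \<Rightarrow> complex"
  where "S_scalar \<chi> n =
    fls_nth (S_series \<chi> - fls_const (1/2) * (half_part \<chi>)\<^sup>2) (2 * (- n - 2))"

fun FT_gen_action ::
    "(complex \<Rightarrow> 'v::ab_group_add \<Rightarrow> 'v) \<Rightarrow> (int \<Rightarrow> 'v \<Rightarrow> 'v) \<Rightarrow> complex fls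
      \<Rightarrow> atw_gen \<Rightarrow> 'v \<Rightarrow> 'v" where
  "FT_gen_action s Phi \<chi> (S_gen n) v = s (S_scalar \<chi> n) v"
| "FT_gen_action s Phi \<chi> (T_gen n) v = s (chi_mode \<chi> (2 * n + 1)) v"
| "FT_gen_action s Phi \<chi> (G_gen R) v = G_mode s Phi \<chi> R v"
| "FT_gen_action s Phi \<chi> C_gen v = s (-3) v"

definition FT_action ::
    "(complex \<Rightarrow> 'v::ab_group_add \<Rightarrow> 'v) \<Rightarrow> (int \<Rightarrow> 'v \<Rightarrow> 'v) \<Rightarrow> complex fls
      \<Rightarrow> atw \<Rightarrow> 'v \<Rightarrow> 'v"
  where "FT_action s Phi \<chi> x v =
    (\<Sum>a\<in>Poly_Mapping.keys x. s (Poly_Mapping.lookup x a) (FT_gen_action s Phi \<chi> a v))"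


section \<open>The modules \<open>F\<^sub>-\<^sub>1\<^sup>T\<^sup>j\<close>\<close>

text \<open>The polynomial ring in variables \<open>x\<^sub>n\<close>, \<open>n \<ge> 0\<close>, with \<open>x\<^sub>n\<close> standing for
  \<open>\<beta>(-n - 1/2)\<close>; the keys are the exponent vectors of the monomials, and the vacuum is \<open>1\<close>.\<close>

type_synonym monomial = "nat \<Rightarrow>\<^sub>0 nat"
type_synonym fock = "monomial \<Rightarrow>\<^sub>0 complex"

definition fock_var :: "nat \<Rightarrow> fock"
  where "fock_var n = Poly_Mapping.single (Poly_Mapping.single n 1) 1"

definition fock_pderiv :: "nat \<Rightarrow> fock \<Rightarrow> fock"
  where "fock_pderiv n u =
    (\<Sum>m\<in>Poly_Mapping.keys u.
       Poly_Mapping.single (m - Poly_Mapping.single n 1)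
         (of_nat (Poly_Mapping.lookup m n) * Poly_Mapping.lookup u m))"

text \<open>\<open>fock_beta K\<close> is \<open>\<beta>(K/2)\<close> for odd \<open>K\<close>; \<open>\<beta>(z)\<close> has no modes for even \<open>K\<close>. The relation
  \<open>[\<beta>(k), \<beta>(-k)] = -k\<close> makes \<open>\<beta>(k)\<close>, \<open>k > 0\<close>, act as \<open>-k\<close> times a partial derivative.\<close>

definition fock_beta :: "int \<Rightarrow> fock \<Rightarrow> fock"
  where "fock_beta K u =
    (if even K then 0
     else if K < 0 then fock_var (nat ((- K - 1) div 2)) * u
     else pm_scale (*) (- (of_int K / 2)) (fock_pderiv (nat ((K - 1) div 2)) u))"

text \<open>The coefficient of \<open>y\<^sup>d\<close> in \<open>exp (\<Sum>k odd. a\<^sub>k y\<^sup>k)\<close>, where \<open>k > 0\<close>: the \<open>N\<close>-th term of the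
  exponential series contributes \<open>(1/N!) \<Sum> a\<^bsub>k1\<^esub> \<dots> a\<^bsub>kN\<^esub>\<close> over \<open>k1 + \<dots> + kN = d\<close>.\<close>

definition exp_coeff :: "(nat \<Rightarrow> fock \<Rightarrow> fock) \<Rightarrow> nat \<Rightarrow> fock \<Rightarrow> fock"
  where "exp_coeff a d u =
    (\<Sum>ks\<in>{ks. (\<forall>k\<in>set ks. odd k) \<and> sum_list ks = d}.
       pm_scale (*) (1 / fact (length ks)) (foldr a ks u))"

text \<open>The coefficient of \<open>z\<^bsup>M/2\<^esup> = y\<^sup>M\<close> in \<open>Y\<^sub>t\<^sub>w(e\<^sup>\<beta>, z)\<close>: the prefactor contributes
  \<open>y\<close>, the left exponential \<open>y\<^bsup>M-1+d\<^esup>\<close> and the right one \<open>y\<^bsup>-d\<^esup>\<close>.\<close>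

definition exp_beta_coeff :: "nat \<Rightarrow> int \<Rightarrow> fock \<Rightarrow> fock"
  where "exp_beta_coeff j M u =
    pm_scale (*) (- (2 * \<i>) * (-1) ^ j)
      (Sum_any (\<lambda>d::nat.
         if M - 1 + int d < 0 then 0
         else exp_coeff (\<lambda>k. pm_scale (*) (2 / of_nat k) \<circ> fock_beta (- int k))
                (nat (M - 1 + int d))
                (exp_coeff (\<lambda>k. pm_scale (*) (- (2 / of_nat k)) \<circ> fock_beta (int k)) d u)))"


section \<open>The fields on \<open>F\<^sup>T\<^sup>i(\<chi>) \<otimes> F\<^sub>-\<^sub>1\<^sup>T\<^sup>j\<close>\<close>

text \<open>The operator with argument \<open>N\<close> is the coefficient of \<open>z\<^bsup>-n-1\<^esup>\<close>, \<open>N = 2n\<close>. In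
  \<open>G(z) \<otimes> Y\<^sub>t\<^sub>w(e\<^sup>\<beta>, z)\<close> the mode \<open>G(r)\<close> comes with \<open>z\<^bsup>-r-3/2\<^esup>\<close>, hence with the coefficient of
  \<open>z\<^bsup>r+1/2-n\<^esup>\<close> in the second factor.\<close>

definition e_mode ::
    "(complex \<Rightarrow> 'v::ab_group_add \<Rightarrow> 'v) \<Rightarrow> (int \<Rightarrow> 'v \<Rightarrow> 'v) \<Rightarrow> complex fls \<Rightarrow> nat
      \<Rightarrow> int \<Rightarrow> (monomial \<Rightarrow>\<^sub>0 'v) \<Rightarrow> (monomial \<Rightarrow>\<^sub>0 'v)"
  where "e_mode s Phi \<chi> j N w =
    pm_scale s (1 / complex_of_real (sqrt 2))
      (Sum_any (\<lambda>R. tens_op s (G_mode s Phi \<chi> R) (exp_beta_coeff j (R + 1 - N)) w))"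

text \<open>Under \<open>z\<^sup>1\<^sup>/\<^sup>2 \<mapsto> -z\<^sup>1\<^sup>/\<^sup>2\<close> the coefficient of \<open>z\<^bsup>-n-1\<^esup>\<close> is multiplied by \<open>(-1)\<^bsup>2n\<^esup>\<close>.\<close>

definition f_mode ::
    "(complex \<Rightarrow> 'v::ab_group_add \<Rightarrow> 'v) \<Rightarrow> (int \<Rightarrow> 'v \<Rightarrow> 'v) \<Rightarrow> complex fls \<Rightarrow> nat
      \<Rightarrow> int \<Rightarrow> (monomial \<Rightarrow>\<^sub>0 'v) \<Rightarrow> (monomial \<Rightarrow>\<^sub>0 'v)"
  where "f_mode s Phi \<chi> j N w = pm_scale s ((-1) powi N) (e_mode s Phi \<chi> j N w)"

definition h_mode ::
    "(complex \<Rightarrow> 'v::ab_group_add \<Rightarrow> 'v) \<Rightarrow> complex fls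
      \<Rightarrow> int \<Rightarrow> (monomial \<Rightarrow>\<^sub>0 'v) \<Rightarrow> (monomial \<Rightarrow>\<^sub>0 'v)"
  where "h_mode s \<chi> N w =
    (if even N then 0
     else pm_scale s (-2) (tens_op s id (fock_beta N) w) + pm_scale s (2 * chi_mode \<chi> N) w)"

text \<open>The index \<open>(ns, ms)\<close> consists of the doubled \<open>n\<^sub>1 > \<dots> > n\<^sub>r > 0\<close> and
  \<open>m\<^sub>1 \<ge> \<dots> \<ge> m\<^sub>s > 0\<close>.\<close>

definition basis_index :: "(nat list \<times> nat list) set"
  where "basis_index = {(ns, ms).
    sorted_wrt (>) ns \<and> (\<forall>n\<in>set ns. n > 0) \<and>
    sorted_wrt (\<ge>) ms \<and> (\<forall>m\<in>set ms. odd m)}"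

definition basis_vector ::
    "(complex \<Rightarrow> 'v::ab_group_add \<Rightarrow> 'v) \<Rightarrow> (int \<Rightarrow> 'v \<Rightarrow> 'v) \<Rightarrow> 'v \<Rightarrow> complex fls \<Rightarrow> nat
      \<Rightarrow> nat list \<times> nat list \<Rightarrow> (monomial \<Rightarrow>\<^sub>0 'v)"
  where "basis_vector s Phi vac \<chi> P = (\<lambda>(ns, ms).
    foldr (\<lambda>n. tens_op s (G_mode s Phi \<chi> (int P - int n)) id) ns
      (foldr (\<lambda>m. h_mode s \<chi> (- int m)) ms
        (tens s vac (1 :: fock))))"


section \<open>Vertex algebras and twisted modules\<close>

text \<open>\<open>Y a n b\<close> is the \<open>n\<close>-th product \<open>a\<^sub>(\<^sub>n\<^sub>) b\<close>, so \<open>Y(a,z) = \<Sum>n. a\<^sub>(\<^sub>n\<^sub>) z\<^bsup>-n-1\<^esup>\<close>. The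
  last condition is the Borcherds identity, that is, the Jacobi identity in components.\<close>

definition vertex_algebra ::
    "(complex \<Rightarrow> 'a::ab_group_add \<Rightarrow> 'a) \<Rightarrow> 'a \<Rightarrow> ('a \<Rightarrow> int \<Rightarrow> 'a \<Rightarrow> 'a) \<Rightarrow> bool"
  where "vertex_algebra s vone Y \<longleftrightarrow>
    vector_space s \<and>
    (\<forall>n b. Vector_Spaces.linear s s (\<lambda>a. Y a n b)) \<and>
    (\<forall>a n. Vector_Spaces.linear s s (Y a n)) \<and>
    (\<forall>a b. \<exists>N. \<forall>n\<ge>N. Y a n b = 0) \<and>
    (\<forall>n b. Y vone n b = (if n = -1 then b else 0)) \<and>
    (\<forall>a. Y a (-1) vone = a \<and> (\<forall>n\<ge>0. Y a n vone = 0)) \<and>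
    (\<forall>a b c m n k.
      Sum_any (\<lambda>j::nat. s (of_int m gchoose j) (Y (Y a (n + int j) b) (m + k - int j) c)) =
      Sum_any (\<lambda>j::nat. s ((-1) ^ j * (of_int n gchoose j))
        (Y a (m + n - int j) (Y b (k + int j) c)
          - s ((-1) powi n) (Y b (n + k - int j) (Y a (m + int j) c)))))"

definition va_automorphism ::
    "(complex \<Rightarrow> 'a::ab_group_add \<Rightarrow> 'a) \<Rightarrow> 'a \<Rightarrow> ('a \<Rightarrow> int \<Rightarrow> 'a \<Rightarrow> 'a) \<Rightarrow> ('a \<Rightarrow> 'a) \<Rightarrow> bool"
  where "va_automorphism s vone Y \<theta> \<longleftrightarrow>
    Vector_Spaces.linear s s \<theta> \<and> bij \<theta> \<and> \<theta> vone = vone \<and>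
    (\<forall>a n b. \<theta> (Y a n b) = Y (\<theta> a) n (\<theta> b))"

datatype sl2 = sl2_e | sl2_f | sl2_h

text \<open>\<open>sl2_bracket x y z\<close> is the coefficient of \<open>z\<close> in \<open>[x, y]\<close>, and \<open>sl2_form\<close> is the trace form.\<close>

fun sl2_bracket :: "sl2 \<Rightarrow> sl2 \<Rightarrow> sl2 \<Rightarrow> complex" where
  "sl2_bracket sl2_e sl2_f = (\<lambda>_. 0)(sl2_h := 1)"
| "sl2_bracket sl2_f sl2_e = (\<lambda>_. 0)(sl2_h := -1)"
| "sl2_bracket sl2_h sl2_e = (\<lambda>_. 0)(sl2_e := 2)"
| "sl2_bracket sl2_e sl2_h = (\<lambda>_. 0)(sl2_e := -2)"
| "sl2_bracket sl2_h sl2_f = (\<lambda>_. 0)(sl2_f := -2)"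
| "sl2_bracket sl2_f sl2_h = (\<lambda>_. 0)(sl2_f := 2)"
| "sl2_bracket _ _ = (\<lambda>_. 0)"

fun sl2_form :: "sl2 \<Rightarrow> sl2 \<Rightarrow> complex" where
  "sl2_form sl2_e sl2_f = 1"
| "sl2_form sl2_f sl2_e = 1"
| "sl2_form sl2_h sl2_h = 2"
| "sl2_form _ _ = 0"

text \<open>The free associative algebra on the symbols \<open>x(n) = x \<otimes> t\<^sup>n\<close> has the words in them as basis.
  The first family of relators below presents \<open>U(\<close>affine \<open>sl\<^sub>2)\<close> with the central element set to \<open>k\<close>;
  together with the left ideal generated by the \<open>x(n)\<close>, \<open>n \<ge> 0\<close>, the quotient is the module
  induced from the one-dimensional module of level \<open>k\<close> of the nonnegative part, which is the
  underlying space of \<open>V\<^sub>k(sl\<^sub>2)\<close>.\<close>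

type_synonym affine_words = "(sl2 \<times> int) list \<Rightarrow>\<^sub>0 complex"

definition affine_relators :: "complex \<Rightarrow> affine_words set"
  where "affine_relators k =
    {Poly_Mapping.single (u @ [(x, m), (y, n)] @ v) 1
       - Poly_Mapping.single (u @ [(y, n), (x, m)] @ v) 1
       - (\<Sum>z\<in>{sl2_e, sl2_f, sl2_h}.
            Poly_Mapping.single (u @ [(z, m + n)] @ v) (sl2_bracket x y z))
       - Poly_Mapping.single (u @ v) (if m + n = 0 then of_int m * sl2_form x y * k else 0)
     | u v x y m n. True} \<union>
    {Poly_Mapping.single (u @ [(x, n)]) 1 | u x n. n \<ge> 0}"

definition affine_eval ::
    "(complex \<Rightarrow> 'a::ab_group_add \<Rightarrow> 'a) \<Rightarrow> 'a \<Rightarrow> ('a \<Rightarrow> int \<Rightarrow> 'a \<Rightarrow> 'a) \<Rightarrow> (sl2 \<Rightarrow> 'a)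
      \<Rightarrow> affine_words \<Rightarrow> 'a"
  where "affine_eval s vone Y \<iota> p =
    (\<Sum>u\<in>Poly_Mapping.keys p.
       s (Poly_Mapping.lookup p u) (foldr (\<lambda>(x, n). Y (\<iota> x) n) u vone))"

text \<open>The vertex algebra \<open>V\<close> is \<open>V\<^sub>k(sl\<^sub>2)\<close>, \<open>\<iota>\<close> being the embedding \<open>x \<mapsto> x(-1)1\<close> of \<open>sl\<^sub>2\<close>:
  the modes of the \<open>\<iota> x\<close> make \<open>V\<close> the induced module, with \<open>vone\<close> as generating vector.\<close>

definition universal_affine_sl2 ::
    "complex \<Rightarrow> (complex \<Rightarrow> 'a::ab_group_add \<Rightarrow> 'a) \<Rightarrow> 'a \<Rightarrow> ('a \<Rightarrow> int \<Rightarrow> 'a \<Rightarrow> 'a)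
      \<Rightarrow> (sl2 \<Rightarrow> 'a) \<Rightarrow> bool"
  where "universal_affine_sl2 k s vone Y \<iota> \<longleftrightarrow>
    vertex_algebra s vone Y \<and>
    surj (affine_eval s vone Y \<iota>) \<and>
    {p. affine_eval s vone Y \<iota> p = 0}
      = Modules.module.span (pm_scale (*)) (affine_relators k)"

text \<open>Twisted modules for an automorphism \<open>\<theta>\<close> of order two. \<open>Yw a N\<close> is the coefficient of
  \<open>z\<^bsup>-N/2-1\<^esup>\<close> in the twisted field of \<open>a\<close>. The last condition is the twisted Jacobi identity in
  components; \<open>M\<close> runs over twice the exponents \<open>m\<close> for which \<open>a\<close> has a mode, namely
  \<open>m \<in> \<int>\<close> if \<open>\<theta> a = a\<close> and \<open>m \<in> 1/2 + \<int>\<close> if \<open>\<theta> a = -a\<close>.\<close>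

definition twisted_module ::
    "(complex \<Rightarrow> 'a::ab_group_add \<Rightarrow> 'a) \<Rightarrow> 'a \<Rightarrow> ('a \<Rightarrow> int \<Rightarrow> 'a \<Rightarrow> 'a) \<Rightarrow> ('a \<Rightarrow> 'a)
      \<Rightarrow> (complex \<Rightarrow> 'w::ab_group_add \<Rightarrow> 'w) \<Rightarrow> ('a \<Rightarrow> int \<Rightarrow> 'w \<Rightarrow> 'w) \<Rightarrow> bool"
  where "twisted_module s vone Y \<theta> sw Yw \<longleftrightarrow>
    vertex_algebra s vone Y \<and> va_automorphism s vone Y \<theta> \<and> (\<forall>a. \<theta> (\<theta> a) = a) \<and>
    vector_space sw \<and>
    (\<forall>N w. Vector_Spaces.linear s sw (\<lambda>a. Yw a N w)) \<and>
    (\<forall>a N. Vector_Spaces.linear sw sw (Yw a N)) \<and>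
    (\<forall>a w. \<exists>B. \<forall>N\<ge>B. Yw a N w = 0) \<and>
    (\<forall>N w. Yw vone N w = (if N = -2 then w else 0)) \<and>
    (\<forall>a N w. Yw (\<theta> a) N w = sw ((-1) powi N) (Yw a N w)) \<and>
    (\<forall>a b w M n K. \<theta> a = s ((-1) powi M) a \<longrightarrow>
      Sum_any (\<lambda>j::nat. sw ((of_int M / 2) gchoose j)
        (Yw (Y a (n + int j) b) (M + K - 2 * int j) w)) =
      Sum_any (\<lambda>j::nat. sw ((-1) ^ j * (of_int n gchoose j))
        (Yw a (M + 2 * n - 2 * int j) (Yw b (K + 2 * int j) w)
          - sw ((-1) powi n) (Yw b (2 * n + K - 2 * int j) (Yw a (M + 2 * int j) w)))))"

definition irreducible_twisted_module ::
    "(complex \<Rightarrow> 'a::ab_group_add \<Rightarrow> 'a) \<Rightarrow> 'a \<Rightarrow> ('a \<Rightarrow> int \<Rightarrow> 'a \<Rightarrow> 'a) \<Rightarrow> ('a \<Rightarrow> 'a)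
      \<Rightarrow> (complex \<Rightarrow> 'w::ab_group_add \<Rightarrow> 'w) \<Rightarrow> ('a \<Rightarrow> int \<Rightarrow> 'w \<Rightarrow> 'w) \<Rightarrow> bool"
  where "irreducible_twisted_module s vone Y \<theta> sw Yw \<longleftrightarrow>
    twisted_module s vone Y \<theta> sw Yw \<and> irreducible_under sw (range (\<lambda>(a, N). Yw a N))"

end

theory Submission
  imports Defs
begin

text \<open>
  Write \<open>G(p - n) = c\<^sub>n \<Phi>(-n) + \<dots>\<close> with later terms \<open>\<Phi>(m)\<close>, \<open>m > -n\<close>. In all three cases \<open>c\<^sub>n \<noteq> 0\<close> for
  \<open>n > 0\<close>, so the \<open>G(p - n)\<close> serve as creation operators for the annihilation operators \<open>\<Phi>(n)\<close> just as
  the \<open>\<Phi>(-n)\<close> do, and their ordered products on the vacuum form a basis of \<open>F\<^sup>T\<^sup>i\<close>. Hence a submodule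
  that contains the vacuum is everything.

  If the leading coefficients at the \<open>\<Phi>(n)\<close> with \<open>n > 0\<close> do not vanish either, the \<open>G(r)\<close> recover all \<open>\<Phi>(n)\<close>, \<open>n > 0\<close>,
  and every nonzero submodule contains the vacuum. If \<open>p = 0\<close> and \<open>\<chi>\<^sub>0 = \<ell> + 1/2\<close>, the span of the \<open>G(r)\<close>
  is the orthogonal complement of a single vector \<open>\<Psi>\<close> in the completed space of the \<open>\<Phi>(r)\<close>, and the
  argument survives if \<open>\<Psi>\<close> is not isotropic. The norm of \<open>\<Psi>\<close> is the residue of \<open>u\<^sup>-\<^sup>2\<close> for a solution of
  \<open>u'' = 2 S u\<close>. It vanishes iff the second solution has no logarithm, and this forces \<open>det A(\<chi>) = 0\<close>.

  On the tensor product the modes of \<open>h\<close> generate the Weyl algebra of the Fock space, so a submodule is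
  \<open>U\<^sub>0 \<otimes> F\<^sub>-\<^sub>1\<close>; the coefficient of the Fock vacuum in \<open>e(n) (v \<otimes> 1)\<close> is a multiple of \<open>G(n) v\<close>, so that
  \<open>U\<^sub>0\<close> is a submodule of \<open>F\<^sup>T\<^sup>i(\<chi>)\<close>.
\<close>

section \<open>Linear algebra\<close>

lemma
  assumes "Vector_Spaces.linear s t f"
  shows lin_add: "f (x + y) = f x + f y"
    and lin_scale: "f (s c x) = t c (f x)"
    and lin_zero: "f 0 = 0"
    and lin_diff: "f (x - y) = f x - f y"
    and lin_neg: "f (- x) = - f x"
    and lin_sum: "f (sum g A) = (\<Sum>a\<in>A. f (g a))"
proof -
  interpret Vector_Spaces.linear s t f by fact
  show "f (x + y) = f x + f y" "f (s c x) = t c (f x)" "f 0 = 0" "f (x - y) = f x - f y"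
      "f (- x) = - f x" "f (sum g A) = (\<Sum>a\<in>A. f (g a))"
    by (simp_all add: add scale diff neg sum)
qed

lemma linearI':
  assumes "vector_space s" "vector_space t"
    and "\<And>x y. f (x + y) = f x + f y" "\<And>c x. f (s c x) = t c (f x)"
  shows "Vector_Spaces.linear s t f"
  using assms by (simp add: Vector_Spaces.linear_iff)

text \<open>Coefficients are attached to indices, not to vectors. Repetitions are thus excluded as
  well, and relations in a tensor product can be tested one factor at a time.\<close>

definition indep_family ::
    "(complex \<Rightarrow> 'v::ab_group_add \<Rightarrow> 'v) \<Rightarrow> 'k set \<Rightarrow> ('k \<Rightarrow> 'v) \<Rightarrow> bool"
  where "indep_family s K b \<longleftrightarrow>
    (\<forall>T c. finite T \<longrightarrow> T \<subseteq> K \<longrightarrow> (\<Sum>k\<in>T. s (c k) (b k)) = 0 \<longrightarrow> (\<forall>k\<in>T. c k = 0))"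

lemma indep_familyD:
  assumes "indep_family s K b" "finite T" "T \<subseteq> K" "(\<Sum>k\<in>T. s (c k) (b k)) = 0" "k \<in> T"
  shows "c k = 0"
  using assms unfolding indep_family_def by blast

lemma is_basis_familyI:
  assumes "vector_space s" "indep_family s K b" "Modules.module.span s (b ` K) = UNIV"
  shows "is_basis_family s K b"
proof -
  interpret vector_space s by fact
  have inj: "inj_on b K"
  proof (rule inj_onI, rule ccontr)
    fix x y assume xy: "x \<in> K" "y \<in> K" "b x = b y" "x \<noteq> y"
    have "(\<Sum>k\<in>{x, y}. s ((\<lambda>k. if k = x then 1 else -1) k) (b k)) = 0"
      using xy by simp
    from indep_familyD[OF assms(2) _ _ this, of x] xy show False by simp
  qed
  have "independent (b ` K)"
    unfolding independent_explicit_module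
  proof (intro allI impI)
    fix t u v assume t: "finite t" "t \<subseteq> b ` K" "(\<Sum>v\<in>t. s (u v) v) = 0" "v \<in> t"
    define T where "T = {k\<in>K. b k \<in> t}"
    have bT: "b ` T = t" and injT: "inj_on b T"
      using t inj by (auto simp: T_def inj_on_def)
    then have "finite T" using t finite_image_iff by metis
    moreover have "(\<Sum>k\<in>T. s (u (b k)) (b k)) = 0"
      using t(3) sum.reindex[OF injT, of "\<lambda>v. s (u v) v"] by (simp add: bT)
    moreover have "T \<subseteq> K" by (auto simp: T_def)
    ultimately have "\<forall>k\<in>T. u (b k) = 0"
      using indep_familyD[OF assms(2), of T "\<lambda>k. u (b k)"] by blast
    then show "u v = 0" using bT t(4) by auto
  qed
  then show ?thesis using inj assms(3) by (simp add: is_basis_family_def)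
qed


section \<open>Fermionic creation and annihilation operators\<close>

text \<open>The lists encode the subsets of \<open>{1..N}\<close>, hence the ordered monomials in N
  anticommuting variables. The bound \<open>N\<close> is the induction parameter below.\<close>

definition decreasing_lists :: "nat \<Rightarrow> nat list set"
  where "decreasing_lists N = {ns. sorted_wrt (>) ns \<and> set ns \<subseteq> {1..N}}"

lemma decreasing_lists_0: "decreasing_lists 0 = {[]}"
  by (auto simp: decreasing_lists_def)

lemma decreasing_lists_Suc:
  "decreasing_lists (Suc N) = decreasing_lists N \<union> (Cons (Suc N)) ` decreasing_lists N"
proof (intro Set.set_eqI iffI)
  fix ns assume ns: "ns \<in> decreasing_lists (Suc N)"
  show "ns \<in> decreasing_lists N \<union> (Cons (Suc N)) ` decreasing_lists N"
  proof (cases ns)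
    case Nil then show ?thesis by (simp add: decreasing_lists_def)
  next
    case (Cons m ms)
    show ?thesis
    proof (cases "m = Suc N")
      case True
      then have "ms \<in> decreasing_lists N" using ns Cons by (force simp: decreasing_lists_def)
      then show ?thesis using True Cons by auto
    next
      case False
      then have "ns \<in> decreasing_lists N" using ns Cons by (force simp: decreasing_lists_def)
      then show ?thesis by auto
    qed
  qed
qed (force simp: decreasing_lists_def)

lemma finite_decreasing_lists: "finite (decreasing_lists N)"
  by (induction N) (simp_all add: decreasing_lists_0 decreasing_lists_Suc)

lemma decreasing_lists_mono: "N \<le> M \<Longrightarrow> decreasing_lists N \<subseteq> decreasing_lists M"
  by (auto simp: decreasing_lists_def)

lemma Union_decreasing_lists:
  "(\<Union>N. decreasing_lists N) = {ns. sorted_wrt (>) ns \<and> (\<forall>n\<in>set ns. n > 0)}"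
proof (intro Set.set_eqI iffI)
  fix ns :: "nat list" assume "ns \<in> {ns. sorted_wrt (>) ns \<and> (\<forall>n\<in>set ns. n > 0)}"
  moreover have "n \<le> sum_list ns" if "n \<in> set ns" for n
    using that by (rule member_le_sum_list) simp
  ultimately have "ns \<in> decreasing_lists (sum_list ns)"
    by (auto simp: decreasing_lists_def Suc_le_eq)
  then show "ns \<in> (\<Union>N. decreasing_lists N)" by blast
qed (auto simp: decreasing_lists_def Suc_le_eq)

text \<open>Creation operators \<open>X n\<close> and annihilation operators \<open>D n\<close> with
  scalar anticommutators. The \<open>X n\<close> may have nonzero anticommutators among themselves,
  and the pairing \<open>dx\<close> is only triangular with nonzero diagonal; ordered monomials
  still behave as in a Fock space.\<close>

locale fermions = vector_space s
  for s :: "complex \<Rightarrow> 'v::ab_group_add \<Rightarrow> 'v" +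
  fixes X D :: "nat \<Rightarrow> 'v \<Rightarrow> 'v" and xx dx :: "nat \<Rightarrow> nat \<Rightarrow> complex" and vac :: 'v
  assumes linX: "\<And>n. Vector_Spaces.linear s s (X n)"
    and linD: "\<And>n. Vector_Spaces.linear s s (D n)"
    and XX: "\<And>n m v. X n (X m v) + X m (X n v) = s (xx n m) v"
    and DX: "\<And>n m v. D n (X m v) + X m (D n v) = s (dx n m) v"
    and dx_diag: "\<And>n. n > 0 \<Longrightarrow> dx n n \<noteq> 0"
    and dx_lower: "\<And>n m. m > 0 \<Longrightarrow> m < n \<Longrightarrow> dx n m = 0"
    and D_vac: "\<And>n. n > 0 \<Longrightarrow> D n vac = 0"
    and vac_nz: "vac \<noteq> 0"
begin

definition xvec :: "nat list \<Rightarrow> 'v"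
  where "xvec ns = foldr X ns vac"

definition layer :: "nat \<Rightarrow> 'v set"
  where "layer N = span (xvec ` decreasing_lists N)"

lemma xvec_simps [simp]: "xvec [] = vac" "xvec (n # ns) = X n (xvec ns)"
  by (simp_all add: xvec_def)

lemma XX': "X n (X m v) = s (xx n m) v - X m (X n v)"
  using XX[of n m v] by (simp add: algebra_simps)

lemma XX_same: "X n (X n v) = s (xx n n / 2) v"
proof -
  have "s (1/2) (X n (X n v) + X n (X n v)) = s (1/2) (s (xx n n) v)" by (simp only: XX)
  moreover have "s (1/2) (X n (X n v) + X n (X n v)) = X n (X n v)"
    unfolding scale_right_distrib scale_left_distrib[symmetric] by simp
  ultimately show ?thesis by simp
qed

lemma DX': "D n (X m v) = s (dx n m) v - X m (D n v)"
  using DX[of n m v] by (simp add: algebra_simps)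

lemma layer_0: "layer 0 = span {vac}"
  by (simp add: layer_def decreasing_lists_0)

lemma layer_mono: "N \<le> M \<Longrightarrow> layer N \<subseteq> layer M"
  unfolding layer_def by (intro span_mono image_mono decreasing_lists_mono)

lemma X_layer: "w \<in> layer N \<Longrightarrow> X (Suc N) w \<in> layer (Suc N)"
  unfolding layer_def
proof (induction rule: span_induct_alt)
  case base
  then show ?case by (simp add: lin_zero[OF linX] span_zero)
next
  case (step c x y)
  then obtain a where a: "a \<in> decreasing_lists N" "x = xvec a" by blast
  then have "X (Suc N) x = xvec (Suc N # a)" "Suc N # a \<in> decreasing_lists (Suc N)"
    by (auto simp: decreasing_lists_Suc)
  then have "X (Suc N) x \<in> span (xvec ` decreasing_lists (Suc N))"
    by (metis imageI span_base)
  then show ?case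
    using step.IH by (simp add: lin_add[OF linX] lin_scale[OF linX] span_add span_scale)
qed

text \<open>A list bounded by \<open>Suc N\<close> either omits \<open>Suc N\<close> or begins with
  it, so a vector is at most linear in the top operator. The inductions on layers rest on this
  splitting.\<close>

lemma layer_SucE:
  assumes "w \<in> layer (Suc N)"
  obtains w0 w1 where "w0 \<in> layer N" "w1 \<in> layer N" "w = w0 + X (Suc N) w1"
proof -
  from assms have "\<exists>w0 w1. w0 \<in> layer N \<and> w1 \<in> layer N \<and> w = w0 + X (Suc N) w1"
    unfolding layer_def
  proof (induction rule: span_induct_alt)
    case base
    show ?case by (intro exI[of _ 0]) (simp add: lin_zero[OF linX] span_zero)
  next
    case (step c x y)
    then obtain w0 w1 where w: "w0 \<in> span (xvec ` decreasing_lists N)"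
      "w1 \<in> span (xvec ` decreasing_lists N)" "y = w0 + X (Suc N) w1" by blast
    from step(1) consider a where "a \<in> decreasing_lists N" "x = xvec a"
      | a where "a \<in> decreasing_lists N" "x = X (Suc N) (xvec a)"
      by (auto simp: decreasing_lists_Suc)
    then show ?case
    proof cases
      case 1
      then show ?thesis using w
        by (intro exI[of _ "s c x + w0"] exI[of _ w1])
          (simp add: add.assoc span_add span_scale span_base)
    next
      case 2
      then show ?thesis using w
        by (intro exI[of _ w0] exI[of _ "s c (xvec a) + w1"])
          (simp add: algebra_simps lin_add[OF linX] lin_scale[OF linX]
            span_add span_scale span_base)
    qed
  qed
  then show thesis using that by blast
qed

lemma layer_add: "v \<in> layer N \<Longrightarrow> w \<in> layer N \<Longrightarrow> v + w \<in> layer N"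
  and layer_diff: "v \<in> layer N \<Longrightarrow> w \<in> layer N \<Longrightarrow> v - w \<in> layer N"
  and layer_scale: "v \<in> layer N \<Longrightarrow> s c v \<in> layer N"
  by (simp_all add: layer_def span_add span_diff span_scale)

text \<open>Reordering costs only scalars: \<open>X n\<close> is moved past the top operator at the
  price of a scalar multiple of \<open>w1\<close>, and the top operator itself has a scalar
  square.\<close>

lemma X_layer_le: "w \<in> layer N \<Longrightarrow> n > 0 \<Longrightarrow> n \<le> N \<Longrightarrow> X n w \<in> layer N"
proof (induction N arbitrary: w)
  case (Suc N)
  from Suc.prems(1) obtain w0 w1 where w: "w0 \<in> layer N" "w1 \<in> layer N" "w = w0 + X (Suc N) w1"
    by (rule layer_SucE)
  have sub: "layer N \<subseteq> layer (Suc N)" by (simp add: layer_mono)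
  show ?case
  proof (cases "n = Suc N")
    case True
    then have "X n w = X (Suc N) w0 + s (xx n n / 2) w1"
      by (simp add: w lin_add[OF linX] XX_same)
    then show ?thesis using w sub by (auto intro!: layer_add layer_scale X_layer)
  next
    case False
    then have le: "n \<le> N" using Suc.prems by simp
    have "X n w = X n w0 + (s (xx n (Suc N)) w1 - X (Suc N) (X n w1))"
      unfolding w lin_add[OF linX] XX'[of n "Suc N"] ..
    moreover have "X n w0 \<in> layer N" "X n w1 \<in> layer N"
      using Suc.IH w Suc.prems le by auto
    ultimately show ?thesis using w sub by (auto intro!: layer_add layer_scale layer_diff X_layer)
  qed
qed simp

section \<open>Ordered monomials of arbitrary length\<close>

definition full :: "'v set"
  where "full = (\<Union>N. layer N)"

lemma full_eq_span: "full = span (xvec ` {ns. sorted_wrt (>) ns \<and> (\<forall>n\<in>set ns. n > 0)})"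
proof (intro Set.set_eqI iffI)
  fix w assume "w \<in> full"
  then show "w \<in> span (xvec ` {ns. sorted_wrt (>) ns \<and> (\<forall>n\<in>set ns. n > 0)})"
    unfolding full_def layer_def Union_decreasing_lists[symmetric]
    using span_mono[of "xvec ` decreasing_lists _"
        "xvec ` (\<Union>N. decreasing_lists N)"] by blast
next
  fix w assume "w \<in> span (xvec ` {ns. sorted_wrt (>) ns \<and> (\<forall>n\<in>set ns. n > 0)})"
  then show "w \<in> full"
    unfolding Union_decreasing_lists[symmetric]
  proof (induction rule: span_induct_alt)
    case base
    show ?case by (auto simp: full_def layer_def span_zero)
  next
    case (step c x y)
    then obtain N M where "x \<in> layer N" "y \<in> layer M"
      unfolding full_def layer_def by (blast intro: span_base)
    then have "x \<in> layer (max N M)" "y \<in> layer (max N M)"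
      using layer_mono[of N "max N M"] layer_mono[of M "max N M"] by auto
    then show ?case unfolding full_def by (blast intro: layer_add layer_scale)
  qed
qed

lemma subspace_full: "subspace full"
  unfolding full_eq_span by (rule subspace_span)

lemma vac_full: "vac \<in> full"
  unfolding full_def layer_def
  by (rule UN_I[of 0]) (auto simp: decreasing_lists_0 intro: span_base)

lemma X_full: "w \<in> full \<Longrightarrow> n > 0 \<Longrightarrow> X n w \<in> full"
proof -
  assume w: "w \<in> full" "n > 0"
  then obtain N where "w \<in> layer N" by (auto simp: full_def)
  then have "w \<in> layer (max N n)" using layer_mono[of N "max N n"] by auto
  then have "X n w \<in> layer (max N n)" using w by (intro X_layer_le) auto
  then show ?thesis by (auto simp: full_def)
qed

lemma full_least:
  assumes "subspace U" "vac \<in> U" "\<And>n w. n > 0 \<Longrightarrow> w \<in> U \<Longrightarrow> X n w \<in> U"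
  shows "full \<subseteq> U"
proof -
  have "xvec ns \<in> U" if "\<forall>n\<in>set ns. n > 0" for ns
    using that by (induction ns) (auto simp: assms)
  then show ?thesis unfolding full_eq_span by (intro span_minimal assms) auto
qed

text \<open>By \<open>dx_lower\<close>, \<open>D n\<close> anticommutes to zero with every
  \<open>X m\<close> for 0 < m < n, so it passes through to the vacuum and kills it.\<close>

lemma D_layer: "w \<in> layer N \<Longrightarrow> n > N \<Longrightarrow> D n w = 0"
proof (induction N arbitrary: w)
  case 0
  then obtain c where "w = s c vac" by (auto simp: layer_0 span_singleton)
  then show ?case using 0 by (simp add: lin_scale[OF linD] D_vac)
next
  case (Suc N)
  from Suc.prems(1) obtain w0 w1 where w: "w0 \<in> layer N" "w1 \<in> layer N" "w = w0 + X (Suc N) w1"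
    by (rule layer_SucE)
  then show ?case using Suc
    by (simp add: lin_add[OF linD] DX' lin_zero[OF linX] dx_lower)
qed

lemma D_X_Suc: "w \<in> layer N \<Longrightarrow> D (Suc N) (X (Suc N) w) = s (dx (Suc N) (Suc N)) w"
  by (simp add: DX' D_layer lin_zero[OF linX])

text \<open>On \<open>w0 + X (Suc N) w1\<close> the operator \<open>D (Suc N)\<close> returns a
  nonzero multiple of \<open>w1\<close>. So \<open>w1 = 0\<close>, and the vector descends layer by
  layer to the vacuum line.\<close>

lemma kernel_layer:
  assumes "w \<in> layer N" "\<And>n. n > 0 \<Longrightarrow> D n w = 0"
  shows "w \<in> span {vac}"
  using assms(1)
proof (induction N)
  case 0
  then show ?case by (simp add: layer_0)
next
  case (Suc N)
  from Suc.prems(1) obtain w0 w1 where w: "w0 \<in> layer N" "w1 \<in> layer N" "w = w0 + X (Suc N) w1"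
    by (rule layer_SucE)
  then have "D (Suc N) w = s (dx (Suc N) (Suc N)) w1"
    by (simp add: lin_add[OF linD] D_X_Suc D_layer)
  then have "w1 = 0" using assms(2)[of "Suc N"] dx_diag[of "Suc N"] by simp
  then show ?case using Suc.IH w by (simp add: lin_zero[OF linX])
qed

lemma kernel_full:
  assumes "w \<in> full" "\<And>n. n > 0 \<Longrightarrow> D n w = 0"
  shows "w \<in> span {vac}"
  using assms kernel_layer by (auto simp: full_def)

text \<open>Applying \<open>D (Suc N)\<close> to the relation isolates the lists that begin with
  \<open>Suc N\<close>; both halves are then relations one layer lower.\<close>

lemma xvec_indep_layer:
  "(\<Sum>ns\<in>decreasing_lists N. s (c ns) (xvec ns)) = 0 \<Longrightarrow> ns \<in> decreasing_lists N \<Longrightarrow> c ns = 0"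
proof (induction N arbitrary: c ns)
  case 0
  then show ?case using vac_nz by (simp add: decreasing_lists_0)
next
  case (Suc N)
  let ?w0 = "\<Sum>ns\<in>decreasing_lists N. s (c ns) (xvec ns)"
  let ?w1 = "\<Sum>ns\<in>decreasing_lists N. s (c (Suc N # ns)) (xvec ns)"
  have disj: "decreasing_lists N \<inter> (Cons (Suc N)) ` decreasing_lists N = {}"
    by (auto simp: decreasing_lists_def)
  have "(\<Sum>ns\<in>decreasing_lists (Suc N). s (c ns) (xvec ns)) = ?w0 + X (Suc N) ?w1"
    unfolding decreasing_lists_Suc
    by (subst sum.union_disjoint)
      (auto simp: finite_decreasing_lists disj sum.reindex lin_sum[OF linX] lin_scale[OF linX])
  then have eq: "?w0 + X (Suc N) ?w1 = 0" using Suc.prems by simp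
  have w: "?w0 \<in> layer N" "?w1 \<in> layer N"
    unfolding layer_def by (auto intro!: span_sum intro: span_scale span_base)
  have "D (Suc N) (?w0 + X (Suc N) ?w1) = s (dx (Suc N) (Suc N)) ?w1"
    using w by (simp only: lin_add[OF linD] D_X_Suc) (simp add: D_layer)
  then have w1: "?w1 = 0" using dx_diag[of "Suc N"] by (simp add: eq lin_zero[OF linD])
  then have w0: "?w0 = 0" using eq by (simp add: lin_zero[OF linX])
  from Suc.prems(2) show ?case
    unfolding decreasing_lists_Suc using Suc.IH[OF w0] Suc.IH[OF w1] by auto
qed

lemma indep_xvec: "indep_family s {ns. sorted_wrt (>) ns \<and> (\<forall>n\<in>set ns. n > 0)} xvec"
  unfolding indep_family_def
proof (intro allI impI ballI)
  fix T c k assume T: "finite T" "T \<subseteq> {ns. sorted_wrt (>) ns \<and> (\<forall>n\<in>set ns. n > 0)}"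
    "(\<Sum>k\<in>T. s (c k) (xvec k)) = 0" "k \<in> T"
  from T(2) have "\<forall>k\<in>T. \<exists>N. k \<in> decreasing_lists N"
    unfolding Union_decreasing_lists[symmetric] by blast
  then obtain f where f: "\<And>k. k \<in> T \<Longrightarrow> k \<in> decreasing_lists (f k)" by metis
  define N where "N = Max (f ` T)"
  have sub: "T \<subseteq> decreasing_lists N"
    using f T(1) decreasing_lists_mono[of "f _" N] by (force simp: N_def)
  have "(\<Sum>k\<in>decreasing_lists N. s (if k \<in> T then c k else 0) (xvec k)) =
      (\<Sum>k\<in>T. s (if k \<in> T then c k else 0) (xvec k))"
    by (rule sum.mono_neutral_right) (auto simp: finite_decreasing_lists sub)
  then have "(\<Sum>k\<in>decreasing_lists N. s (if k \<in> T then c k else 0) (xvec k)) = 0"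
    using T(3) by simp
  from xvec_indep_layer[OF this, of k] sub T(4) show "c k = 0" by auto
qed

end

section \<open>The Clifford module and the modes of \<open>G(z)\<close>\<close>

locale clifford = vector_space s
  for s :: "complex \<Rightarrow> 'v::ab_group_add \<Rightarrow> 'v" +
  fixes i :: nat and Phi :: "int \<Rightarrow> 'v \<Rightarrow> 'v" and vac :: 'v
  assumes FT: "is_FT i s Phi vac"
begin

definition phi0 :: complex
  where "phi0 = (-1) ^ i / (complex_of_real (sqrt 2) * \<i>)"

lemma phi0_sq: "phi0 * phi0 = - (1/2)"
proof -
  have "complex_of_real (sqrt 2) * complex_of_real (sqrt 2) = 2"
    by (simp flip: of_real_mult)
  then have "(complex_of_real (sqrt 2) * \<i>) * (complex_of_real (sqrt 2) * \<i>) = -2"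
    by (simp add: algebra_simps)
  moreover have "((-1::complex) ^ i) * ((-1) ^ i) = 1"
    by (simp flip: power_mult_distrib)
  ultimately show ?thesis by (simp add: phi0_def)
qed

lemma phi0_nz: "phi0 \<noteq> 0"
  using phi0_sq by auto

lemma linPhi: "Vector_Spaces.linear s s (Phi R)"
  and PhiPhi: "Phi R (Phi Q v) + Phi Q (Phi R v) = s (if R + Q = 0 then - ((-1) powi R) else 0) v"
  and vac_nz: "vac \<noteq> 0"
  and Phi_pos_vac: "R > 0 \<Longrightarrow> Phi R vac = 0"
  and Phi_0_vac: "Phi 0 vac = s phi0 vac"
  using FT by (simp_all add: is_FT_def CLtw_module_def phi0_def)

lemmas Phi_simps = lin_add[OF linPhi] lin_scale[OF linPhi] lin_zero[OF linPhi]
  lin_diff[OF linPhi] lin_neg[OF linPhi] lin_sum[OF linPhi]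

lemma PhiPhi': "Phi R (Phi Q v) = s (if R + Q = 0 then - ((-1) powi R) else 0) v - Phi Q (Phi R v)"
  using PhiPhi[of R Q v] by (simp add: algebra_simps)

text \<open>Irreducibility as an induction principle: a linear property that holds for the vacuum
  and is preserved by all \<open>Phi R\<close> holds for every vector.\<close>

lemma Phi_hull:
  assumes "subspace U" "vac \<in> U" "\<And>R w. w \<in> U \<Longrightarrow> Phi R w \<in> U"
  shows "U = UNIV"
proof -
  have "irreducible_under s (range Phi)" using FT by (simp add: is_FT_def)
  then have "U = {0} \<or> U = UNIV"
    using assms unfolding irreducible_under_def is_subspace_def by blast
  then show ?thesis using assms(2) vac_nz by auto
qed

text \<open>High modes are known to kill the vacuum only. The vectors with such a bound form a
  submodule, since moving \<open>Phi R\<close> past \<open>Phi Q\<close> leaves a scalar only at R =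
  -Q.\<close>

lemma locally_finite: "\<exists>B. \<forall>R>B. Phi R v = 0"
proof -
  let ?U = "{v. \<exists>B. \<forall>R>B. Phi R v = 0}"
  have "?U = UNIV"
  proof (rule Phi_hull)
    show "subspace ?U"
      unfolding subspace_def
    proof (intro conjI ballI allI)
      fix x y assume "x \<in> ?U" "y \<in> ?U"
      then obtain B C where "\<forall>R>B. Phi R x = 0" "\<forall>R>C. Phi R y = 0" by blast
      then have "\<forall>R>max B C. Phi R (x + y) = 0" by (simp add: Phi_simps)
      then show "x + y \<in> ?U" by blast
    next
      fix c x assume "x \<in> ?U"
      then obtain B where "\<forall>R>B. Phi R x = 0" by blast
      then have "\<forall>R>B. Phi R (s c x) = 0" by (simp add: Phi_simps)
      then show "s c x \<in> ?U" by blast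
    qed (simp add: Phi_simps)
    show "vac \<in> ?U" using Phi_pos_vac by blast
    fix Q w assume "w \<in> ?U"
    then obtain B where B: "\<forall>R>B. Phi R w = 0" by blast
    then have "\<forall>R>max B (- Q). Phi R (Phi Q w) = 0"
      by (simp add: PhiPhi'[of _ Q] Phi_simps)
    then show "Phi Q w \<in> ?U" by blast
  qed
  then show ?thesis by blast
qed

lemma common_bound:
  assumes "finite S"
  shows "\<exists>B\<ge>b. \<forall>v\<in>S. \<forall>R>B. Phi R v = 0"
  using assms
proof (induction S)
  case (insert v S)
  then obtain B where B: "B \<ge> b" "\<forall>v\<in>S. \<forall>R>B. Phi R v = 0" by blast
  obtain C where C: "\<forall>R>C. Phi R v = 0" using locally_finite by blast
  show ?case using B C by (intro exI[of _ "max B C"]) auto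
qed auto

end

locale clifford_chi = clifford s i Phi vac
  for s :: "complex \<Rightarrow> 'v::ab_group_add \<Rightarrow> 'v" and i Phi vac +
  fixes P :: nat and \<chi> :: "complex fls"
  assumes chi: "\<And>N. N > int P \<Longrightarrow> chi_mode \<chi> N = 0"
begin

abbreviation G :: "int \<Rightarrow> 'v \<Rightarrow> 'v"
  where "G \<equiv> G_mode s Phi \<chi>"

text \<open>The coefficient of \<open>Phi m\<close> in \<open>G R\<close>. The derivative
  contributes -r - 1/2 = -(R + 1)/2 on the diagonal; the lowest mode that can occur is m = R -
  P.\<close>

definition gc :: "int \<Rightarrow> int \<Rightarrow> complex"
  where "gc R m = chi_mode \<chi> (R - m) - (if m = R then (of_int R + 1) / 2 else 0)"

lemma gc_eq_0: "m < R - int P \<Longrightarrow> gc R m = 0"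
  by (simp add: gc_def chi)

text \<open>The formal sum reduces to a window of modes: below R - P the coefficients vanish, above
  \<open>B\<close> the vector is killed.\<close>

lemma G_eq_sum:
  assumes "\<And>m. m > B \<Longrightarrow> Phi m v = 0"
  shows "G R v = (\<Sum>m\<in>{R - int P..B}. s (gc R m) (Phi m v))"
proof -
  have bij: "bij (\<lambda>m. R - m)" by (rule involuntory_imp_bij) simp
  have "Sum_any (\<lambda>N. s (chi_mode \<chi> N) (Phi (R - N) v)) =
      Sum_any (\<lambda>m. s (chi_mode \<chi> (R - m)) (Phi m v))"
    by (rule Sum_any.reindex_cong[OF bij]) (simp add: fun_eq_iff)
  also have "\<dots> = (\<Sum>m\<in>{R - int P..B}. s (chi_mode \<chi> (R - m)) (Phi m v))"
    by (rule Sum_any.expand_superset) (use assms chi in \<open>auto intro!: leI\<close>)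
  finally have 1: "G R v = s (- ((of_int R + 1) / 2)) (Phi R v) +
      (\<Sum>m\<in>{R - int P..B}. s (chi_mode \<chi> (R - m)) (Phi m v))"
    by (simp add: G_mode_def add_divide_distrib)
  have "(\<Sum>m\<in>{R - int P..B}. s (gc R m) (Phi m v)) =
      (\<Sum>m\<in>{R - int P..B}. s (chi_mode \<chi> (R - m)) (Phi m v)) -
      (\<Sum>m\<in>{R - int P..B}. if R = m then s ((of_int R + 1) / 2) (Phi R v) else 0)"
    unfolding sum_subtractf[symmetric]
    by (rule sum.cong) (auto simp: gc_def scale_left_diff_distrib)
  \<comment> \<open>If R lies outside the window, then R > B because R \<ge> R - P, so
    \<open>Phi R v = 0\<close> and the equation still holds.\<close>
  also have "(\<Sum>m\<in>{R - int P..B}. if R = m then s ((of_int R + 1) / 2) (Phi R v) else 0) =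
      s ((of_int R + 1) / 2) (Phi R v)"
    using assms[of R] by (auto simp: sum.delta)
  finally show ?thesis using 1 by simp
qed

lemma linG: "Vector_Spaces.linear s s (G R)"
proof (rule linearI')
  fix x y c
  obtain B where B: "\<forall>v\<in>{x, y}. \<forall>R>B. Phi R v = 0"
    using common_bound[of "{x, y}" 0] by auto
  then show "G R (x + y) = G R x + G R y"
    by (subst (1 2 3) G_eq_sum[of B]) (auto simp: Phi_simps scale_right_distrib sum.distrib)
  show "G R (s c x) = s c (G R x)"
    using B by (subst (1 2) G_eq_sum[of B]) (auto simp: Phi_simps scale_sum_right mult.commute)
qed (rule vector_space_axioms)+

lemmas G_simps = lin_add[OF linG] lin_scale[OF linG] lin_zero[OF linG]
  lin_diff[OF linG] lin_neg[OF linG] lin_sum[OF linG]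

lemma G_Phi: "G R (Phi Q v) + Phi Q (G R v) = s (- ((-1) powi Q) * gc R (- Q)) v"
proof -
  \<comment> \<open>The bound is at least -Q, so the only mode with a nonzero anticommutator, m =
    -Q, is not cut off from above.\<close>
  obtain B where B: "B \<ge> - Q" "\<forall>v\<in>{v, Phi Q v}. \<forall>R>B. Phi R v = 0"
    using common_bound[of "{v, Phi Q v}" "- Q"] by auto
  have "G R (Phi Q v) + Phi Q (G R v) =
      (\<Sum>m\<in>{R - int P..B}. s (gc R m) (Phi Q (Phi m v) + Phi m (Phi Q v)))"
    using B by (subst (1 2) G_eq_sum[of B])
      (auto simp: Phi_simps scale_right_distrib sum.distrib add.commute)
  also have "\<dots> = (\<Sum>m\<in>{R - int P..B}. if - Q = m then s (- ((-1) powi Q) * gc R (- Q)) v else 0)"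
    by (rule sum.cong) (auto simp: PhiPhi mult.commute)
  also have "\<dots> = s (- ((-1) powi Q) * gc R (- Q)) v"
    using B(1) gc_eq_0[of "- Q" R] by (auto simp: sum.delta)
  finally show ?thesis .
qed

text \<open>The scalar by which the anticommutator of \<open>G R\<close> and \<open>G Q\<close>
  acts. Outside the range of summation one of the two coefficients vanishes by
  \<open>gc_eq_0\<close>.\<close>

definition gg :: "int \<Rightarrow> int \<Rightarrow> complex"
  where "gg R Q = (\<Sum>m\<in>{Q - int P..int P - R}. - ((-1) powi m) * gc R (- m) * gc Q m)"

lemma G_G: "G R (G Q v) + G Q (G R v) = s (gg R Q) v"
proof -
  obtain B where B: "B \<ge> int P - R" "\<forall>v\<in>{v, G R v}. \<forall>R>B. Phi R v = 0"
    using common_bound[of "{v, G R v}" "int P - R"] by auto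
  have Gv: "G Q v = (\<Sum>m\<in>{Q - int P..B}. s (gc Q m) (Phi m v))"
    "G Q (G R v) = (\<Sum>m\<in>{Q - int P..B}. s (gc Q m) (Phi m (G R v)))"
    using B(2) by (auto intro!: G_eq_sum)
  have "G R (G Q v) + G Q (G R v) =
      (\<Sum>m\<in>{Q - int P..B}. s (gc Q m) (G R (Phi m v) + Phi m (G R v)))"
    by (subst Gv(1), subst Gv(2)) (simp add: G_simps scale_right_distrib sum.distrib)
  also have "\<dots> = s (\<Sum>m\<in>{Q - int P..B}. - ((-1) powi m) * gc R (- m) * gc Q m) v"
    unfolding scale_sum_left by (rule sum.cong) (auto simp: G_Phi mult_ac)
  also have "(\<Sum>m\<in>{Q - int P..B}. - ((-1) powi m) * gc R (- m) * gc Q m) = gg R Q"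
    unfolding gg_def by (rule sum.mono_neutral_right) (use B in \<open>auto simp: gc_eq_0\<close>)
  finally show ?thesis .
qed

end

locale clifford_chi_lead = clifford_chi +
  assumes lead: "\<And>n::nat. n > 0 \<Longrightarrow> gc (int P - int n) (- int n) \<noteq> 0"
begin

text \<open>The anticommutator of \<open>Phi n\<close> with \<open>G (P - m)\<close> is, up to sign,
  the coefficient at -n. It vanishes for m < n and is the leading coefficient for m = n, which is
  the triangularity required.\<close>

sublocale fermions s "\<lambda>n. G (int P - int n)" "\<lambda>n. Phi (int n)"
  "\<lambda>n m. gg (int P - int n) (int P - int m)"
  "\<lambda>n m. - ((-1) powi (int n)) * gc (int P - int m) (- int n)" vac
proof
  fix n m v
  show "Phi (int n) (G (int P - int m) v) + G (int P - int m) (Phi (int n) v) =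
      s (- ((-1) powi (int n)) * gc (int P - int m) (- int n)) v"
    using G_Phi[of "int P - int m" "int n" v] by (simp add: add.commute)
qed (auto simp: G_simps Phi_simps G_G lead gc_eq_0 Phi_pos_vac vac_nz)

text \<open>In \<open>G (P - n) vac\<close> the term of \<open>Phi (-n)\<close> has a nonzero
  coefficient, and the other terms are \<open>Phi m vac\<close> with -n < m \<le> 0. So the relation
  can be solved for \<open>Phi (-n) vac\<close> by induction on n.\<close>

lemma Phi_vac_full: "Phi m vac \<in> full"
proof -
  have neg: "Phi (- int n) vac \<in> full" for n
  proof (induction n rule: less_induct)
    case (less n)
    show ?case
    proof (cases "n = 0")
      case True
      then show ?thesis using subspace_scale[OF subspace_full vac_full] by (simp add: Phi_0_vac)
    next
      case False
      let ?X = "G (int P - int n) vac"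
      have "?X = (\<Sum>m\<in>{- int n..0}. s (gc (int P - int n) m) (Phi m vac))"
        by (subst G_eq_sum[of 0]) (auto simp: Phi_pos_vac)
      also have "{- int n..0} = insert (- int n) {- int n<..0}" by auto
      finally have "s (gc (int P - int n) (- int n)) (Phi (- int n) vac) =
          ?X - (\<Sum>m\<in>{- int n<..0}. s (gc (int P - int n) m) (Phi m vac))"
        by simp
      moreover have "?X \<in> full" using False X_full[OF vac_full] by simp
      moreover have "Phi m vac \<in> full" if "m \<in> {- int n<..0}" for m
        using less.IH[of "nat (- m)"] that by (auto simp: nat_less_iff)
      ultimately have "s (gc (int P - int n) (- int n)) (Phi (- int n) vac) \<in> full"
        by (auto intro!: subspace_diff[OF subspace_full] subspace_sum[OF subspace_full]
            subspace_scale[OF subspace_full])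
      from subspace_scale[OF subspace_full this, of "1 / gc (int P - int n) (- int n)"]
      show ?thesis using lead[of n] False by simp
    qed
  qed
  show ?thesis
  proof (cases "m > 0")
    case True
    then show ?thesis by (simp add: Phi_pos_vac subspace_0 subspace_full)
  next
    case False
    then show ?thesis using neg[of "nat (- m)"] by simp
  qed
qed

text \<open>The vectors of \<open>full\<close> whose images under all \<open>Phi m\<close> stay in
  \<open>full\<close> include the vacuum and are preserved by the creation operators, because moving
  \<open>Phi m\<close> past \<open>G\<close> leaves a scalar. So \<open>full\<close> is a Clifford
  submodule and irreducibility applies.\<close>

lemma full_UNIV: "full = UNIV"
proof (rule Phi_hull)
  let ?U = "{w \<in> full. \<forall>m. Phi m w \<in> full}"
  have "full \<subseteq> ?U"
  proof (rule full_least)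
    show "subspace ?U"
      using subspace_full unfolding subspace_def by (auto simp: Phi_simps)
    show "vac \<in> ?U" by (simp add: vac_full Phi_vac_full)
    fix n :: nat and w assume n: "n > 0" and w: "w \<in> ?U"
    have "Phi m (G (int P - int n) w) \<in> full" for m
    proof -
      have "Phi m (G (int P - int n) w) =
          s (- ((-1) powi m) * gc (int P - int n) (- m)) w - G (int P - int n) (Phi m w)"
        using G_Phi[of "int P - int n" m w] by (simp add: algebra_simps)
      then show ?thesis
        using w n X_full[of "Phi m w" n] by (auto intro!: subspace_diff subspace_neg subspace_scale subspace_full)
    qed
    then show "G (int P - int n) w \<in> ?U" using w n X_full by auto
  qed
  then show "\<And>R w. w \<in> full \<Longrightarrow> Phi R w \<in> full" by blast
qed (rule subspace_full vac_full)+

lemma G_stable_UNIV: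
  assumes "subspace U" "vac \<in> U" "\<And>R w. w \<in> U \<Longrightarrow> G R w \<in> U"
  shows "U = UNIV"
  using full_least[of U] assms full_UNIV by auto

lemma killed_by_positive:
  assumes "\<And>R. R > 0 \<Longrightarrow> Phi R w = 0"
  obtains c where "w = s c vac"
proof -
  have "w \<in> span {vac}" by (rule kernel_full) (auto simp: full_UNIV assms)
  then show thesis using that by (auto simp: span_singleton)
qed

lemma span_xvec:
  "span (xvec ` {ns. sorted_wrt (>) ns \<and> (\<forall>n\<in>set ns. n > 0)}) = UNIV"
  using full_eq_span full_UNIV by simp

end

section \<open>Irreducibility under the modes of \<open>G(z)\<close>\<close>

context vector_space
begin

text \<open>If the highest operator that may act nontrivially does not kill \<open>w\<close>, then
  \<open>w\<close> is replaced by its image. Its square is zero by anticommutation, so the image is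
  killed by it and still by all higher operators.\<close>

lemma anticommuting_descent:
  fixes A :: "nat \<Rightarrow> 'b \<Rightarrow> 'b"
  assumes two: "(2::'a) \<noteq> 0"
    and lin: "\<And>n. A n 0 = 0"
    and anti: "\<And>n m v. n > 0 \<Longrightarrow> m > 0 \<Longrightarrow> A n (A m v) = - A m (A n v)"
    and stable: "\<And>n v. n > 0 \<Longrightarrow> v \<in> U \<Longrightarrow> A n v \<in> U"
    and w: "w \<in> U" "w \<noteq> 0" "\<And>n. n > N \<Longrightarrow> A n w = 0"
  shows "\<exists>w'\<in>U. w' \<noteq> 0 \<and> (\<forall>n>0. A n w' = 0)"
  using w
proof (induction N arbitrary: w)
  case (Suc N)
  show ?case
  proof (cases "A (Suc N) w = 0")
    case True
    then have "A n w = 0" if "n > N" for n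
      using Suc.prems(3)[of n] that by (cases "n = Suc N") auto
    then show ?thesis using Suc.IH[of w] Suc.prems by blast
  next
    case False
    have sq: "A (Suc N) (A (Suc N) w) = 0"
    proof -
      have "scale 2 (A (Suc N) (A (Suc N) w)) = 0"
        using anti[of "Suc N" "Suc N" w] scale_left_distrib[of 1 1 "A (Suc N) (A (Suc N) w)"]
        by (simp add: eq_neg_iff_add_eq_0)
      then show ?thesis using two by simp
    qed
    have "A n (A (Suc N) w) = 0" if "n > N" for n
      using Suc.prems(3)[of n] anti[of n "Suc N" w] sq that lin by (cases "n = Suc N") auto
    then show ?thesis using Suc.IH[of "A (Suc N) w"] Suc.prems stable False by blast
  qed
qed auto

end

section \<open>Nonzero submodules contain the vacuum: the nonresonant and the resonant case\<close>

context clifford_chi_lead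
begin

lemma positive_anticommute: "R > 0 \<Longrightarrow> Q > 0 \<Longrightarrow> Phi R (Phi Q v) = - Phi Q (Phi R v)"
  by (simp add: PhiPhi'[of R Q])

lemma locally_finite_nat: "\<exists>N. \<forall>n>N. Phi (int n) w = 0"
proof -
  obtain B where "\<forall>R>B. Phi R w = 0" using locally_finite by blast
  then show ?thesis by (intro exI[of _ "nat B"]) auto
qed

text \<open>\<open>G (m + P)\<close> begins with a nonzero multiple of \<open>Phi m\<close>, so
  downward induction from a mode that kills \<open>v\<close> recovers all positive
  \<open>Phi m\<close>. Descent then yields a vector killed by all of them, a multiple of the
  vacuum.\<close>

lemma vac_mem_nonresonant:
  assumes nonres: "\<And>m. m > 0 \<Longrightarrow> gc (m + int P) m \<noteq> 0"
    and U: "subspace U" "\<And>R w. w \<in> U \<Longrightarrow> G R w \<in> U" "w \<in> U" "w \<noteq> 0"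
  shows "vac \<in> U"
proof -
  have stable: "Phi m v \<in> U" if v: "v \<in> U" and "m > 0" for v m
  proof -
    obtain B where B: "\<forall>R>B. Phi R v = 0" using locally_finite by blast
    show ?thesis using \<open>m > 0\<close>
    proof (induction "nat (B - m)" arbitrary: m rule: less_induct)
      case less
      show ?case
      proof (cases "m > B")
        case True
        then show ?thesis using B by (simp add: subspace_0 U)
      next
        case False
        have "G (m + int P) v = (\<Sum>k\<in>{m..B}. s (gc (m + int P) k) (Phi k v))"
          using B by (subst G_eq_sum[of B]) auto
        also have "{m..B} = insert m {m<..B}" using False by auto
        finally have "s (gc (m + int P) m) (Phi m v) =
            G (m + int P) v - (\<Sum>k\<in>{m<..B}. s (gc (m + int P) k) (Phi k v))"
          by simp
        moreover have "Phi k v \<in> U" if "k \<in> {m<..B}" for k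
          using less that by (intro less.hyps) auto
        ultimately have "s (gc (m + int P) m) (Phi m v) \<in> U"
          using U v by (auto intro!: subspace_diff[of U] subspace_sum[of U] subspace_scale[of U])
        from subspace_scale[OF U(1) this, of "1 / gc (m + int P) m"]
        show ?thesis using nonres less.prems by simp
      qed
    qed
  qed
  obtain N where "\<forall>n>N. Phi (int n) w = 0" using locally_finite_nat by blast
  then have "\<exists>w'\<in>U. w' \<noteq> 0 \<and> (\<forall>n>0. Phi (int n) w' = 0)"
    using U stable
    by (intro anticommuting_descent[where w = w and N = N])
      (auto simp: Phi_simps intro: positive_anticommute)
  then obtain w' where w': "w' \<in> U" "w' \<noteq> 0" "\<forall>n>0. Phi (int n) w' = 0" by blast
  have "Phi R w' = 0" if "R > 0" for R
    using w'(3)[rule_format, of "nat R"] that by simp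
  then obtain c where c: "w' = s c vac" by (rule killed_by_positive)
  with w' have "c \<noteq> 0" by auto
  with subspace_scale[OF U(1) w'(1), of "1 / c"] show ?thesis by (simp add: c)
qed

text \<open>The vector \<open>\<Psi> = \<Sum>r. (-1)\<^bsup>2r\<^esup> t\<^bsub>-r\<^esub> \<Phi>(r)\<close> anticommutes with all \<open>G(r)\<close>, and the \<open>G(r)\<close> span its
  orthogonal complement topologically; \<open>\<kappa>\<close> is the norm of \<open>\<Psi>\<close> up to sign. If it does not vanish,
  \<open>\<Psi>\<close> is not in this complement and the two lowest weight vectors \<open>vac\<close> and \<open>\<Psi> vac\<close> generate
  each other.\<close>

lemma vac_mem_resonant:
  assumes P: "P = 0" and L: "L > 0"
    and lead': "\<And>R. R \<noteq> L \<Longrightarrow> gc R R \<noteq> 0"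
    and t: "t L = 1" "\<And>R. R > L \<Longrightarrow> t R = 0" "\<And>R. (\<Sum>m\<in>{R..L}. gc R m * t m) = 0"
    and kappa: "(\<Sum>R\<in>{-L..L}. (-1) powi R * t R * t (- R)) \<noteq> 0"
    and U: "subspace U" "\<And>R w. w \<in> U \<Longrightarrow> G R w \<in> U" "w \<in> U" "w \<noteq> 0"
  shows "vac \<in> U"
proof -
  \<comment> \<open>By the relations for \<open>t\<close>, each \<open>Phi k\<close> in
    \<open>G R\<close> may be replaced by \<open>A k\<close>. As \<open>A L = 0\<close>, the
    vanishing leading coefficient at R = L does no harm.\<close>
  define A where "A R v = Phi R v - s (t R) (Phi L v)" for R v
  have stable: "A R v \<in> U" if v: "v \<in> U" for R v
  proof -
    obtain B where B: "B \<ge> L" "\<forall>R>B. Phi R v = 0" using common_bound[of "{v}" L] by auto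
    show ?thesis
    proof (induction "nat (B - R)" arbitrary: R rule: less_induct)
      case less
      consider "R > B" | "R = L" | "R \<le> B" "R \<noteq> L" by linarith
      then show ?case
      proof cases
        case 1
        then show ?thesis using B t(2)[of R] by (simp add: A_def subspace_0 U)
      next
        case 2
        then show ?thesis by (simp add: A_def t subspace_0 U)
      next
        case 3
        have z: "(\<Sum>m\<in>{R..B}. gc R m * t m) = 0"
          unfolding t(3)[of R, symmetric]
          by (rule sum.mono_neutral_right) (use B in \<open>auto simp: t(2)\<close>)
        have "G R v = (\<Sum>k\<in>{R..B}. s (gc R k) (Phi k v))"
          using B P by (subst G_eq_sum[of B]) auto
        also have "\<dots> = (\<Sum>k\<in>{R..B}. s (gc R k) (Phi k v)) - s (\<Sum>m\<in>{R..B}. gc R m * t m) (Phi L v)"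
          by (simp add: z)
        also have "\<dots> = (\<Sum>k\<in>{R..B}. s (gc R k) (A k v))"
          by (simp add: A_def scale_right_diff_distrib sum_subtractf scale_sum_left)
        also have "{R..B} = insert R {R<..B}" using 3 by auto
        finally have "s (gc R R) (A R v) = G R v - (\<Sum>k\<in>{R<..B}. s (gc R k) (A k v))"
          by simp
        moreover have "A k v \<in> U" if "k \<in> {R<..B}" for k
          using that 3 by (intro less.hyps) auto
        ultimately have "s (gc R R) (A R v) \<in> U"
          using U v by (auto intro!: subspace_diff[of U] subspace_sum[of U] subspace_scale[of U])
        from subspace_scale[OF U(1) this, of "1 / gc R R"]
        show ?thesis using lead' 3 by simp
      qed
    qed
  qed
  have LL: "Phi L (Phi L v) = 0" for v
    using PhiPhi[of L L v] L scale_left_distrib[of 1 1 "Phi L (Phi L v)"]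
      scale_eq_0_iff[of 2 "Phi L (Phi L v)"] by simp
  have "\<exists>w'\<in>U. w' \<noteq> 0 \<and> (\<forall>n>0. A (int n) w' = 0)"
  proof -
    obtain N where N: "\<forall>n>N. Phi (int n) w = 0" using locally_finite_nat by blast
    have "A (int n) w = 0" if "n > max N (nat L)" for n
    proof -
      from that have "L < int n" by auto
      then show ?thesis using that N t(2)[of "int n"] by (simp add: A_def)
    qed
    moreover have "A (int n) (A (int m) v) = - A (int m) (A (int n) v)" if "n > 0" "m > 0" for n m v
    proof -
      have "A (int n) (A (int m) v) + A (int m) (A (int n) v) =
          (Phi (int n) (Phi (int m) v) + Phi (int m) (Phi (int n) v))
          - s (t (int m)) (Phi (int n) (Phi L v) + Phi L (Phi (int n) v))
          - s (t (int n)) (Phi (int m) (Phi L v) + Phi L (Phi (int m) v))"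
        by (simp add: A_def Phi_simps LL algebra_simps)
      also have "\<dots> = 0" using that L by (simp add: PhiPhi)
      finally show ?thesis by (simp add: eq_neg_iff_add_eq_0)
    qed
    ultimately show ?thesis
      using U stable
      by (intro anticommuting_descent[where w = w and N = "max N (nat L)"])
        (auto simp: A_def Phi_simps)
  qed
  then obtain w' where w': "w' \<in> U" "w' \<noteq> 0" "\<forall>n>0. A (int n) w' = 0" by blast
  have Phi_w': "Phi R w' = s (t R) (Phi L w')" if "R > 0" for R
    using w'(3)[rule_format, of "nat R"] that by (simp add: A_def)
  have "Phi R (Phi L w') = 0" if "R > 0" for R
    using positive_anticommute[OF that L, of w'] Phi_w'[OF that] LL by (simp add: Phi_simps)
  then obtain c where c: "Phi L w' = s c vac" by (rule killed_by_positive)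
  \<comment> \<open>If c = 0, then \<open>w'\<close> is a multiple of the vacuum. Otherwise a
    multiple of \<open>w'\<close> has the same images under the positive modes as
    \<open>Psi vac\<close>, and the two differ by a multiple of the vacuum.\<close>
  show ?thesis
  proof (cases "c = 0")
    case True
    then have "Phi R w' = 0" if "R > 0" for R using Phi_w'[OF that] c by simp
    then obtain d where d: "w' = s d vac" by (rule killed_by_positive)
    with w' have "d \<noteq> 0" by auto
    with subspace_scale[OF U(1) w'(1), of "1 / d"] show ?thesis by (simp add: d)
  next
    case False
    \<comment> \<open>The series is cut off at R = L, beyond which its terms kill the vacuum. The
      anticommutator with \<open>Phi Q\<close> stays correct for Q \<ge> -L, the range used
      here.\<close>
    define Psi where "Psi v = (\<Sum>R\<in>{-L..L}. s ((-1) powi R * t (- R)) (Phi R v))" for v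
    define w1 where "w1 = Psi vac"
    define kap where "kap = (\<Sum>R\<in>{-L..L}. (-1) powi R * t R * t (- R))"
    have Phi_Psi: "Phi Q (Psi v) = s (- t Q) v - Psi (Phi Q v)" if "Q \<ge> - L" for Q v
    proof -
      have "Phi Q (Psi v) + Psi (Phi Q v) =
          (\<Sum>R\<in>{-L..L}. s ((-1) powi R * t (- R)) (Phi Q (Phi R v) + Phi R (Phi Q v)))"
        by (simp add: Psi_def Phi_simps scale_right_distrib sum.distrib)
      also have "\<dots> = (\<Sum>R\<in>{-L..L}. if - Q = R then s (- t Q) v else 0)"
        by (rule sum.cong) (auto simp: PhiPhi power_int_minus simp flip: power_int_mult_distrib)
      also have "\<dots> = s (- t Q) v"
        using that t(2)[of Q] by (auto simp: sum.delta)
      finally show ?thesis by (simp add: algebra_simps)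
    qed
    have Psi_lin: "Psi 0 = 0" "Psi (s a v) = s a (Psi v)" for a v
      by (simp_all add: Psi_def Phi_simps scale_sum_right mult.commute)
    \<comment> \<open>Twice the square is the anticommutator of \<open>Psi\<close> with itself;
      expanding one copy reduces it to the anticommutators in \<open>Phi_Psi\<close>.\<close>
    have Psi_sq: "s 2 (Psi w1) = s (- kap) vac"
    proof -
      have "s 2 (Psi w1) = Psi w1 + Psi w1"
        using scale_left_distrib[of 1 1 "Psi w1"] by simp
      also have "\<dots> = (\<Sum>R\<in>{-L..L}. s ((-1) powi R * t (- R)) (Phi R (Psi vac))) +
          Psi (\<Sum>R\<in>{-L..L}. s ((-1) powi R * t (- R)) (Phi R vac))"
        by (simp add: w1_def Psi_def)
      also have "Psi (\<Sum>R\<in>{-L..L}. s ((-1) powi R * t (- R)) (Phi R vac)) =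
          (\<Sum>R\<in>{-L..L}. s ((-1) powi R * t (- R)) (Psi (Phi R vac)))"
        unfolding Psi_def Phi_simps scale_sum_right by (subst sum.swap) (simp add: mult_ac)
      also have "(\<Sum>R\<in>{-L..L}. s ((-1) powi R * t (- R)) (Phi R (Psi vac))) +
          (\<Sum>R\<in>{-L..L}. s ((-1) powi R * t (- R)) (Psi (Phi R vac))) =
          (\<Sum>R\<in>{-L..L}. s (- ((-1) powi R * t R * t (- R))) vac)"
        unfolding sum.distrib[symmetric] by (rule sum.cong) (auto simp: Phi_Psi algebra_simps)
      finally show ?thesis by (simp add: kap_def scale_sum_left sum_negf)
    qed
    \<comment> \<open>Normalised so that every positive mode sends \<open>w2\<close> and
      \<open>w1\<close> to the same multiple of the vacuum.\<close>
    define w2 where "w2 = s (- (1 / c)) w'"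
    have w2U: "w2 \<in> U" unfolding w2_def by (rule subspace_scale[OF U(1) w'(1)])
    have Phi_w2: "Phi R w2 = - s (t R) vac" if "R > 0" for R
      using Phi_w'[OF that] False by (simp add: w2_def Phi_simps c)
    have Phi_w1: "Phi R w1 = - s (t R) vac" if "R > 0" for R
      using that L Phi_Psi[of R vac] Phi_pos_vac[of R] by (simp add: w1_def Psi_lin)
    have "Phi R (w2 - w1) = 0" if "R > 0" for R
      using that by (simp add: Phi_simps Phi_w1 Phi_w2)
    then obtain x where x: "w2 - w1 = s x vac" by (rule killed_by_positive)
    then have w2: "w2 = s x vac + w1" by (simp add: algebra_simps)
    have "Phi 0 w1 = - s (t 0) vac - s phi0 w1"
      using Phi_Psi[of 0 vac] L by (simp add: w1_def Phi_0_vac Psi_lin)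
    \<comment> \<open>\<open>A 0\<close> has eigenvalue \<open>phi0\<close> on the vacuum and
      \<open>- phi0\<close> on \<open>w1\<close>, so subtracting \<open>s phi0 w2\<close> isolates
      \<open>w1\<close>.\<close>
    then have "A 0 w2 = s (phi0 * x) vac - s phi0 w1"
      unfolding A_def using Phi_w2[OF L] by (simp add: t(1)) (simp add: w2 Phi_simps Phi_0_vac mult.commute)
    then have "A 0 w2 - s phi0 w2 = s (- 2 * phi0) w1"
      using scale_left_distrib[of "phi0" "phi0" w1] by (simp add: w2 algebra_simps)
    then have "s (- 2 * phi0) w1 \<in> U"
      using w2U stable subspace_diff[OF U(1)] subspace_scale[OF U(1)] by metis
    from subspace_scale[OF U(1) this, of "1 / (- 2 * phi0)"]
    have w1U: "w1 \<in> U" using phi0_nz by simp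
    \<comment> \<open>With every \<open>Phi R\<close> replaced by \<open>A R\<close>,
      \<open>Psi\<close> preserves \<open>U\<close>. On \<open>w1\<close> the result is
      \<open>Psi w1 + s kap vac\<close>, half of \<open>s kap vac\<close> by
      \<open>Psi_sq\<close>.\<close>
    have "(\<Sum>R\<in>{-L..L}. s ((-1) powi R * t (- R)) (A R w1)) \<in> U"
      by (intro subspace_sum subspace_scale U stable w1U)
    also have "(\<Sum>R\<in>{-L..L}. s ((-1) powi R * t (- R)) (A R w1)) =
        Psi w1 - s kap (Phi L w1)"
      by (simp add: A_def Psi_def kap_def scale_right_diff_distrib sum_subtractf scale_sum_left mult_ac)
    also have "\<dots> = Psi w1 + s kap vac"
      using Phi_w1[OF L] by (simp add: t(1))
    finally have "s 2 (Psi w1 + s kap vac) \<in> U" by (rule subspace_scale[OF U(1)])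
    then have "s kap vac \<in> U"
      using scale_left_distrib[of kap kap vac] by (simp add: scale_right_distrib Psi_sq)
    from subspace_scale[OF U(1) this, of "1 / kap"] show ?thesis
      using kappa by (simp add: kap_def[symmetric])
  qed
qed

end

section \<open>The modes of \<open>S(z)\<close>\<close>

lemma fls_times_nth_bounds:
  fixes f g :: "'b::semiring_0 fls"
  assumes f: "\<And>m. m < a \<Longrightarrow> fls_nth f m = 0" and g: "\<And>m. m < b \<Longrightarrow> fls_nth g m = 0"
  shows "fls_nth (f * g) n = (\<Sum>m\<in>{a..n - b}. fls_nth f m * fls_nth g (n - m))"
proof (cases "f = 0 \<or> g = 0")
  case False
  then have "a \<le> fls_subdegree f" "b \<le> fls_subdegree g"
    using f g by (auto intro!: fls_subdegree_geI)
  then show ?thesis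
    unfolding fls_times_nth(2) by (intro sum.mono_neutral_left) auto
qed auto

lemma int_part_nth: "fls_nth (int_part \<chi>) m = (if even m then fls_nth \<chi> m else 0)"
  unfolding int_part_def by (rule nth_Abs_fls_lower_bound[of "fls_subdegree \<chi>"]) auto

lemma half_part_nth: "fls_nth (half_part \<chi>) m = (if odd m then fls_nth \<chi> m else 0)"
  unfolding half_part_def by (rule nth_Abs_fls_lower_bound[of "fls_subdegree \<chi>"]) auto

lemma deriv_z_nth: "fls_nth (deriv_z f) d = (of_int (d + 2) / 2) * fls_nth f (d + 2)"
proof -
  have "deriv_z f = fls_const (1/2) * (fls_X_inv * fls_deriv f)"
    unfolding deriv_z_def by (rule mult.assoc)
  then show ?thesis by (simp add: fls_X_inv_times_conv_shift(1) add.assoc)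
qed

lemma chi_nth: "fls_nth \<chi> m = chi_mode \<chi> (- m - 2)"
  by (simp add: chi_mode_def)

text \<open>The modes N and K - N sit at the exponents -N - 2 and -(K - N) - 2 of y, which add up to
  -K - 4. The predicate \<open>Q\<close> selects the integer or the half-odd part.\<close>

lemma square_nth:
  assumes chi: "\<And>N. N > int P \<Longrightarrow> chi_mode \<chi> N = 0"
    and f: "\<And>m. fls_nth f m = (if Q (- m - 2) then fls_nth \<chi> m else 0)"
  shows "fls_nth (f\<^sup>2) (- K - 4) =
    (\<Sum>N\<in>{K - int P..int P}. (if Q N \<and> Q (K - N) then chi_mode \<chi> N * chi_mode \<chi> (K - N) else 0))"
proof -
  have z: "fls_nth f m = 0" if "m < - int P - 2" for m
    using that chi by (simp add: f chi_nth[of \<chi>])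
  have "fls_nth (f\<^sup>2) (- K - 4) =
      (\<Sum>m\<in>{- int P - 2..- K - 4 - (- int P - 2)}. fls_nth f m * fls_nth f (- K - 4 - m))"
    unfolding power2_eq_square by (rule fls_times_nth_bounds; rule z)
  also have "\<dots> = (\<Sum>N\<in>{K - int P..int P}. fls_nth f (- N - 2) * fls_nth f (- K - 4 - (- N - 2)))"
    by (rule sum.reindex_bij_witness[of _ "\<lambda>N. - N - 2" "\<lambda>m. - m - 2"]) auto
  also have "\<dots> = (\<Sum>N\<in>{K - int P..int P}.
      (if Q N \<and> Q (K - N) then chi_mode \<chi> N * chi_mode \<chi> (K - N) else 0))"
    by (rule sum.cong) (auto simp: f chi_nth[of \<chi>])
  finally show ?thesis .
qed

lemma S_mode_eq:
  assumes chi: "\<And>N. N > int P \<Longrightarrow> chi_mode \<chi> N = 0"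
  shows "2 * S_mode \<chi> n =
    (\<Sum>N\<in>{2 * n - int P..int P}. (if even N then chi_mode \<chi> N * chi_mode \<chi> (2 * n - N) else 0))
    - of_int (n + 1) * chi_mode \<chi> (2 * n)"
proof -
  have idx: "2 * (- n - 2) = - (2 * n) - 4" by simp
  have "fls_nth ((int_part \<chi>)\<^sup>2) (- (2 * n) - 4) =
      (\<Sum>N\<in>{2 * n - int P..int P}. (if even N \<and> even (2 * n - N)
        then chi_mode \<chi> N * chi_mode \<chi> (2 * n - N) else 0))"
    by (rule square_nth[OF chi]) (auto simp: int_part_nth)
  moreover have "fls_nth (deriv_z (int_part \<chi>)) (- (2 * n) - 4) =
      - (of_int (n + 1) * chi_mode \<chi> (2 * n))"
    by (simp add: deriv_z_nth int_part_nth chi_nth[of \<chi>] field_simps)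
  ultimately show ?thesis
    unfolding S_mode_def S_series_def idx by (simp cong: if_cong)
qed

text \<open>As 2n is even, N and 2n - N have the same parity, so the difference of the two squares
  is one sum with sign (-1)^N. In this form it arises from the anticommutator of two modes of
  G.\<close>

lemma S_scalar_eq:
  assumes chi: "\<And>N. N > int P \<Longrightarrow> chi_mode \<chi> N = 0"
  shows "2 * S_scalar \<chi> n =
    (\<Sum>N\<in>{2 * n - int P..int P}. (-1) powi N * (chi_mode \<chi> N * chi_mode \<chi> (2 * n - N)))
    - of_int (n + 1) * chi_mode \<chi> (2 * n)"
proof -
  have idx: "2 * (- n - 2) = - (2 * n) - 4" by simp
  have "fls_nth ((half_part \<chi>)\<^sup>2) (- (2 * n) - 4) =
      (\<Sum>N\<in>{2 * n - int P..int P}. (if odd N \<and> odd (2 * n - N)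
        then chi_mode \<chi> N * chi_mode \<chi> (2 * n - N) else 0))"
    by (rule square_nth[OF chi]) (auto simp: half_part_nth)
  then have "2 * S_scalar \<chi> n = 2 * S_mode \<chi> n -
      (\<Sum>N\<in>{2 * n - int P..int P}. (if odd N then chi_mode \<chi> N * chi_mode \<chi> (2 * n - N) else 0))"
    unfolding S_scalar_def S_mode_def idx by (simp add: algebra_simps cong: if_cong)
  also have "\<dots> = ((\<Sum>N\<in>{2 * n - int P..int P}.
        (if even N then chi_mode \<chi> N * chi_mode \<chi> (2 * n - N) else 0)) -
      (\<Sum>N\<in>{2 * n - int P..int P}. (if odd N then chi_mode \<chi> N * chi_mode \<chi> (2 * n - N) else 0)))
      - of_int (n + 1) * chi_mode \<chi> (2 * n)"
    using S_mode_eq[OF chi, where n = n] by (simp add: algebra_simps)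
  also have "(\<Sum>N\<in>{2 * n - int P..int P}.
        (if even N then chi_mode \<chi> N * chi_mode \<chi> (2 * n - N) else 0)) -
      (\<Sum>N\<in>{2 * n - int P..int P}. (if odd N then chi_mode \<chi> N * chi_mode \<chi> (2 * n - N) else 0)) =
      (\<Sum>N\<in>{2 * n - int P..int P}. (-1) powi N * (chi_mode \<chi> N * chi_mode \<chi> (2 * n - N)))"
    unfolding sum_subtractf[symmetric]
    by (rule sum.cong) (auto simp: power_int_minus_left)
  finally show ?thesis .
qed


section \<open>The determinant condition\<close>

definition euler_op :: "complex fps \<Rightarrow> complex fps"
  where "euler_op f = fps_X * fps_deriv f"

lemma euler_op_nth: "fps_nth (euler_op f) n = of_nat n * fps_nth f n"
  by (cases n) (simp_all add: euler_op_def)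

lemma euler_op_simps:
  "euler_op (f + g) = euler_op f + euler_op g"
  "euler_op (f - g) = euler_op f - euler_op g"
  "euler_op (f * g) = euler_op f * g + f * euler_op g"
  "euler_op (fps_const c) = 0"
  by (simp_all add: euler_op_def algebra_simps)

lemma fps_of_nat_mult_nth: "fps_nth (of_nat n * f :: complex fps) k = of_nat n * fps_nth f k"
  by (simp add: fps_of_nat[symmetric])

text \<open>The solution is the exponential of a series \<open>E\<close> that integrates F/x
  termwise; this is possible because F has no constant term.\<close>

lemma euler_op_ex:
  assumes "fps_nth F 0 = 0"
  shows "\<exists>f. fps_nth f 0 = 1 \<and> euler_op f = F * f"
proof -
  \<comment> \<open>Division by zero gives \<open>E\<close> the constant term 0, so it can be
    substituted into the exponential series.\<close>
  define E where "E = Abs_fps (\<lambda>n. fps_nth F n / of_nat n)"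
  have E: "euler_op E = F"
    by (rule fps_ext) (use assms in \<open>simp add: euler_op_nth E_def\<close>)
  have "fps_deriv (fps_exp 1 oo E) = (fps_exp 1 oo E) * fps_deriv E"
    by (subst fps_compose_deriv) (simp_all add: E_def)
  then have "euler_op (fps_exp 1 oo E) = F * (fps_exp 1 oo E)"
    by (simp add: euler_op_def E[symmetric] mult_ac)
  then show ?thesis by (intro exI[of _ "fps_exp 1 oo E"]) simp
qed

lemma sum_even_indices:
  fixes f :: "nat \<Rightarrow> complex"
  shows "(\<Sum>k\<le>2 * n. if even k then f (k div 2) else 0) = (\<Sum>j\<le>n. f j)"
  by (induction n) simp_all

text \<open>With \<open>\<ell> = L/2\<close> and \<open>u = z\<^bsup>\<ell>+1/2\<^esup> u0\<close>, where \<open>z u0' = C u0\<close>, a solution of \<open>u'' = 2 S u\<close>, one has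
  \<open>u\<^sup>-\<^sup>2 = z\<^bsup>-L-1\<^esup> Q\<close>, and \<open>u \<integral>u\<^sup>-\<^sup>2\<close> is a second solution. If \<open>Q\<^sub>L = 0\<close>, it has no logarithm; its
  coefficients \<open>V\<close> then satisfy the Frobenius recursion, and this makes them a kernel vector of
  \<open>A(\<chi>)\<close>.\<close>

lemma det_A_eq_0:
  assumes chi: "\<And>N. N > 0 \<Longrightarrow> chi_mode \<chi> N = 0" and chi0: "chi_mode \<chi> 0 = (of_nat L + 1) / 2"
    and L: "L > 0"
    and C: "C = Abs_fps (\<lambda>k. if k = 0 then 0 else chi_mode \<chi> (- 2 * int k))"
    and Q: "euler_op Q = - 2 * C * Q" "fps_nth Q 0 = 1" "fps_nth Q L = 0"
  shows "det (A_matrix L \<chi>) = 0"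
proof -
  obtain u where u: "fps_nth u 0 = 1" "euler_op u = C * u"
    using euler_op_ex[of C] C by auto
  \<comment> \<open>As shown below, \<open>T\<close> is 2 z^2 S(z) without its constant
    term.\<close>
  define T where "T = euler_op C + C\<^sup>2 + of_nat L * C"
  \<comment> \<open>z^(-L) R is a primitive of z^(-L-1) Q. The term n = L would need a logarithm and
    is absent as Q_L = 0; the value 0 there is a choice of integration constant.\<close>
  define R where "R = Abs_fps (\<lambda>n. if n = L then 0 else fps_nth Q n / (of_nat n - of_nat L))"
  define V where "V = u * R"
  have R: "euler_op R = of_nat L * R + Q"
    by (rule fps_ext) (use Q(3) in \<open>auto simp: euler_op_nth R_def fps_of_nat_mult_nth field_simps\<close>)
  have "euler_op V = of_nat L * V + C * V + u * Q"
    by (simp add: V_def euler_op_simps u R algebra_simps)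
  moreover have "euler_op (of_nat L * V) = of_nat L * euler_op V"
    by (simp add: euler_op_simps fps_of_nat[symmetric])
  \<comment> \<open>Applying the Euler operator to \<open>u * Q\<close> gives - C u Q, which cancels
    the C u Q coming from C times the derivative of \<open>V\<close>, so the equation becomes
    homogeneous.\<close>
  ultimately have "euler_op (euler_op V) = of_nat L * euler_op V + T * V"
    by (simp add: euler_op_simps u Q T_def power2_eq_square algebra_simps)
  then have rec: "of_nat k * (of_nat k - of_nat L) * fps_nth V k =
      (\<Sum>i=0..k. fps_nth T i * fps_nth V (k - i))" for k
    by (simp add: fps_eq_iff euler_op_nth fps_of_nat_mult_nth fps_mult_nth[of T]
        algebra_simps)
  have T: "fps_nth T j = 2 * S_mode \<chi> (- int j)" if "j > 0" for j
  proof -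
    have e: "2 * - int j = - 2 * int j" by simp
    have "2 * S_mode \<chi> (- int j) =
        (\<Sum>N\<in>{- 2 * int j..0}. (if even N then chi_mode \<chi> N * chi_mode \<chi> (- 2 * int j - N) else 0))
        + (of_nat j - 1) * chi_mode \<chi> (- 2 * int j)"
      using S_mode_eq[of 0 \<chi> "- int j", unfolded e] chi by (simp add: left_diff_distrib)
    also have "(\<Sum>N\<in>{- 2 * int j..0}.
        (if even N then chi_mode \<chi> N * chi_mode \<chi> (- 2 * int j - N) else 0)) =
        (\<Sum>k\<le>2 * j. if even k then chi_mode \<chi> (- int k) * chi_mode \<chi> (- 2 * int j + int k) else 0)"
      by (rule sum.reindex_bij_witness[of _ "\<lambda>k. - int k" "\<lambda>N. nat (- N)"])
        (auto simp: even_nat_iff)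
    also have "\<dots> = (\<Sum>k\<le>2 * j. if even k then chi_mode \<chi> (- 2 * int (k div 2)) *
          chi_mode \<chi> (- 2 * int j + 2 * int (k div 2)) else 0)"
      by (rule sum.cong) auto
    also have "\<dots> = (\<Sum>k\<le>j. chi_mode \<chi> (- 2 * int k) * chi_mode \<chi> (- 2 * int j + 2 * int k))"
      by (rule sum_even_indices)
    \<comment> \<open>The two end terms involve chi_0 and together give the factor L + 1; the inner
      terms form the square of \<open>C\<close>, which has no constant term.\<close>
    also have "{..j} = insert 0 (insert j {0<..<j})" using that by auto
    also have "(\<Sum>k\<in>insert 0 (insert j {0<..<j}).
        chi_mode \<chi> (- 2 * int k) * chi_mode \<chi> (- 2 * int j + 2 * int k)) =
        (of_nat L + 1) * chi_mode \<chi> (- 2 * int j) + (\<Sum>k\<in>{0<..<j}.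
        chi_mode \<chi> (- 2 * int k) * chi_mode \<chi> (- 2 * int j + 2 * int k))"
      using that by (simp add: chi0 field_simps)
    also have "(\<Sum>k\<in>{0<..<j}. chi_mode \<chi> (- 2 * int k) * chi_mode \<chi> (- 2 * int j + 2 * int k)) =
        (\<Sum>k=0..j. fps_nth C k * fps_nth C (j - k))"
      by (rule sum.mono_neutral_cong_left) (auto simp: C algebra_simps)
    finally have "2 * S_mode \<chi> (- int j) =
        (of_nat L + 1) * chi_mode \<chi> (- 2 * int j) + (\<Sum>k=0..j. fps_nth C k * fps_nth C (j - k))
        + (of_nat j - 1) * chi_mode \<chi> (- 2 * int j)" .
    moreover have "fps_nth C j = chi_mode \<chi> (- 2 * int j)" using that by (simp add: C)
    ultimately show ?thesis
      by (simp add: T_def power2_eq_square fps_mult_nth[of C C] euler_op_nth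
          fps_of_nat_mult_nth algebra_simps)
  qed
  have T0: "fps_nth T 0 = 0" by (simp add: T_def C euler_op_nth)
  \<comment> \<open>In this reversed order, row a is the Frobenius recursion at k = L - a, and the
    subdiagonal entry is k (L - k). In the top row k = L this factor vanishes, so V_L drops
    out.\<close>
  define x where "x = vec L (\<lambda>b. fps_nth V (L - 1 - b))"
  have V0: "fps_nth V 0 \<noteq> 0" using L by (simp add: V_def u R_def Q)
  have "x $ (L - 1) \<noteq> 0" using L V0 by (simp add: x_def)
  then have "x \<noteq> 0\<^sub>v L" using L by auto
  moreover have "A_matrix L \<chi> *\<^sub>v x = 0\<^sub>v L"
  proof (rule eq_vecI)
    fix a assume "a < dim_vec (0\<^sub>v L)"
    then have a: "a < L" by simp
    define k where "k = L - a"
    have k: "0 < k" "k \<le> L" "a = L - k" using a by (auto simp: k_def)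
    have "(A_matrix L \<chi> *\<^sub>v x) $ a = (\<Sum>b<L. A_matrix L \<chi> $$ (a, b) * fps_nth V (L - 1 - b))"
      using a by (simp add: A_matrix_def x_def scalar_prod_def atLeast0LessThan)
    also have "\<dots> = (\<Sum>i<L. A_matrix L \<chi> $$ (a, L - 1 - i) * fps_nth V i)"
      by (rule sum.reindex_bij_witness[of _ "\<lambda>i. L - 1 - i" "\<lambda>i. L - 1 - i"]) auto
    also have "\<dots> = (\<Sum>i<L. (if i < k then fps_nth T (k - i) * fps_nth V i else 0) +
        (if i = k then - (of_nat k * (of_nat k - of_nat L) * fps_nth V k) else 0))"
    proof (rule sum.cong)
      fix i assume "i \<in> {..<L}"
      then have i: "i < L" by simp
      have b: "of_nat (L - 1 - i + 1) = (of_nat L - of_nat i :: complex)"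
        using i by (simp add: of_nat_diff)
      consider "i < k" | "i = k" | "i > k" by linarith
      then show "A_matrix L \<chi> $$ (a, L - 1 - i) * fps_nth V i =
          (if i < k then fps_nth T (k - i) * fps_nth V i else 0) +
          (if i = k then - (of_nat k * (of_nat k - of_nat L) * fps_nth V k) else 0)"
      proof cases
        case 1
        then have "int (L - 1 - i + 1) - int (a + 1) + 1 = int (k - i)" "a \<le> L - 1 - i"
          using k i by auto
        moreover have "A_matrix L \<chi> $$ (a, L - 1 - i) =
            2 * S_mode \<chi> (- (int (L - 1 - i + 1) - int (a + 1) + 1))"
          using calculation(2) i a by (simp add: A_matrix_def Let_def)
        ultimately show ?thesis
          using 1 T[of "k - i"] by simp
      next
        case 2
        have id: "(l / 2)\<^sup>2 - (l / 2 - (l - m))\<^sup>2 = m * (l - m)" for l m :: complex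
          by (simp add: power2_eq_square field_simps)
        from 2 have "a + 1 = L - 1 - i + 1 + 1" "\<not> a + 1 \<le> L - 1 - i + 1" using k i by auto
        then have "A_matrix L \<chi> $$ (a, L - 1 - i) =
            (of_nat L / 2)\<^sup>2 - (of_nat L / 2 - (of_nat L - of_nat i))\<^sup>2"
          using i a b by (simp add: A_matrix_def Let_def)
        then have e: "A_matrix L \<chi> $$ (a, L - 1 - i) = of_nat k * (of_nat L - of_nat k)"
          using 2 id[of "of_nat L" "of_nat k"] by simp
        show ?thesis unfolding e using 2 by (simp add: algebra_simps)
      next
        case 3
        then have "a + 1 \<noteq> L - 1 - i + 1 + 1" "\<not> a + 1 \<le> L - 1 - i + 1" using k i by auto
        then show ?thesis using 3 i a by (simp add: A_matrix_def Let_def)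
      qed
    qed simp
    also have "\<dots> = (\<Sum>i<k. fps_nth T (k - i) * fps_nth V i)
        - of_nat k * (of_nat k - of_nat L) * fps_nth V k"
    proof -
      have "{i \<in> {..<L}. i < k} = {..<k}" using k by auto
      then show ?thesis
        using k by (auto simp: sum.distrib sum.inter_filter[symmetric] sum.delta)
    qed
    also have "(\<Sum>i<k. fps_nth T (k - i) * fps_nth V i) =
        (\<Sum>i=0..k. fps_nth T i * fps_nth V (k - i))"
    proof -
      have "(\<Sum>i=0..k. fps_nth T i * fps_nth V (k - i)) =
          (\<Sum>i\<in>{0<..k}. fps_nth T i * fps_nth V (k - i))"
        by (rule sum.mono_neutral_right) (auto simp: T0)
      also have "\<dots> = (\<Sum>i<k. fps_nth T (k - i) * fps_nth V i)"
        by (rule sum.reindex_bij_witness[of _ "\<lambda>i. k - i" "\<lambda>i. k - i"]) auto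
      finally show ?thesis by simp
    qed
    finally show "(A_matrix L \<chi> *\<^sub>v x) $ a = 0\<^sub>v L $ a" using rec[of k] a by simp
  qed (simp add: A_matrix_def)
  moreover have "A_matrix L \<chi> \<in> carrier_mat L L" by (simp add: A_matrix_def)
  moreover have "x \<in> carrier_vec L" by (simp add: x_def)
  ultimately show ?thesis using det_0_iff_vec_prod_zero_field by blast
qed

text \<open>The \<tau> are the coefficients of a series f in y with y f' = F f. The alternating sum
  is the coefficient of y^(2L) in f(-y) f(y), where the half-odd part of \<chi> cancels. With z =
  y^2 the even coefficients give the series \<open>Q\<close> of \<open>det_A_eq_0\<close>, which is
  applied in contrapositive form.\<close>

lemma resonant_coefficients:
  assumes chi: "\<And>N. N > 0 \<Longrightarrow> chi_mode \<chi> N = 0" and chi0: "chi_mode \<chi> 0 = (of_nat L + 1) / 2"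
    and L: "L > 0" and det: "det (A_matrix L \<chi>) \<noteq> 0"
  obtains \<tau> :: "nat \<Rightarrow> complex" where "\<tau> 0 = 1"
    "\<And>n. of_nat n * \<tau> n = - 2 * (\<Sum>k<n. chi_mode \<chi> (int k - int n) * \<tau> k)"
    "(\<Sum>n\<le>2 * L. (-1) ^ n * \<tau> n * \<tau> (2 * L - n)) \<noteq> 0"
proof -
  define F where "F = Abs_fps (\<lambda>k. if k = 0 then 0 else - 2 * chi_mode \<chi> (- int k))"
  obtain f where f: "fps_nth f 0 = 1" "euler_op f = F * f"
    using euler_op_ex[of F] F_def by auto
  have rec: "of_nat n * fps_nth f n = (\<Sum>k=0..n. fps_nth F k * fps_nth f (n - k))" for n
    unfolding euler_op_nth[symmetric] f(2) by (rule fps_mult_nth)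
  have rec': "of_nat n * fps_nth f n = - 2 * (\<Sum>k<n. chi_mode \<chi> (int k - int n) * fps_nth f k)" for n
  proof -
    have "(\<Sum>k=0..n. fps_nth F k * fps_nth f (n - k)) = (\<Sum>k\<in>{0<..n}. fps_nth F k * fps_nth f (n - k))"
      by (rule sum.mono_neutral_right) (auto simp: F_def)
    also have "\<dots> = (\<Sum>k<n. - 2 * (chi_mode \<chi> (int k - int n) * fps_nth f k))"
      by (rule sum.reindex_bij_witness[of _ "\<lambda>i. n - i" "\<lambda>i. n - i"]) (auto simp: F_def of_nat_diff)
    finally show ?thesis by (simp add: rec sum_distrib_left)
  qed
  \<comment> \<open>The substitution y -> -y, which is compatible with the Euler operator. Only the
    even coefficients, belonging to the integer part of \<chi>, survive in
    \<open>F + F'\<close>.\<close>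
  define f' F' where "f' = Abs_fps (\<lambda>n. (-1) ^ n * fps_nth f n)"
    and "F' = Abs_fps (\<lambda>n. (-1) ^ n * fps_nth F n)"
  have f': "euler_op f' = F' * f'"
  proof (rule fps_ext)
    fix n
    have "fps_nth (euler_op f') n = (-1) ^ n * (of_nat n * fps_nth f n)"
      by (simp add: euler_op_nth f'_def)
    also have "\<dots> = (\<Sum>k=0..n. (-1) ^ n * (fps_nth F k * fps_nth f (n - k)))"
      by (simp only: rec sum_distrib_left)
    also have "\<dots> = fps_nth (F' * f') n"
      unfolding fps_mult_nth
    proof (rule sum.cong)
      fix k assume "k \<in> {0..n}"
      then have "(-1 :: complex) ^ n = (-1) ^ k * (-1) ^ (n - k)" by (simp flip: power_add)
      then show "(-1) ^ n * (fps_nth F k * fps_nth f (n - k)) = fps_nth F' k * fps_nth f' (n - k)"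
        by (simp add: F'_def f'_def)
    qed simp
    finally show "fps_nth (euler_op f') n = fps_nth (F' * f') n" .
  qed
  define q where "q = f' * f"
  have q: "euler_op q = (F + F') * q"
    by (simp add: q_def euler_op_simps f f' algebra_simps)
  define Q where "Q = Abs_fps (\<lambda>n. fps_nth q (2 * n))"
  define C where "C = Abs_fps (\<lambda>k. if k = 0 then 0 else chi_mode \<chi> (- 2 * int k))"
  have Q: "euler_op Q = - 2 * C * Q"
  proof (rule fps_ext)
    fix n
    \<comment> \<open>The Euler operator in y is twice the one in z = y^2.\<close>
    have "2 * fps_nth (euler_op Q) n = fps_nth (euler_op q) (2 * n)"
      by (simp add: euler_op_nth Q_def)
    also have "\<dots> = (\<Sum>k\<le>2 * n. fps_nth (F + F') k * fps_nth q (2 * n - k))"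
      by (simp add: q fps_mult_nth atLeast0AtMost)
    also have "\<dots> = (\<Sum>k\<le>2 * n. if even k
        then (- 4 * fps_nth C (k div 2)) * fps_nth Q (n - k div 2) else 0)"
    proof (rule sum.cong)
      fix k assume "k \<in> {..2 * n}"
      show "fps_nth (F + F') k * fps_nth q (2 * n - k) = (if even k
          then (- 4 * fps_nth C (k div 2)) * fps_nth Q (n - k div 2) else 0)"
      proof (cases "even k")
        case True
        then obtain j where j: "k = 2 * j" by (rule evenE)
        have "2 * n - k = 2 * (n - k div 2)" by (simp add: j)
        then have "fps_nth q (2 * n - k) = fps_nth Q (n - k div 2)" by (simp add: Q_def)
        moreover have "fps_nth (F + F') k = - 4 * fps_nth C (k div 2)"
          by (simp add: j F_def F'_def C_def)
        ultimately show ?thesis using True by (simp only: if_True)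
      next
        case False
        then show ?thesis by (simp add: F_def F'_def)
      qed
    qed simp
    also have "\<dots> = (\<Sum>j\<le>n. (- 4 * fps_nth C j) * fps_nth Q (n - j))"
      by (rule sum_even_indices)
    also have "\<dots> = 2 * (- 2 * (\<Sum>j\<le>n. fps_nth C j * fps_nth Q (n - j)))"
      by (simp add: sum_distrib_left mult.assoc)
    also have "(\<Sum>j\<le>n. fps_nth C j * fps_nth Q (n - j)) = fps_nth (C * Q) n"
      by (simp add: fps_mult_nth atLeast0AtMost)
    also have "- 2 * fps_nth (C * Q) n = fps_nth (- 2 * C * Q) n"
    proof -
      have "- 2 * C * Q = - (C * Q + C * Q)" by (simp add: algebra_simps)
      then show ?thesis by (simp only: fps_neg_nth fps_add_nth) simp
    qed
    finally show "fps_nth (euler_op Q) n = fps_nth (- 2 * C * Q) n" by simp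
  qed
  have "fps_nth Q 0 = 1" by (simp add: Q_def q_def f f'_def)
  with Q have "fps_nth Q L \<noteq> 0" using det_A_eq_0[OF chi chi0 L C_def] det by blast
  then have "(\<Sum>n\<le>2 * L. (-1) ^ n * fps_nth f n * fps_nth f (2 * L - n)) \<noteq> 0"
    by (simp add: Q_def q_def fps_mult_nth f'_def atLeast0AtMost)
  with f(1) rec' show thesis by (rule that)
qed

section \<open>The module \<open>F\<^sup>T\<^sup>i(\<chi>)\<close>\<close>

lemma vector_space_mult: "vector_space ((*) :: complex \<Rightarrow> complex \<Rightarrow> complex)"
  by unfold_locales (auto simp: algebra_simps)

lemma lookup_pm_scale:
  assumes "vector_space s"
  shows "Poly_Mapping.lookup (pm_scale s c w) k = s c (Poly_Mapping.lookup w k)"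
proof -
  interpret vector_space s by fact
  show ?thesis by (simp add: pm_scale_def Poly_Mapping.map.rep_eq when_def)
qed

lemma vector_space_pm_scale:
  assumes "vector_space s"
  shows "vector_space (pm_scale s :: complex \<Rightarrow> ('k \<Rightarrow>\<^sub>0 'v::ab_group_add) \<Rightarrow> _)"
proof -
  interpret vector_space s by fact
  show ?thesis
    by unfold_locales
      (auto intro!: poly_mapping_eqI simp: lookup_pm_scale[OF assms] lookup_add algebra_simps)
qed

lemma minus_one_powi_add: "(-1 :: complex) powi (m + n) = (-1) powi m * (-1) powi n"
  by (simp add: power_int_add)

lemma minus_one_powi_sq: "(-1 :: complex) powi m * (-1) powi m = 1"
  by (simp flip: power_int_mult_distrib)

section \<open>Anticommutators of the modes of G and the module structure\<close>

context clifford_chi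
begin

lemma gg_expand:
  "gg R Q = (-1) powi (R + 1) *
    ((\<Sum>N\<in>{R + Q - int P..int P}. (-1) powi N * (chi_mode \<chi> N * chi_mode \<chi> (R + Q - N)))
      - ((of_int R + 1) / 2 + (-1) powi (R + Q) * ((of_int Q + 1) / 2)) * chi_mode \<chi> (R + Q)
      + (if R + Q = 0 then (of_int R + 1) / 2 * ((of_int Q + 1) / 2) else 0))"
proof -
  \<comment> \<open>An interval that contains the summation range of \<open>gg\<close> and both
    diagonal positions -R and Q, so that each term of the expanded product can be summed
    separately.\<close>
  define I where "I = {min (Q - int P) (- R)..max (int P - R) Q}"
  define a b where "a = (of_int R + 1 :: complex) / 2" and "b = (of_int Q + 1 :: complex) / 2"
  have mem: "- R \<in> I" "Q \<in> I" and fin: "finite I" by (auto simp: I_def)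
  have sq: "(-1) powi Q = ((-1) powi R * (-1) powi (R + Q) :: complex)"
    using minus_one_powi_sq[of R] by (simp add: minus_one_powi_add mult.assoc[symmetric])
  have "gg R Q = (\<Sum>m\<in>I. - ((-1) powi m) * gc R (- m) * gc Q m)"
    unfolding gg_def by (rule sum.mono_neutral_left) (auto simp: I_def gc_eq_0)
  also have "\<dots> = (\<Sum>m\<in>I. - ((-1) powi m * (chi_mode \<chi> (R + m) * chi_mode \<chi> (Q - m)))
      + (if - R = m then (-1) powi R * a * chi_mode \<chi> (R + Q) else 0)
      + (if Q = m then (-1) powi Q * b * chi_mode \<chi> (R + Q) else 0)
      - (if - R = m then (if R + Q = 0 then (-1) powi R * a * b else 0) else 0))"
  proof (rule sum.cong)
    fix m
    have gc: "gc R (- m) = chi_mode \<chi> (R + m) - (if - R = m then a else 0)"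
      "gc Q m = chi_mode \<chi> (Q - m) - (if Q = m then b else 0)"
      by (auto simp: gc_def a_def b_def)
    have neg: "(-1 :: complex) powi (- R) = (-1) powi R"
      by (simp add: power_int_minus power_int_minus_left)
    show "- ((-1) powi m) * gc R (- m) * gc Q m =
      - ((-1) powi m * (chi_mode \<chi> (R + m) * chi_mode \<chi> (Q - m)))
      + (if - R = m then (-1) powi R * a * chi_mode \<chi> (R + Q) else 0)
      + (if Q = m then (-1) powi Q * b * chi_mode \<chi> (R + Q) else 0)
      - (if - R = m then (if R + Q = 0 then (-1) powi R * a * b else 0) else 0)"
      unfolding gc using neg by (auto simp: algebra_simps)
  qed simp
  also have "\<dots> = - (\<Sum>m\<in>I. (-1) powi m * (chi_mode \<chi> (R + m) * chi_mode \<chi> (Q - m)))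
      + (-1) powi R * a * chi_mode \<chi> (R + Q) + (-1) powi Q * b * chi_mode \<chi> (R + Q)
      - (if R + Q = 0 then (-1) powi R * a * b else 0)"
    using mem fin by (simp add: sum.distrib sum_subtractf sum_negf)
  also have "(\<Sum>m\<in>I. (-1) powi m * (chi_mode \<chi> (R + m) * chi_mode \<chi> (Q - m))) =
      (\<Sum>m\<in>{Q - int P..int P - R}. (-1) powi m * (chi_mode \<chi> (R + m) * chi_mode \<chi> (Q - m)))"
    by (rule sum.mono_neutral_right) (auto simp: I_def chi)
  also have "\<dots> = (\<Sum>N\<in>{R + Q - int P..int P}.
      (-1) powi R * ((-1) powi N * (chi_mode \<chi> N * chi_mode \<chi> (R + Q - N))))"
  proof (rule sum.reindex_bij_witness[of _ "\<lambda>N. N - R" "\<lambda>m. R + m"])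
    fix m assume "m \<in> {Q - int P..int P - R}"
    show "(-1) powi R * ((-1) powi (R + m) * (chi_mode \<chi> (R + m) * chi_mode \<chi> (R + Q - (R + m)))) =
        (-1) powi m * (chi_mode \<chi> (R + m) * chi_mode \<chi> (Q - m))"
      using minus_one_powi_sq[of R] by (simp add: minus_one_powi_add mult.assoc[symmetric])
  qed auto
  also have "\<dots> = (-1) powi R * (\<Sum>N\<in>{R + Q - int P..int P}.
      (-1) powi N * (chi_mode \<chi> N * chi_mode \<chi> (R + Q - N)))"
    by (rule sum_distrib_left[symmetric])
  finally show ?thesis
    unfolding sq minus_one_powi_add[of R 1] a_def[symmetric] b_def[symmetric]
    by (auto simp: algebra_simps)
qed

text \<open>For even R + Q = 2n the two diagonal shifts add up to n + 1, as in the derivative term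
  of S, and for n = 0 their product gives the central term with C = -3. For odd R + Q the
  alternating sum changes sign under N -> R + Q - N and vanishes.\<close>

lemma gg_eq:
  "gg R Q = (-1) powi (R + 1) *
    (if even (R + Q) then 2 * S_scalar \<chi> ((R + Q) div 2)
        - (if R + Q = 0 then (of_int R / 2)\<^sup>2 - 1/4 else 0)
     else - (of_int (R - Q) / 2) * chi_mode \<chi> (R + Q))"
proof (cases "even (R + Q)")
  case True
  then obtain n where n: "R + Q = 2 * n" by (rule evenE)
  have "(of_int R + 1) / 2 + (of_int Q + 1) / 2 = (of_int (R + Q) + 2 :: complex) / 2"
    by (simp add: field_simps)
  also have "\<dots> = of_int (n + 1)" unfolding n by simp
  finally have e: "(of_int R + 1) / 2 + (of_int Q + 1) / 2 = (of_int (n + 1) :: complex)" .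
  have "(of_int R + 1) / 2 * ((of_int Q + 1) / 2) = - ((of_int R / 2)\<^sup>2 - 1/4 :: complex)" if "n = 0"
  proof -
    have "Q = - R" using n that by simp
    then show ?thesis by (simp add: power2_eq_square field_simps)
  qed
  with True show ?thesis
    using S_scalar_eq[OF chi, where n = n] unfolding gg_expand n
    by (simp add: e)
next
  case False
  define K where "K = R + Q"
  let ?S = "\<Sum>N\<in>{K - int P..int P}. (-1) powi N * (chi_mode \<chi> N * chi_mode \<chi> (K - N))"
  have "?S = (\<Sum>N\<in>{K - int P..int P}. - ((-1) powi N * (chi_mode \<chi> N * chi_mode \<chi> (K - N))))"
  proof (rule sum.reindex_bij_witness[of _ "\<lambda>N. K - N" "\<lambda>N. K - N"])
    fix N
    have "(-1 :: complex) powi (K - N) = - ((-1) powi N)"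
      using False by (auto simp: K_def power_int_minus_left)
    then show "- ((-1) powi (K - N) * (chi_mode \<chi> (K - N) * chi_mode \<chi> (K - (K - N)))) =
        (-1) powi N * (chi_mode \<chi> N * chi_mode \<chi> (K - N))"
      by simp
  qed auto
  then have "?S = 0" by (simp add: sum_negf)
  moreover have "R + Q \<noteq> 0" using False by (metis dvd_0_right)
  moreover have "(-1 :: complex) powi (R + Q) = -1" using False by (simp add: power_int_minus_left)
  ultimately show ?thesis
    using False unfolding gg_expand K_def by (simp add: field_simps)
qed

abbreviation act :: "atw_gen \<Rightarrow> 'v \<Rightarrow> 'v"
  where "act \<equiv> FT_gen_action s Phi \<chi>"

abbreviation rho :: "atw \<Rightarrow> 'v \<Rightarrow> 'v"
  where "rho \<equiv> FT_action s Phi \<chi>"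

lemma lin_act: "Vector_Spaces.linear s s (act a)"
  by (rule linearI'; cases a)
    (simp_all add: vector_space_axioms scale_right_distrib G_simps mult.commute)

lemma rho_superset:
  assumes "finite A" "Poly_Mapping.keys x \<subseteq> A"
  shows "rho x v = (\<Sum>a\<in>A. s (Poly_Mapping.lookup x a) (act a v))"
  unfolding FT_action_def using assms
  by (intro sum.mono_neutral_left) (auto simp: in_keys_iff)

lemma linear_rho_left: "Vector_Spaces.linear (pm_scale (*)) s (\<lambda>x. rho x v)"
proof (rule linearI')
  fix x y :: atw and c
  let ?A = "Poly_Mapping.keys x \<union> Poly_Mapping.keys y"
  have "finite ?A" by simp
  then show "rho (x + y) v = rho x v + rho y v"
    using keys_add[of x y]
    by (simp add: rho_superset[of ?A] lookup_add scale_left_distrib sum.distrib)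
  have "Poly_Mapping.keys (pm_scale (*) c x) \<subseteq> Poly_Mapping.keys x"
    by (auto simp: in_keys_iff lookup_pm_scale[OF vector_space_mult])
  then show "rho (pm_scale (*) c x) v = s c (rho x v)"
    by (simp add: rho_superset[of "Poly_Mapping.keys x"] lookup_pm_scale[OF vector_space_mult]
        scale_sum_right)
qed (simp_all add: vector_space_pm_scale vector_space_mult vector_space_axioms)

lemma linear_rho: "Vector_Spaces.linear s s (rho x)"
  by (rule linearI')
    (simp_all add: vector_space_axioms FT_action_def lin_add[OF lin_act] lin_scale[OF lin_act]
      scale_right_distrib sum.distrib scale_sum_right mult.commute)

lemma rho_single: "rho (Poly_Mapping.single a c) v = s c (act a v)"
  by (subst rho_superset[of "{a}"]) simp_all

lemma rho_bracket: "rho (atw_bracket x y) v =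
  (\<Sum>a\<in>Poly_Mapping.keys x. \<Sum>b\<in>Poly_Mapping.keys y.
    s (Poly_Mapping.lookup x a * Poly_Mapping.lookup y b) (rho (atw_gen_bracket a b) v))"
  by (simp add: atw_bracket_def lin_sum[OF linear_rho_left] lin_scale[OF linear_rho_left])

lemma rho_rho: "rho x (rho y v) =
  (\<Sum>a\<in>Poly_Mapping.keys x. \<Sum>b\<in>Poly_Mapping.keys y.
    s (Poly_Mapping.lookup x a * Poly_Mapping.lookup y b) (act a (act b v)))"
  by (simp add: FT_action_def lin_sum[OF lin_act] lin_scale[OF lin_act] scale_sum_right)

lemma rho_rho': "rho y (rho x v) =
  (\<Sum>a\<in>Poly_Mapping.keys x. \<Sum>b\<in>Poly_Mapping.keys y.
    s (Poly_Mapping.lookup x a * Poly_Mapping.lookup y b) (act b (act a v)))"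
  by (subst rho_rho, subst sum.swap) (simp add: mult.commute)

lemma act_bracket_GG:
  "rho (atw_gen_bracket (G_gen R) (G_gen Q)) v = G R (G Q v) + G Q (G R v)"
proof (cases "even (R + Q)")
  case True
  define c :: complex where "c = (if R + Q = 0 then (1/3) * ((of_int R / 2)\<^sup>2 - 1/4) else 0)"
  have "rho (atw_gen_bracket (G_gen R) (G_gen Q)) v =
      s ((-1) powi (R + 1)) (s 2 (s (S_scalar \<chi> ((R + Q) div 2)) v) + s c (s (-3) v))"
    using True by (simp only: atw_gen_bracket.simps if_True c_def[symmetric]
        lin_scale[OF linear_rho_left] lin_add[OF linear_rho_left] rho_single FT_gen_action.simps)
  also have "\<dots> = s ((-1) powi (R + 1) * (2 * S_scalar \<chi> ((R + Q) div 2) + c * (-3))) v"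
    by (simp only: scale_scale scale_left_distrib[symmetric])
  also have "(-1) powi (R + 1) * (2 * S_scalar \<chi> ((R + Q) div 2) + c * (-3)) = gg R Q"
    using True by (simp add: gg_eq c_def)
  finally show ?thesis by (simp only: G_G)
next
  case False
  then have "2 * ((R + Q - 1) div 2) + 1 = R + Q" by presburger
  with False show ?thesis
    unfolding G_G gg_eq by (simp add: lin_scale[OF linear_rho_left] rho_single)
qed

lemma act_central: "(\<nexists>R. a = G_gen R) \<Longrightarrow> \<exists>c. act a = s c"
proof (cases a)
  case C_gen
  then show ?thesis by (intro exI[of _ "-3"]) (simp add: fun_eq_iff)
qed (auto simp: fun_eq_iff)

text \<open>All generators except the \<open>G_gen R\<close> act by scalars and have zero brackets,
  which settles the case of an even argument. The odd case is \<open>act_bracket_GG\<close>,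
  extended bilinearly.\<close>

lemma atw_module_rho: "atw_module s rho"
  unfolding atw_module_def
proof (intro conjI allI impI)
  fix x y :: atw and v
  assume even: "atw_even x \<or> atw_even y"
  have "rho (atw_gen_bracket a b) v = act a (act b v) - act b (act a v)"
    if "a \<in> Poly_Mapping.keys x" "b \<in> Poly_Mapping.keys y" for a b
  proof -
    have "(\<nexists>R. a = G_gen R) \<or> (\<nexists>R. b = G_gen R)"
      using even that unfolding atw_even_def by blast
    moreover from this have "act a (act b v) = act b (act a v)"
      using act_central[of a] act_central[of b] by (auto simp: lin_scale[OF lin_act])
    moreover have "atw_gen_bracket a b = 0" if "(\<nexists>R. a = G_gen R) \<or> (\<nexists>R. b = G_gen R)"
      using that by (cases a; cases b) simp_all
    ultimately show ?thesis by (simp add: lin_zero[OF linear_rho_left])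
  qed
  then show "rho (atw_bracket x y) v = rho x (rho y v) - rho y (rho x v)"
    unfolding rho_bracket rho_rho[of x y] rho_rho'[of y x] sum_subtractf[symmetric]
      scale_right_diff_distrib[symmetric] by (intro sum.cong refl) simp
next
  fix x y :: atw and v
  assume odd: "atw_odd x \<and> atw_odd y"
  have "rho (atw_gen_bracket a b) v = act a (act b v) + act b (act a v)"
    if ab: "a \<in> Poly_Mapping.keys x" "b \<in> Poly_Mapping.keys y" for a b
  proof -
    obtain R Q where "a = G_gen R" "b = G_gen Q"
      using odd ab unfolding atw_odd_def by blast
    then show ?thesis using act_bracket_GG[of R Q v] by simp
  qed
  then show "rho (atw_bracket x y) v = rho x (rho y v) + rho y (rho x v)"
    unfolding rho_bracket rho_rho[of x y] rho_rho'[of y x] sum.distrib[symmetric]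
      scale_right_distrib[symmetric] by (intro sum.cong refl) simp
qed (simp_all add: vector_space_axioms linear_rho_left linear_rho)

end

section \<open>The three cases of the hypothesis on \<chi>\<close>

definition admissible :: "nat \<Rightarrow> complex fls \<Rightarrow> bool"
  where "admissible P \<chi> \<longleftrightarrow>
    (P > 0 \<and> chi_mode \<chi> (int P) \<noteq> 0) \<or>
    (P = 0 \<and> (2 * chi_mode \<chi> 0 \<notin> \<int> \<or> chi_mode \<chi> 0 = 1/2)) \<or>
    (P = 0 \<and> (\<exists>L::nat. chi_mode \<chi> 0 - 1/2 = of_nat L / 2 \<and> det (A_matrix L \<chi>) \<noteq> 0))"

locale clifford_chi_admissible = clifford_chi s i Phi vac P \<chi>
  for s :: "complex \<Rightarrow> 'v::ab_group_add \<Rightarrow> 'v" and i Phi vac P \<chi> +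
  assumes admissible: "admissible P \<chi>"
begin

lemma gc_diag: "gc (m + int P) m = chi_mode \<chi> (int P) - (if P = 0 then (of_int m + 1) / 2 else 0)"
  by (simp add: gc_def)

text \<open>The leading coefficient at \<open>Phi m\<close> is independent of m if P > 0, and
  vanishes only at m = 2 chi_0 - 1 if P = 0. For chi_0 = 1/2 this is the exempt m = 0. What remains
  is a resonance at a positive m = L, with nonzero determinant.\<close>

lemma admissible_cases:
  obtains "\<And>m. m \<noteq> 0 \<Longrightarrow> gc (m + int P) m \<noteq> 0"
  | L :: nat where "P = 0" "L > 0" "chi_mode \<chi> 0 = (of_nat L + 1) / 2" "det (A_matrix L \<chi>) \<noteq> 0"
proof -
  consider "P > 0" "chi_mode \<chi> (int P) \<noteq> 0" | "P = 0" "2 * chi_mode \<chi> 0 \<notin> \<int>"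
    | "P = 0" "chi_mode \<chi> 0 = 1/2"
    | L :: nat where "P = 0" "L > 0" "chi_mode \<chi> 0 = (of_nat L + 1) / 2" "det (A_matrix L \<chi>) \<noteq> 0"
  proof -
    have "chi_mode \<chi> 0 = (of_nat L + 1) / 2 \<and> (L = 0 \<longrightarrow> chi_mode \<chi> 0 = 1/2)"
      if "chi_mode \<chi> 0 - 1/2 = of_nat L / 2" for L :: nat
      using that unfolding diff_eq_eq by (simp add: add_divide_distrib)
    then show thesis using that admissible unfolding admissible_def by blast
  qed
  then show thesis
  proof cases
    case 1
    then show ?thesis by (intro that(1)) (simp add: gc_diag)
  next
    case 2
    have "chi_mode \<chi> 0 \<noteq> (of_int m + 1) / 2" for m
    proof
      assume "chi_mode \<chi> 0 = (of_int m + 1) / 2"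
      then have "2 * chi_mode \<chi> 0 = of_int (m + 1)" by (simp add: mult.commute)
      then show False using 2 by (metis Ints_of_int)
    qed
    then show ?thesis using 2(1) by (intro that(1), subst gc_diag) simp
  next
    case 3
    show ?thesis by (intro that(1), subst gc_diag) (simp add: 3 add_divide_distrib)
  next
    case 4
    then show ?thesis by (rule that(2))
  qed
qed

lemma lead_nz: "n > 0 \<Longrightarrow> gc (int P - int n) (- int n) \<noteq> 0"
proof (cases rule: admissible_cases)
  case 1
  then show "n > 0 \<Longrightarrow> ?thesis" using 1[of "- int n"] by simp
next
  case (2 L)
  assume "n > 0"
  have "(of_nat L + 1) / 2 \<noteq> (1 - of_nat n :: complex) / 2"
  proof
    assume "(of_nat L + 1) / 2 = (1 - of_nat n :: complex) / 2"
    then have "of_nat L + 1 = (1 - of_nat n :: complex)" by simp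
    then have "(of_nat (L + n) :: complex) = 0" by (simp add: algebra_simps)
    then show False using \<open>n > 0\<close> by (simp only: of_nat_eq_0_iff)
  qed
  then show ?thesis using 2 gc_diag[of "- int n"] by simp
qed

sublocale clifford_chi_lead s i Phi vac P \<chi>
  by unfold_locales (rule lead_nz)

lemma vac_mem:
  assumes U: "subspace U" "\<And>R w. w \<in> U \<Longrightarrow> G R w \<in> U" "w \<in> U" "w \<noteq> 0"
  shows "vac \<in> U"
proof (cases rule: admissible_cases)
  case 1
  then show ?thesis using U by (intro vac_mem_nonresonant[of U w]) auto
next
  case (2 L)
  have chi': "chi_mode \<chi> N = 0" if "N > 0" for N using that chi 2(1) by simp
  obtain \<tau> :: "nat \<Rightarrow> complex" where tau: "\<tau> 0 = 1"
    "\<And>n. of_nat n * \<tau> n = - 2 * (\<Sum>k<n. chi_mode \<chi> (int k - int n) * \<tau> k)"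
    "(\<Sum>n\<le>2 * L. (-1) ^ n * \<tau> n * \<tau> (2 * L - n)) \<noteq> 0"
    using resonant_coefficients[OF chi' 2(3) 2(2) 2(4)] by blast
  \<comment> \<open>The coefficients run downwards from the resonant mode L. At R = L - n the
    diagonal coefficient is n/2, so the relation required of \<open>t\<close> is half the recursion
    for \<open>\<tau> n\<close>.\<close>
  define t where "t R = (if R > int L then 0 else \<tau> (nat (int L - R)))" for R
  have diag: "gc R R = (of_nat L - of_int R) / 2" for R
    using gc_diag[of R] 2(1,3) by (simp add: diff_divide_distrib add_divide_distrib)
  show ?thesis
  proof (rule vac_mem_resonant[of "int L" t U w])
    fix R :: int
    show "(\<Sum>m\<in>{R..int L}. gc R m * t m) = 0"
    proof (cases "R \<le> int L")
      case True
      define n where "n = nat (int L - R)"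
      have R: "R = int L - int n" using True by (simp add: n_def)
      have "(\<Sum>m\<in>{R..int L}. gc R m * t m) = (\<Sum>k\<le>n. gc R (int L - int k) * \<tau> k)"
        by (rule sum.reindex_bij_witness[of _ "\<lambda>k. int L - int k" "\<lambda>m. nat (int L - m)"])
          (auto simp: R t_def)
      also have "{..n} = insert n {..<n}" by auto
      also have "(\<Sum>k\<in>insert n {..<n}. gc R (int L - int k) * \<tau> k) =
          gc R R * \<tau> n + (\<Sum>k<n. gc R (int L - int k) * \<tau> k)"
        by (simp add: R)
      also have "(\<Sum>k<n. gc R (int L - int k) * \<tau> k) = (\<Sum>k<n. chi_mode \<chi> (int k - int n) * \<tau> k)"
        by (rule sum.cong) (auto simp: gc_def R)
      also have "gc R R = of_nat n / 2" by (simp add: diag R)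
      finally show ?thesis using tau(2)[of n] by simp
    qed simp
  next
    have "(\<Sum>R\<in>{- int L..int L}. (-1) powi R * t R * t (- R)) =
        (\<Sum>n\<le>2 * L. (-1) ^ L * ((-1) ^ n * \<tau> n * \<tau> (2 * L - n)))"
    proof (rule sum.reindex_bij_witness[of _ "\<lambda>n. int L - int n" "\<lambda>R. nat (int L - R)"])
      fix R assume R: "R \<in> {- int L..int L}"
      define n where "n = nat (int L - R)"
      have R': "R = int L - int n" "n \<le> 2 * L" using R by (auto simp: n_def)
      have "nat (int L + R) = 2 * L - n" "R + int n = int L" using R' by auto
      moreover have "(-1 :: complex) powi R = (-1) ^ L * (-1) ^ n"
        unfolding R' by (cases "even n") (simp_all add: power_int_diff)
      ultimately show "(-1) ^ L * ((-1) ^ nat (int L - R) * \<tau> (nat (int L - R)) *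
          \<tau> (2 * L - nat (int L - R))) = (-1) powi R * t R * t (- R)"
        using R by (simp add: t_def n_def)
    qed auto
    also have "\<dots> = (-1) ^ L * (\<Sum>n\<le>2 * L. (-1) ^ n * \<tau> n * \<tau> (2 * L - n))"
      by (simp add: sum_distrib_left)
    finally show "(\<Sum>R\<in>{- int L..int L}. (-1) powi R * t R * t (- R)) \<noteq> 0"
      using tau(3) by simp
  next
    fix R :: int assume "R \<noteq> int L"
    then have "(of_nat L - of_int R :: complex) \<noteq> 0"
      by (metis eq_iff_diff_eq_0 of_int_eq_iff of_int_of_nat_eq)
    then show "gc R R \<noteq> 0" by (simp add: diag)
  qed (use 2 U tau(1) in \<open>auto simp: t_def\<close>)
qed

lemma G_irreducible:
  assumes "subspace U" "\<And>R w. w \<in> U \<Longrightarrow> G R w \<in> U" "U \<noteq> {0}"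
  shows "U = UNIV"
proof -
  have "0 \<in> U" using assms(1) by (rule subspace_0)
  then obtain w where "w \<in> U" "w \<noteq> 0" using assms(3) by blast
  then have "vac \<in> U" by (intro vac_mem[OF assms(1,2)])
  then show ?thesis by (intro G_stable_UNIV[OF assms(1)] assms(2))
qed

lemma atw_irreducible_module_rho: "atw_irreducible_module s rho"
  unfolding atw_irreducible_module_def irreducible_under_def is_subspace_def
proof (intro conjI allI impI)
  show "\<exists>v. v \<noteq> (0 :: 'v)" using vac_nz by blast
  fix U assume U: "subspace U \<and> (\<forall>T\<in>range rho. T ` U \<subseteq> U)"
  have stable: "G R w \<in> U" if "w \<in> U" for R w
  proof -
    have "rho (Poly_Mapping.single (G_gen R) 1) ` U \<subseteq> U" using U by blast
    then have "rho (Poly_Mapping.single (G_gen R) 1) w \<in> U" using that by blast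
    then show ?thesis by (simp add: rho_single)
  qed
  show "U = {0} \<or> U = UNIV"
  proof (cases "U = {0}")
    case False
    have "U = UNIV" by (rule G_irreducible[OF _ stable False]) (use U in auto)
    then show ?thesis ..
  qed simp
qed (rule atw_module_rho)

end

section \<open>Tensor products with the Fock space\<close>

lemma sum_singles: "(\<Sum>c\<in>Poly_Mapping.keys u. Poly_Mapping.single c (Poly_Mapping.lookup u c)) = u"
  by (rule poly_mapping_eqI)
    (simp add: lookup_sum lookup_single when_def in_keys_iff sum.delta')

lemma pm_scale_mult: "pm_scale (*) c u = Poly_Mapping.single 0 c * (u :: fock)"
  by (simp add: pm_scale_def mult_map_scale_conv_mult)

lemma vector_space_fock: "vector_space (pm_scale (*) :: complex \<Rightarrow> fock \<Rightarrow> fock)"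
  by (rule vector_space_pm_scale[OF vector_space_mult])

lemmas lookup_fock_scale = lookup_pm_scale[OF vector_space_mult]

lemma fock_var_mult_single:
  "fock_var n * Poly_Mapping.single c a = Poly_Mapping.single (Poly_Mapping.single n 1 + c) a"
  by (simp add: fock_var_def mult_single)

lemma lookup_fock_var_mult:
  "Poly_Mapping.lookup (fock_var n * u) (Poly_Mapping.single n 1 + b) = Poly_Mapping.lookup u b"
  "Poly_Mapping.lookup b n = 0 \<Longrightarrow> Poly_Mapping.lookup (fock_var n * u) b = 0"
proof -
  have "fock_var n * u = (\<Sum>c\<in>Poly_Mapping.keys u.
      Poly_Mapping.single (Poly_Mapping.single n 1 + c) (Poly_Mapping.lookup u c))"
    by (subst sum_singles[of u, symmetric]) (simp add: sum_distrib_left fock_var_mult_single)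
  then have l: "Poly_Mapping.lookup (fock_var n * u) b' = (\<Sum>c\<in>Poly_Mapping.keys u.
      if Poly_Mapping.single n 1 + c = b' then Poly_Mapping.lookup u c else 0)" for b'
    by (simp add: lookup_sum lookup_single when_def)
  show "Poly_Mapping.lookup (fock_var n * u) (Poly_Mapping.single n 1 + b) = Poly_Mapping.lookup u b"
    unfolding l by (simp add: in_keys_iff sum.delta)
  show "Poly_Mapping.lookup (fock_var n * u) b = 0" if "Poly_Mapping.lookup b n = 0"
    unfolding l using that by (intro sum.neutral) (auto simp: lookup_add)
qed

section \<open>Total degree and induction on monomials\<close>

definition deg :: "monomial \<Rightarrow> nat"
  where "deg b = Sum_any (Poly_Mapping.lookup b)"

lemma deg_add: "deg (a + b) = deg a + deg b"
  unfolding deg_def lookup_add by (rule Sum_any.distrib) simp_all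

lemma deg_single: "deg (Poly_Mapping.single n 1) = 1"
  by (simp add: deg_def lookup_single)

lemma deg_0: "deg 0 = 0"
  by (simp add: deg_def)

lemma monomial_decomp:
  assumes "Poly_Mapping.lookup b n \<noteq> 0"
  obtains b' :: monomial where "b = Poly_Mapping.single n 1 + b'"
proof
  show "b = Poly_Mapping.single n 1 + (b - Poly_Mapping.single n 1)"
    using assms by (intro poly_mapping_eqI) (auto simp: lookup_add lookup_minus lookup_single when_def)
qed

lemma monomial_cases:
  obtains "b = 0" | n b' where "b = Poly_Mapping.single n 1 + (b' :: monomial)"
proof (cases "b = 0")
  case False
  then obtain n where "Poly_Mapping.lookup b n \<noteq> 0" by (metis lookup_zero poly_mapping_eqI)
  then show ?thesis using that(2) monomial_decomp by metis
qed

lemma monomial_induct [case_names zero add]: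
  assumes "Q 0" "\<And>n b. Q b \<Longrightarrow> Q (Poly_Mapping.single n 1 + b)"
  shows "Q (b :: monomial)"
proof (induction "deg b" arbitrary: b rule: less_induct)
  case less
  show ?case
  proof (cases b rule: monomial_cases)
    case (2 n b')
    then have "deg b' < deg b" by (simp only: deg_add deg_single)
    then show ?thesis using less assms(2) 2 by simp
  qed (use assms(1) in simp)
qed

section \<open>Operators on the tensor product\<close>

context clifford_chi_admissible
begin

sublocale tensor: vector_space "pm_scale s :: complex \<Rightarrow> (monomial \<Rightarrow>\<^sub>0 'v) \<Rightarrow> (monomial \<Rightarrow>\<^sub>0 'v)"
  by (rule vector_space_pm_scale[OF vector_space_axioms])

lemmas lookup_scale = lookup_pm_scale[OF vector_space_axioms]

lemma lookup_tens: "Poly_Mapping.lookup (tens s v u) b = s (Poly_Mapping.lookup u b) v"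
  by (auto simp: tens_def lookup_sum lookup_single when_def in_keys_iff sum.delta')

lemma tens_simps:
  "tens s (v + v') u = tens s v u + tens s v' u"
  "tens s (s c v) u = pm_scale s c (tens s v u)"
  "tens s 0 u = 0"
  "tens s v (u + u') = tens s v u + tens s v u'"
  "tens s v (pm_scale (*) c u) = pm_scale s c (tens s v u)"
  "tens s v 0 = 0"
  "tens s v (Poly_Mapping.single b c) = Poly_Mapping.single b (s c v)"
  by (auto intro!: poly_mapping_eqI simp: lookup_tens lookup_add lookup_scale lookup_fock_scale
      scale_right_distrib scale_left_distrib mult.commute lookup_single when_def)

lemma lookup_tens_op:
  assumes "A 0 = 0" "finite K" "Poly_Mapping.keys w \<subseteq> K"
  shows "Poly_Mapping.lookup (tens_op s A B w) b =
    (\<Sum>c\<in>K. s (Poly_Mapping.lookup (B (Poly_Mapping.single c 1)) b) (A (Poly_Mapping.lookup w c)))"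
  unfolding tens_op_def lookup_sum lookup_tens
  by (rule sum.mono_neutral_left) (use assms in \<open>auto simp: in_keys_iff\<close>)

lemma tens_op_single:
  "A 0 = 0 \<Longrightarrow> tens_op s A B (Poly_Mapping.single c v) = tens s (A v) (B (Poly_Mapping.single c 1))"
  by (rule poly_mapping_eqI) (simp add: lookup_tens_op[of A "{c}"] lookup_tens)

lemma lookup_tens_op_id:
  "A 0 = 0 \<Longrightarrow> Poly_Mapping.lookup (tens_op s A id w) b = A (Poly_Mapping.lookup w b)"
  by (subst lookup_tens_op[of A "insert b (Poly_Mapping.keys w)"])
    (auto simp: lookup_single when_def if_distrib[of "\<lambda>x. s x _"] sum.delta cong: if_cong)

lemma tens_op_tens:
  "A 0 = 0 \<Longrightarrow> (\<And>c v. A (s c v) = s c (A v)) \<Longrightarrow> tens_op s A id (tens s v u) = tens s (A v) u"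
  by (rule poly_mapping_eqI) (simp add: lookup_tens_op_id lookup_tens)

definition xmul :: "nat \<Rightarrow> (monomial \<Rightarrow>\<^sub>0 'v) \<Rightarrow> (monomial \<Rightarrow>\<^sub>0 'v)"
  where "xmul n = tens_op s id (fock_beta (- (2 * int n + 1)))"

text \<open>On the Fock factor this is -(n + 1/2) times the partial derivative in x_n, while
  \<open>xmul n\<close> is multiplication by x_n.\<close>

definition xder :: "nat \<Rightarrow> (monomial \<Rightarrow>\<^sub>0 'v) \<Rightarrow> (monomial \<Rightarrow>\<^sub>0 'v)"
  where "xder n = tens_op s id (fock_beta (2 * int n + 1))"

lemma xmul_eq: "xmul n = tens_op s id ((*) (fock_var n))"
proof -
  have "fock_beta (- (2 * int n + 1)) = (*) (fock_var n)"
    by (simp add: fock_beta_def fun_eq_iff)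
  then show ?thesis by (simp only: xmul_def)
qed

lemma xmul_single: "xmul n (Poly_Mapping.single c v) = Poly_Mapping.single (Poly_Mapping.single n 1 + c) v"
  unfolding xmul_eq by (subst tens_op_single) (simp_all only: id_apply
      fock_var_mult_single tens_simps scale_one)

lemma xmul_tens: "xmul n (tens s v u) = tens s v (fock_var n * u)"
proof (rule poly_mapping_eqI)
  fix b
  have "Poly_Mapping.lookup (xmul n (tens s v u)) b = (\<Sum>c\<in>Poly_Mapping.keys u.
      s (Poly_Mapping.lookup (fock_var n * Poly_Mapping.single c 1) b * Poly_Mapping.lookup u c) v)"
    unfolding xmul_eq
    by (subst lookup_tens_op[of id "Poly_Mapping.keys u"])
      (auto simp: in_keys_iff lookup_tens)
  also have "\<dots> = s (Poly_Mapping.lookup (\<Sum>c\<in>Poly_Mapping.keys u.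
      fock_var n * Poly_Mapping.single c (Poly_Mapping.lookup u c)) b) v"
    by (simp add: scale_sum_left lookup_sum fock_var_mult_single lookup_single when_def
        if_distrib[of "\<lambda>x. x * _"] cong: if_cong)
  also have "(\<Sum>c\<in>Poly_Mapping.keys u. fock_var n * Poly_Mapping.single c (Poly_Mapping.lookup u c)) =
      fock_var n * u"
    by (simp only: sum_distrib_left[symmetric] sum_singles)
  finally show "Poly_Mapping.lookup (xmul n (tens s v u)) b =
      Poly_Mapping.lookup (tens s v (fock_var n * u)) b"
    by (simp add: lookup_tens)
qed

lemma lookup_xder:
  "Poly_Mapping.lookup (xder n w) b =
    s (- ((2 * of_nat n + 1) / 2) * of_nat (Poly_Mapping.lookup b n + 1))
      (Poly_Mapping.lookup w (Poly_Mapping.single n 1 + b))"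
proof -
  let ?b = "Poly_Mapping.single n 1 + b"
  let ?d = "s (- ((2 * of_nat n + 1) / 2) * of_nat (Poly_Mapping.lookup b n + 1))
      (Poly_Mapping.lookup w ?b)"
  have pderiv: "Poly_Mapping.lookup (fock_pderiv n (Poly_Mapping.single c 1)) b =
      (if c = ?b then of_nat (Poly_Mapping.lookup b n + 1) else 0)" for c
  proof -
    have "Poly_Mapping.lookup (fock_pderiv n (Poly_Mapping.single c 1)) b =
        (if c - Poly_Mapping.single n 1 = b then of_nat (Poly_Mapping.lookup c n) else 0)"
      by (simp add: fock_pderiv_def lookup_single when_def)
    \<comment> \<open>Subtraction of exponents is truncated: if x_n does not divide c, the shifted
      monomial may still equal b, but then the factor \<open>lookup c n\<close> is 0.\<close>
    also have "\<dots> = (if c = ?b then of_nat (Poly_Mapping.lookup b n + 1) else 0)"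
    proof (cases "Poly_Mapping.lookup c n = 0")
      case True
      then have "c \<noteq> ?b" by (auto simp: lookup_add)
      then show ?thesis using True by simp
    next
      case False
      then obtain b' where "c = Poly_Mapping.single n 1 + b'" by (rule monomial_decomp)
      then show ?thesis by (simp add: lookup_add)
    qed
    finally show ?thesis .
  qed
  have "Poly_Mapping.lookup (xder n w) b = (\<Sum>c\<in>insert ?b (Poly_Mapping.keys w).
      s (Poly_Mapping.lookup (fock_beta (2 * int n + 1) (Poly_Mapping.single c 1)) b)
        (Poly_Mapping.lookup w c))"
    unfolding xder_def by (subst lookup_tens_op[of id "insert ?b (Poly_Mapping.keys w)"]) auto
  also have "\<dots> = (\<Sum>c\<in>insert ?b (Poly_Mapping.keys w). if c = ?b then ?d else 0)"
    by (rule sum.cong) (auto simp: fock_beta_def lookup_fock_scale pderiv)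
  also have "\<dots> = ?d" by (subst sum.delta) auto
  finally show ?thesis .
qed

lemma h_mode_odd:
  "h_mode s \<chi> (- (2 * int n + 1)) w =
    pm_scale s (-2) (xmul n w) + pm_scale s (2 * chi_mode \<chi> (- (2 * int n + 1))) w"
  "h_mode s \<chi> (2 * int n + 1) w =
    pm_scale s (-2) (xder n w) + pm_scale s (2 * chi_mode \<chi> (2 * int n + 1)) w"
  by (simp_all add: h_mode_def xmul_def xder_def)

end

section \<open>The basis of the tensor product\<close>

definition mode_lists :: "nat list set"
  where "mode_lists = {ms. sorted_wrt (\<ge>) ms \<and> (\<forall>m\<in>set ms. odd m)}"

text \<open>The doubled mode m = 2n + 1 belongs to the variable x_n, and n is
  \<open>m div 2\<close>.\<close>

definition mon :: "nat list \<Rightarrow> monomial"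
  where "mon ms = (\<Sum>m\<leftarrow>ms. Poly_Mapping.single (m div 2) 1)"

lemma mon_simps: "mon [] = 0" "mon (m # ms) = Poly_Mapping.single (m div 2) 1 + mon ms"
  by (simp_all add: mon_def)

lemma deg_mon: "deg (mon ms) = length ms"
  by (induction ms) (simp_all add: mon_simps deg_0 deg_add deg_single[simplified])

lemma lookup_mon:
  "\<forall>m\<in>set ms. odd m \<Longrightarrow> Poly_Mapping.lookup (mon ms) n = count (mset ms) (2 * n + 1)"
proof (induction ms)
  case (Cons m ms)
  then have "odd m" by simp
  then obtain k where m: "m = 2 * k + 1" by (rule oddE)
  have IH: "Poly_Mapping.lookup (mon ms) n = count (mset ms) (2 * n + 1)" using Cons by simp
  show ?case unfolding mon_simps lookup_add IH by (simp add: m lookup_single when_def)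
qed (simp add: mon_simps)

lemma sorted_desc_mset_eq:
  assumes "sorted_wrt (\<ge>) xs" "sorted_wrt (\<ge>) ys" "mset xs = mset (ys :: nat list)"
  shows "xs = ys"
proof -
  have "sorted (rev xs)" "sorted (rev ys)" using assms by (simp_all add: sorted_wrt_rev)
  then have "sort (rev ys) = rev xs" "sort (rev ys) = rev ys"
    using assms(3) by (intro properties_for_sort; simp)+
  then show ?thesis by simp
qed

lemma mon_inj:
  assumes "ms \<in> mode_lists" "ms' \<in> mode_lists" "mon ms = mon ms'"
  shows "ms = ms'"
proof (rule sorted_desc_mset_eq)
  have odd: "\<forall>m\<in>set ms. odd m" "\<forall>m\<in>set ms'. odd m"
    using assms by (auto simp: mode_lists_def)
  show "mset ms = mset ms'"
  proof (rule multiset_eqI)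
    fix k
    show "count (mset ms) k = count (mset ms') k"
    proof (cases "odd k")
      case True
      then obtain n where "k = 2 * n + 1" by (rule oddE)
      then show ?thesis using lookup_mon[of ms n] lookup_mon[of ms' n] odd assms(3) by simp
    next
      case False
      then have "k \<notin> set ms" "k \<notin> set ms'" using odd by blast+
      then have "count (mset ms) k = 0" "count (mset ms') k = 0"
        by (simp_all add: count_eq_zero_iff)
      then show ?thesis by (simp only:)
    qed
  qed
qed (use assms in \<open>auto simp: mode_lists_def\<close>)

text \<open>The mode h(-m) multiplies the Fock factor by this inhomogeneous linear polynomial; the
  constant comes from the half-odd part of \<chi>.\<close>

definition lin_factor :: "complex fls \<Rightarrow> nat \<Rightarrow> fock"
  where "lin_factor \<chi> m = Poly_Mapping.single 0 (-2) * fock_var (m div 2)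
    + Poly_Mapping.single 0 (2 * chi_mode \<chi> (- int m))"

definition qpoly :: "complex fls \<Rightarrow> nat list \<Rightarrow> fock"
  where "qpoly \<chi> ms = prod_list (map (lin_factor \<chi>) ms)"

lemma lin_factor_mult: "lin_factor \<chi> m * u =
  pm_scale (*) (-2) (fock_var (m div 2) * u) + pm_scale (*) (2 * chi_mode \<chi> (- int m)) u"
  by (simp add: lin_factor_def pm_scale_mult distrib_right mult.assoc)

text \<open>The constants in the linear factors affect only degrees below the number of factors, so
  from that degree on only the leading monomial is visible.\<close>

lemma lookup_qpoly:
  assumes "length ms \<le> deg b"
  shows "Poly_Mapping.lookup (qpoly \<chi> ms) b = (if b = mon ms then (-2) ^ length ms else 0)"
  using assms
proof (induction ms arbitrary: b)
  case Nil
  then show ?case by (simp add: qpoly_def mon_simps lookup_one when_def)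
next
  case (Cons m ms)
  define n where "n = m div 2"
  have "b \<noteq> mon ms" using Cons.prems deg_mon[of ms] by auto
  then have 0: "Poly_Mapping.lookup (qpoly \<chi> ms) b = 0" using Cons by simp
  have "Poly_Mapping.lookup (fock_var n * qpoly \<chi> ms) b =
      (if b = mon (m # ms) then (-2) ^ length ms else 0)"
  proof (cases "Poly_Mapping.lookup b n = 0")
    case True
    then have "b \<noteq> mon (m # ms)" by (auto simp: mon_simps n_def lookup_add)
    with True show ?thesis by (simp add: lookup_fock_var_mult)
  next
    case False
    then obtain b' where b': "b = Poly_Mapping.single n 1 + b'" by (rule monomial_decomp)
    then have "length ms \<le> deg b'" using Cons.prems by (simp only: deg_add deg_single list.size)
    then show ?thesis unfolding b' mon_simps n_def[symmetric] lookup_fock_var_mult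
      using Cons.IH by simp
  qed
  moreover have "qpoly \<chi> (m # ms) = lin_factor \<chi> m * qpoly \<chi> ms" by (simp add: qpoly_def)
  ultimately show ?case
    by (simp add: lin_factor_mult lookup_add lookup_fock_scale 0 n_def[symmetric])
qed

text \<open>In a nontrivial relation, a list of maximal length with nonzero coefficient is chosen;
  by \<open>lookup_qpoly\<close> and \<open>mon_inj\<close> no other term contributes to its leading
  monomial.\<close>

lemma indep_qpoly: "indep_family (pm_scale (*)) mode_lists (qpoly \<chi>)"
  unfolding indep_family_def
proof (intro allI impI, rule ccontr)
  fix T c
  assume T: "finite T" "T \<subseteq> mode_lists" "(\<Sum>k\<in>T. pm_scale (*) (c k) (qpoly \<chi> k)) = 0"
    and "\<not> (\<forall>k\<in>T. c k = 0)"
  define T' where "T' = {k\<in>T. c k \<noteq> 0}"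
  have "finite (length ` T')" "length ` T' \<noteq> {}"
    using T(1) \<open>\<not> (\<forall>k\<in>T. c k = 0)\<close> by (auto simp: T'_def)
  then have "Max (length ` T') \<in> length ` T'" by (rule Max_in)
  then obtain ms where ms: "ms \<in> T'" "length ms = Max (length ` T')" by auto
  have max: "length k \<le> length ms" if "k \<in> T'" for k
    using that \<open>finite (length ` T')\<close> ms(2) by simp
  have "(\<Sum>k\<in>T. c k * Poly_Mapping.lookup (qpoly \<chi> k) (mon ms)) = 0"
    using arg_cong[OF T(3), of "\<lambda>u. Poly_Mapping.lookup u (mon ms)"]
    by (simp add: lookup_sum lookup_fock_scale)
  also have "(\<Sum>k\<in>T. c k * Poly_Mapping.lookup (qpoly \<chi> k) (mon ms)) =
      (\<Sum>k\<in>T. if ms = k then c ms * (-2) ^ length ms else 0)"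
  proof (rule sum.cong)
    fix k assume k: "k \<in> T"
    show "c k * Poly_Mapping.lookup (qpoly \<chi> k) (mon ms) =
        (if ms = k then c ms * (-2) ^ length ms else 0)"
    proof (cases "c k = 0")
      case False
      then have "k \<in> T'" using k by (simp add: T'_def)
      then have "length k \<le> deg (mon ms)" using max by (simp add: deg_mon)
      moreover have "mon ms = mon k \<longleftrightarrow> ms = k"
        using mon_inj[of ms k] ms(1) k T(2) by (auto simp: T'_def)
      ultimately show ?thesis by (simp add: lookup_qpoly)
    qed auto
  qed simp
  also have "\<dots> = c ms * (-2) ^ length ms"
    using ms(1) T(1) by (simp add: T'_def)
  finally show False using ms(1) by (simp add: T'_def)
qed

text \<open>The factors commute, so a further one can be sorted into place and the span is closed
  under linear factors. Removing the constants closes it under the variables, and all monomials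
  follow from \<open>1\<close>.\<close>

lemma span_qpoly: "Modules.module.span (pm_scale (*)) (qpoly \<chi> ` mode_lists) = UNIV"
proof -
  interpret F: vector_space "pm_scale (*) :: complex \<Rightarrow> fock \<Rightarrow> fock" by (rule vector_space_fock)
  let ?S = "F.span (qpoly \<chi> ` mode_lists)"
  have lin: "lin_factor \<chi> m * u \<in> ?S" if "u \<in> ?S" "odd m" for m u
    using that(1)
  proof (induction rule: F.span_induct_alt)
    case base
    show ?case by (simp add: F.span_zero)
  next
    case (step c x y)
    from step(1) obtain ms where ms: "ms \<in> mode_lists" "x = qpoly \<chi> ms" by (rule imageE)
    define ns where "ns = rev (sort (m # ms))"
    have ns: "ns \<in> mode_lists"
    proof -
      have "sorted_wrt (\<ge>) ns"
        unfolding ns_def sorted_wrt_rev by (rule sorted_sort)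
      moreover have "set ns = insert m (set ms)" by (simp add: ns_def set_insort_key)
      ultimately show ?thesis using ms(1) \<open>odd m\<close> by (simp add: mode_lists_def)
    qed
    have eq: "qpoly \<chi> ns = lin_factor \<chi> m * x"
    proof -
      have "mset (map (lin_factor \<chi>) ns) = mset (map (lin_factor \<chi>) (m # ms))"
        by (simp add: ns_def)
      then have "prod_list (map (lin_factor \<chi>) ns) = prod_list (map (lin_factor \<chi>) (m # ms))"
        by (simp only: prod_mset_prod_list[symmetric])
      then show ?thesis by (simp add: qpoly_def ms(2))
    qed
    have x: "lin_factor \<chi> m * x \<in> ?S"
      unfolding eq[symmetric] by (intro F.span_base imageI ns)
    have "lin_factor \<chi> m * (pm_scale (*) c x + y) =
        pm_scale (*) c (lin_factor \<chi> m * x) + lin_factor \<chi> m * y"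
      by (simp add: pm_scale_mult distrib_left mult.left_commute)
    then show ?case by (simp only:) (intro F.span_add F.span_scale x step.IH)
  qed
  have var: "fock_var n * u \<in> ?S" if "u \<in> ?S" for n u
  proof -
    have "pm_scale (*) (-2) (fock_var n * u) =
        lin_factor \<chi> (2 * n + 1) * u - pm_scale (*) (2 * chi_mode \<chi> (- int (2 * n + 1))) u"
      unfolding lin_factor_mult by simp
    also have "\<dots> \<in> ?S" by (intro F.span_diff F.span_scale lin that) simp
    finally have "pm_scale (*) (- 1 / 2) (pm_scale (*) (-2) (fock_var n * u)) \<in> ?S"
      by (rule F.span_scale)
    then show ?thesis by (simp only: F.scale_scale) simp
  qed
  have single: "Poly_Mapping.single b 1 \<in> ?S" for b
  proof (induction b rule: monomial_induct)
    case zero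
    have "(1 :: fock) = qpoly \<chi> []" by (simp add: qpoly_def)
    moreover have "[] \<in> mode_lists" by (simp add: mode_lists_def)
    ultimately show ?case
      using F.span_base[OF imageI[of "[]" mode_lists "qpoly \<chi>"]] by simp
  next
    case (add n b)
    from var[OF this, of n] show ?case by (simp only: fock_var_mult_single)
  qed
  have "u \<in> ?S" for u
  proof -
    have "pm_scale (*) c (Poly_Mapping.single b 1) = (Poly_Mapping.single b c :: fock)" for b c
      by (simp add: pm_scale_mult mult_single)
    then have "Poly_Mapping.single b c \<in> ?S" for b c
      using F.span_scale[OF single[of b], of c] by simp
    then have "(\<Sum>c\<in>Poly_Mapping.keys u. Poly_Mapping.single c (Poly_Mapping.lookup u c)) \<in> ?S"
      by (rule F.span_sum)
    then show ?thesis by (simp only: sum_singles)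
  qed
  then show ?thesis by blast
qed

section \<open>Products of the two bases\<close>

context clifford_chi_admissible
begin

text \<open>At each Fock monomial the relation becomes one between the \<open>x a\<close>, so its
  scalar coefficients vanish. For fixed a, these vanishing coefficients form a relation between the
  \<open>q b\<close>.\<close>

lemma indep_tens:
  assumes A: "indep_family s A x" and B: "indep_family (pm_scale (*)) B q"
  shows "indep_family (pm_scale s) (A \<times> B) (\<lambda>(a, b). tens s (x a) (q b :: fock))"
  unfolding indep_family_def
proof (intro allI impI ballI)
  fix T c k
  assume T: "finite T" "T \<subseteq> A \<times> B"
    "(\<Sum>k\<in>T. pm_scale s (c k) (case k of (a, b) \<Rightarrow> tens s (x a) (q b))) = 0" "k \<in> T"
  \<comment> \<open>Extension by zero from \<open>T\<close> to the rectangle spanned by its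
    projections.\<close>
  define c' where "c' k = (if k \<in> T then c k else 0)" for k
  have fin: "finite (fst ` T)" "finite (snd ` T)" and sub: "fst ` T \<subseteq> A" "snd ` T \<subseteq> B"
    using T by auto
  have coeff: "(\<Sum>b\<in>snd ` T. c' (a, b) * Poly_Mapping.lookup (q b) m) = 0"
    if a: "a \<in> fst ` T" for a m
  proof (rule indep_familyD[OF A fin(1) sub(1) _ a])
    have "0 = (\<Sum>(a, b)\<in>T. s (c' (a, b) * Poly_Mapping.lookup (q b) m) (x a))"
      using arg_cong[OF T(3), of "\<lambda>w. Poly_Mapping.lookup w m"]
      by (simp add: lookup_sum lookup_scale case_prod_unfold lookup_tens c'_def)
    also have "\<dots> = (\<Sum>(a, b)\<in>fst ` T \<times> snd ` T. s (c' (a, b) * Poly_Mapping.lookup (q b) m) (x a))"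
      by (rule sum.mono_neutral_left) (use fin in \<open>auto simp: c'_def image_iff\<close>, force+)
    also have "\<dots> = (\<Sum>a\<in>fst ` T. s (\<Sum>b\<in>snd ` T. c' (a, b) * Poly_Mapping.lookup (q b) m) (x a))"
      by (simp add: sum.cartesian_product[symmetric] scale_sum_left)
    finally show "(\<Sum>a\<in>fst ` T. s (\<Sum>b\<in>snd ` T. c' (a, b) * Poly_Mapping.lookup (q b) m) (x a)) = 0"
      by simp
  qed
  obtain a b where k: "k = (a, b)" by (cases k)
  then have ab: "a \<in> fst ` T" "b \<in> snd ` T" using T(4) by force+
  have "(\<Sum>b\<in>snd ` T. pm_scale (*) (c' (a, b)) (q b)) = 0"
    by (rule poly_mapping_eqI) (simp add: lookup_sum lookup_fock_scale coeff[OF ab(1)])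
  from indep_familyD[OF B fin(2) sub(2) this ab(2)] show "c k = 0"
    using T(4) by (simp add: c'_def k)
qed

lemma span_tens:
  assumes A: "span (x ` A) = UNIV" and B: "Modules.module.span (pm_scale (*)) (q ` B) = UNIV"
  shows "tensor.span ((\<lambda>(a, b). tens s (x a) (q b :: fock)) ` (A \<times> B)) = UNIV"
proof -
  interpret F: vector_space "pm_scale (*) :: complex \<Rightarrow> fock \<Rightarrow> fock" by (rule vector_space_fock)
  let ?S = "tensor.span ((\<lambda>(a, b). tens s (x a) (q b)) ` (A \<times> B))"
  have 1: "tens s v (q b) \<in> ?S" if b: "b \<in> B" for v b
  proof -
    have "v \<in> span (x ` A)" by (simp add: A)
    then show ?thesis
    proof (induction rule: span_induct_alt)
      case (step c y z)
      then show ?case using b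
        by (auto simp: tens_simps intro!: tensor.span_add tensor.span_scale intro: tensor.span_base)
    qed (simp add: tens_simps tensor.span_zero)
  qed
  have 2: "tens s v u \<in> ?S" for v u
  proof -
    have "u \<in> F.span (q ` B)" by (simp add: B)
    then show ?thesis
    proof (induction rule: F.span_induct_alt)
      case (step c y z)
      then show ?case using 1
        by (auto simp: tens_simps intro!: tensor.span_add tensor.span_scale)
    qed (simp add: tens_simps tensor.span_zero)
  qed
  have "w \<in> ?S" for w
  proof -
    have "Poly_Mapping.single b v \<in> ?S" for b v
      using 2[of v "Poly_Mapping.single b 1"] by (simp add: tens_simps)
    then have "(\<Sum>c\<in>Poly_Mapping.keys w. Poly_Mapping.single c (Poly_Mapping.lookup w c)) \<in> ?S"
      by (rule tensor.span_sum)
    then show ?thesis by (simp only: sum_singles)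
  qed
  then show ?thesis by blast
qed

text \<open>The modes of h multiply the second factor by linear polynomials and the modes of G act
  on the first, so the basis vectors are pure tensors of the two bases.\<close>

lemma basis_vector_eq:
  assumes "\<forall>m\<in>set ms. odd m"
  shows "basis_vector s Phi vac \<chi> P (ns, ms) = tens s (xvec ns) (qpoly \<chi> ms)"
proof -
  have h: "foldr (\<lambda>m. h_mode s \<chi> (- int m)) ms (tens s vac 1) = tens s vac (qpoly \<chi> ms)"
    using assms
  proof (induction ms)
    case (Cons m ms)
    then have "odd m" by simp
    then obtain n where n: "m = 2 * n + 1" by (rule oddE)
    have "foldr (\<lambda>m. h_mode s \<chi> (- int m)) (m # ms) (tens s vac 1) =
        h_mode s \<chi> (- int m) (tens s vac (qpoly \<chi> ms))"
      using Cons by simp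
    also have im: "- int m = - (2 * int n + 1)" by (simp add: n)
    also have "h_mode s \<chi> (- (2 * int n + 1)) (tens s vac (qpoly \<chi> ms)) =
        tens s vac (lin_factor \<chi> m * qpoly \<chi> ms)"
    proof -
      have "m div 2 = n" by (simp add: n)
      then show ?thesis
        unfolding h_mode_odd xmul_tens lin_factor_mult im by (simp only: tens_simps)
    qed
    finally show ?case by (simp add: qpoly_def)
  qed (simp add: qpoly_def)
  have "foldr (\<lambda>n. tens_op s (G (int P - int n)) id) ns (tens s vac u) = tens s (xvec ns) u"
    for u :: fock
    by (induction ns) (simp_all add: tens_op_tens[unfolded id_def] G_simps id_def)
  then show ?thesis by (simp add: basis_vector_def h)
qed

lemma basis_family: "is_basis_family (pm_scale s) basis_index (basis_vector s Phi vac \<chi> P)"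
proof (rule is_basis_familyI)
  let ?A = "{ns :: nat list. sorted_wrt (>) ns \<and> (\<forall>n\<in>set ns. n > 0)}"
  have idx: "basis_index = ?A \<times> mode_lists"
    by (auto simp: basis_index_def mode_lists_def)
  have eq: "basis_vector s Phi vac \<chi> P k = (\<lambda>(ns, ms). tens s (xvec ns) (qpoly \<chi> ms)) k"
    if "k \<in> basis_index" for k
    using that by (auto simp: basis_index_def basis_vector_eq)
  have "indep_family (pm_scale s) basis_index (\<lambda>(ns, ms). tens s (xvec ns) (qpoly \<chi> ms))"
    unfolding idx by (rule indep_tens[OF indep_xvec indep_qpoly])
  moreover have "(\<Sum>k\<in>T. pm_scale s (c k) (basis_vector s Phi vac \<chi> P k)) =
      (\<Sum>k\<in>T. pm_scale s (c k) ((\<lambda>(ns, ms). tens s (xvec ns) (qpoly \<chi> ms)) k))"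
    if "T \<subseteq> basis_index" for T c
    by (rule sum.cong) (use that eq in auto)
  ultimately show "indep_family (pm_scale s) basis_index (basis_vector s Phi vac \<chi> P)"
    unfolding indep_family_def by simp
  have "basis_vector s Phi vac \<chi> P ` basis_index =
      (\<lambda>(ns, ms). tens s (xvec ns) (qpoly \<chi> ms)) ` basis_index"
    using eq by (rule image_cong[OF refl])
  then show "tensor.span (basis_vector s Phi vac \<chi> P ` basis_index) = UNIV"
    using span_tens[OF span_xvec span_qpoly] by (simp add: idx)
qed (rule tensor.vector_space_axioms)

end


section \<open>Irreducibility of the tensor product\<close>

lemma lookup_fock_var_mult_0: "Poly_Mapping.lookup (fock_var n * u) 0 = 0"
  by (simp add: lookup_fock_var_mult)

lemma exp_coeff_0: "exp_coeff a 0 u = u"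
proof -
  have "{ks :: nat list. (\<forall>k\<in>set ks. odd k) \<and> sum_list ks = 0} = {[]}"
  proof (intro Set.set_eqI iffI)
    fix ks :: "nat list" assume "ks \<in> {ks. (\<forall>k\<in>set ks. odd k) \<and> sum_list ks = 0}"
    then have "\<forall>k\<in>set ks. odd k \<and> k = 0" by auto
    then show "ks \<in> {[]}" by (cases ks) auto
  qed auto
  then show ?thesis by (simp add: exp_coeff_def pm_scale_mult)
qed

lemma exp_coeff_annihilate:
  assumes "d > 0"
  shows "exp_coeff (\<lambda>k. pm_scale (*) (c k) \<circ> fock_beta (int k)) d 1 = 0"
  unfolding exp_coeff_def
proof (rule sum.neutral, safe)
  fix ks :: "nat list" assume odd: "\<forall>k\<in>set ks. odd k" and d: "d = sum_list ks"
  have beta: "fock_beta (int k) 1 = 0" "fock_beta (int k) 0 = 0" if "odd k" for k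
    using that odd_pos[OF that]
    by (simp_all add: fock_beta_def fock_pderiv_def pm_scale_mult lookup_one)
  have "foldr (\<lambda>k. pm_scale (*) (c k) \<circ> fock_beta (int k)) ks 1 = 0" if "ks \<noteq> []"
    using that odd
  proof (induction ks)
    case (Cons k ks)
    then show ?case by (cases "ks = []") (simp_all add: beta pm_scale_mult)
  qed simp
  moreover have "ks \<noteq> []" using d assms by auto
  ultimately show "pm_scale (*) (1 / fact (length ks))
      (foldr (\<lambda>k. pm_scale (*) (c k) \<circ> fock_beta (int k)) ks 1) = 0"
    by (simp add: pm_scale_mult)
qed

lemma lookup_exp_coeff_create:
  assumes "d > 0"
  shows "Poly_Mapping.lookup (exp_coeff (\<lambda>k. pm_scale (*) (c k) \<circ> fock_beta (- int k)) d u) 0 = 0"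
  unfolding exp_coeff_def lookup_sum
proof (rule sum.neutral, safe)
  fix ks :: "nat list" assume odd: "\<forall>k\<in>set ks. odd k" and d: "d = sum_list ks"
  then obtain k ks' where "ks = k # ks'" using assms by (cases ks) auto
  moreover have "odd k" using odd \<open>ks = k # ks'\<close> by simp
  moreover have "k > 0" using \<open>odd k\<close> by (rule odd_pos)
  ultimately show "Poly_Mapping.lookup (pm_scale (*) (1 / fact (length ks))
      (foldr (\<lambda>k. pm_scale (*) (c k) \<circ> fock_beta (- int k)) ks u)) 0 = 0"
    by (simp add: lookup_fock_scale fock_beta_def lookup_fock_var_mult_0)
qed

text \<open>On the Fock vacuum the right exponential acts as 1. The left one contains the vacuum
  only in degree 0, which leaves the prefactor at z^(1/2), that is M = 1.\<close>

lemma lookup_exp_beta: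
  "Poly_Mapping.lookup (exp_beta_coeff j M 1) 0 = (if M = 1 then - (2 * \<i>) * (-1) ^ j else 0)"
  "M < 1 \<Longrightarrow> exp_beta_coeff j M 1 = 0"
proof -
  define cr where "cr d = exp_coeff (\<lambda>k. pm_scale (*) (2 / of_nat k) \<circ> fock_beta (- int k)) d" for d
  have sum_eq: "Sum_any (\<lambda>d::nat. if M - 1 + int d < 0 then 0 else cr (nat (M - 1 + int d))
      (exp_coeff (\<lambda>k. pm_scale (*) (- (2 / of_nat k)) \<circ> fock_beta (int k)) d 1)) =
      Sum_any (\<lambda>d::nat. (if M < 1 then 0 else cr (nat (M - 1)) 1) when d = 0)"
  proof (rule Sum_any.cong)
    fix d :: nat
    have "cr k 0 = 0" for k
      unfolding cr_def exp_coeff_def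
    proof (rule sum.neutral, safe)
      fix ks :: "nat list" assume "\<forall>k\<in>set ks. odd k"
      then have "foldr (\<lambda>k. pm_scale (*) (2 / of_nat k) \<circ> fock_beta (- int k)) ks 0 = 0"
        by (induction ks) (auto simp: fock_beta_def pm_scale_mult fock_pderiv_def)
      then show "pm_scale (*) (1 / fact (length ks))
          (foldr (\<lambda>k. pm_scale (*) (2 / of_nat k) \<circ> fock_beta (- int k)) ks 0) = 0"
        by (simp add: pm_scale_mult)
    qed
    then show "(if M - 1 + int d < 0 then 0 else cr (nat (M - 1 + int d))
      (exp_coeff (\<lambda>k. pm_scale (*) (- (2 / of_nat k)) \<circ> fock_beta (int k)) d 1)) =
      ((if M < 1 then 0 else cr (nat (M - 1)) 1) when d = 0)"
      by (cases "d = 0") (simp_all add: exp_coeff_0 exp_coeff_annihilate)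
  qed
  have eq: "exp_beta_coeff j M 1 =
      pm_scale (*) (- (2 * \<i>) * (-1) ^ j) (if M < 1 then 0 else cr (nat (M - 1)) 1)"
    unfolding exp_beta_coeff_def cr_def[symmetric] sum_eq by (simp only: Sum_any_when_equal)
  show "exp_beta_coeff j M 1 = 0" if "M < 1"
    using that by (simp add: eq pm_scale_mult)
  consider "M < 1" | "M = 1" | "M > 1" by linarith
  then show "Poly_Mapping.lookup (exp_beta_coeff j M 1) 0 =
      (if M = 1 then - (2 * \<i>) * (-1) ^ j else 0)"
  proof cases
    case 3
    then have "Poly_Mapping.lookup (cr (nat (M - 1)) 1) 0 = 0"
      unfolding cr_def by (intro lookup_exp_coeff_create) simp
    then show ?thesis using 3 by (simp add: eq lookup_fock_scale)
  qed (unfold eq, simp_all add: lookup_fock_scale cr_def exp_coeff_0)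
qed

context clifford_chi_admissible
begin

text \<open>The vacuum component requires R + 1 - N = 1, which selects the single mode
  \<open>G N\<close>.\<close>

lemma lookup_e_mode:
  "Poly_Mapping.lookup (e_mode s Phi \<chi> j N (Poly_Mapping.single 0 v)) 0 =
    s (1 / complex_of_real (sqrt 2) * (- (2 * \<i>) * (-1) ^ j)) (G N v)"
proof -
  let ?t = "\<lambda>R. tens s (G R v) (exp_beta_coeff j (R + 1 - N) 1)"
  obtain B where B: "\<forall>R>B. Phi R v = 0" using locally_finite by blast
  \<comment> \<open>Below N the exponential has no coefficient on the vacuum; above B + P the mode
    of G kills \<open>v\<close>.\<close>
  let ?K = "{N..max N (B + int P)}"
  have z: "?t R = 0" if "R \<notin> ?K" for R
  proof (cases "R < N")
    case True
    then show ?thesis by (simp add: lookup_exp_beta tens_simps)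
  next
    case False
    then have "R > B + int P" using that by auto
    then have "G R v = 0" using B by (subst G_eq_sum[of B]) auto
    then show ?thesis by (simp add: tens_simps)
  qed
  have "Sum_any ?t = sum ?t ?K"
    by (rule Sum_any.expand_superset) (simp, use z in blast)
  moreover have "tens_op s (G R) (exp_beta_coeff j (R + 1 - N)) (Poly_Mapping.single 0 v) = ?t R" for R
    by (simp add: tens_op_single G_simps)
  ultimately have "e_mode s Phi \<chi> j N (Poly_Mapping.single 0 v) =
      pm_scale s (1 / complex_of_real (sqrt 2)) (sum ?t ?K)"
    by (simp add: e_mode_def)
  then have "Poly_Mapping.lookup (e_mode s Phi \<chi> j N (Poly_Mapping.single 0 v)) 0 =
      s (1 / complex_of_real (sqrt 2)) (\<Sum>R\<in>?K. Poly_Mapping.lookup (?t R) 0)"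
    by (simp only: lookup_scale lookup_sum)
  also have "(\<Sum>R\<in>?K. Poly_Mapping.lookup (?t R) 0) =
      (\<Sum>R\<in>?K. if N = R then s (- (2 * \<i>) * (-1) ^ j) (G N v) else 0)"
    by (rule sum.cong) (auto simp: lookup_tens lookup_exp_beta)
  also have "\<dots> = s (- (2 * \<i>) * (-1) ^ j) (G N v)"
    by (subst sum.delta') auto
  finally show ?thesis by (simp only: scale_scale)
qed

text \<open>The modes of \<open>h\<close> act as multiplications and derivations, so a submodule contains
  \<open>v \<otimes> 1\<close> for every coefficient \<open>v\<close> of its vectors.\<close>

lemma coefficient_mem:
  assumes U: "tensor.subspace U" "\<And>n w. w \<in> U \<Longrightarrow> xmul n w \<in> U" "\<And>n w. w \<in> U \<Longrightarrow> xder n w \<in> U"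
    and "w \<in> U"
  shows "Poly_Mapping.single 0 (Poly_Mapping.lookup w b) \<in> U"
proof -
  have single_mem: "Poly_Mapping.single b v \<in> U" if "Poly_Mapping.single 0 v \<in> U" for b v
  proof (induction b rule: monomial_induct)
    case (add n b)
    from U(2)[OF this, of n] show ?case by (simp only: xmul_single)
  qed (rule that)
  \<comment> \<open>Induction on a degree bound: a derivative lowers the degree and carries the
    coefficient at a nonconstant monomial, up to a nonzero factor, to a smaller monomial.\<close>
  have claim: "Poly_Mapping.single 0 (Poly_Mapping.lookup w b) \<in> U"
    if "w \<in> U" "\<forall>c\<in>Poly_Mapping.keys w. deg c \<le> N" for w b N
    using that
  proof (induction N arbitrary: w b)
    case (0 w b)
    have "c = 0" if "c \<in> Poly_Mapping.keys w" for c
    proof (cases c rule: monomial_cases)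
      case (2 n c')
      then have "deg c = 1 + deg c'" by (simp only: deg_add deg_single)
      then show ?thesis using 0 that by auto
    qed
    then have keys: "Poly_Mapping.keys w \<subseteq> {0}" by auto
    then have w: "w = Poly_Mapping.single 0 (Poly_Mapping.lookup w 0)"
      by (intro poly_mapping_eqI) (auto simp: lookup_single when_def in_keys_iff)
    show ?case
    proof (cases "b = 0")
      case False
      then have "Poly_Mapping.lookup w b = 0" using keys by (auto simp: in_keys_iff)
      then show ?thesis by (simp add: tensor.subspace_0 U)
    qed (use w 0 in simp)
  next
    case (Suc N w b)
    have nonzero: "Poly_Mapping.single 0 (Poly_Mapping.lookup w b) \<in> U" if b0: "b \<noteq> 0" for b
    proof -
      obtain n b' where b: "b = Poly_Mapping.single n 1 + b'"
        using b0 by (cases b rule: monomial_cases) auto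
      define a where "a = - ((2 * of_nat n + 1) / 2) * (of_nat (Poly_Mapping.lookup b' n + 1) :: complex)"
      have "(of_nat (2 * n + 1) :: complex) \<noteq> 0" by (simp only: of_nat_eq_0_iff)
      then have "2 * of_nat n + 1 \<noteq> (0 :: complex)" by (simp add: add.commute)
      moreover have "(of_nat (Poly_Mapping.lookup b' n + 1) :: complex) \<noteq> 0"
        by (simp only: of_nat_eq_0_iff)
      ultimately have a: "a \<noteq> 0" by (simp add: a_def)
      have "deg c \<le> N" if "c \<in> Poly_Mapping.keys (xder n w)" for c
      proof -
        have "Poly_Mapping.single n 1 + c \<in> Poly_Mapping.keys w"
          using that by (auto simp: in_keys_iff lookup_xder)
        then have "deg (Poly_Mapping.single n 1 + c) \<le> Suc N" using Suc.prems by blast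
        then show ?thesis by (simp only: deg_add deg_single)
      qed
      then have "Poly_Mapping.single 0 (Poly_Mapping.lookup (xder n w) b') \<in> U"
        using Suc.prems U by (intro Suc.IH) auto
      also have "Poly_Mapping.single 0 (Poly_Mapping.lookup (xder n w) b') =
          pm_scale s a (Poly_Mapping.single 0 (Poly_Mapping.lookup w b))"
        by (rule poly_mapping_eqI)
          (simp add: lookup_scale lookup_single when_def lookup_xder b a_def)
      finally have "pm_scale s (1 / a) (pm_scale s a (Poly_Mapping.single 0 (Poly_Mapping.lookup w b))) \<in> U"
        by (rule tensor.subspace_scale[OF U(1)])
      then show ?thesis using a by simp
    qed
    show ?case
    proof (cases "b = 0")
      case True
      let ?K = "insert 0 (Poly_Mapping.keys w)"
      \<comment> \<open>The constant term is what remains of \<open>w\<close> after subtracting the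
        other terms, each of which lies in \<open>U\<close> by \<open>nonzero\<close> and
        \<open>single_mem\<close>.\<close>
      have "w = (\<Sum>c\<in>?K. Poly_Mapping.single c (Poly_Mapping.lookup w c))"
        by (subst (1) sum_singles[of w, symmetric], rule sum.mono_neutral_left)
          (auto simp: in_keys_iff)
      also have "\<dots> = Poly_Mapping.single 0 (Poly_Mapping.lookup w 0) +
          (\<Sum>c\<in>?K - {0}. Poly_Mapping.single c (Poly_Mapping.lookup w c))"
        by (rule sum.remove) auto
      finally have "Poly_Mapping.single 0 (Poly_Mapping.lookup w 0) =
          w - (\<Sum>c\<in>?K - {0}. Poly_Mapping.single c (Poly_Mapping.lookup w c))"
        by (simp add: algebra_simps)
      moreover have "\<dots> \<in> U"
        using Suc.prems nonzero single_mem
        by (intro tensor.subspace_diff tensor.subspace_sum U) auto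
      ultimately show ?thesis using True by simp
    qed (rule nonzero)
  qed
  have "\<forall>c\<in>Poly_Mapping.keys w. deg c \<le> Max (deg ` Poly_Mapping.keys w)" by simp
  then show ?thesis using claim \<open>w \<in> U\<close> by blast
qed

lemma tensor_irreducible:
  assumes U: "tensor.subspace U" "\<And>N w. w \<in> U \<Longrightarrow> e_mode s Phi \<chi> j N w \<in> U"
      "\<And>N w. w \<in> U \<Longrightarrow> h_mode s \<chi> N w \<in> U" "U \<noteq> {0}"
  shows "U = UNIV"
proof -
  \<comment> \<open>The modes of h are -2 times \<open>xmul\<close> or \<open>xder\<close> plus a
    scalar; the scalar part of the image lies in \<open>U\<close> and can be removed.\<close>
  have scale_back: "z \<in> U" if "pm_scale s (-2) z + pm_scale s c w \<in> U" "w \<in> U" for z w c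
  proof -
    have "(pm_scale s (-2) z + pm_scale s c w) - pm_scale s c w \<in> U"
      by (intro tensor.subspace_diff tensor.subspace_scale U that)
    then have "pm_scale s (-2) z \<in> U" by (simp only: add_diff_cancel_right')
    then have "pm_scale s (- 1 / 2) (pm_scale s (-2) z) \<in> U"
      by (rule tensor.subspace_scale[OF U(1)])
    then show ?thesis by (simp only: tensor.scale_scale) simp
  qed
  have xmul: "xmul n w \<in> U" and xder: "xder n w \<in> U" if "w \<in> U" for n w
    using U(3)[OF that, of "- (2 * int n + 1)"] U(3)[OF that, of "2 * int n + 1"] that
    unfolding h_mode_odd by (blast intro: scale_back)+
  define U0 where "U0 = {v. Poly_Mapping.single 0 v \<in> U}"
  have mem: "Poly_Mapping.lookup w b \<in> U0" if "w \<in> U" for w b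
    unfolding U0_def using coefficient_mem[OF U(1) xmul xder that] by simp
  have "U0 = UNIV"
  proof (rule G_irreducible)
    have "Poly_Mapping.single (0 :: monomial) (s c v) = pm_scale s c (Poly_Mapping.single 0 v)" for c v
      by (rule poly_mapping_eqI) (simp add: lookup_scale lookup_single when_def)
    then show "subspace U0"
      unfolding subspace_def U0_def
      using U(1) by (auto simp: single_add tensor.subspace_0 tensor.subspace_add tensor.subspace_scale)
    then have scale: "s c v \<in> U0" if "v \<in> U0" for c v using that by (rule subspace_scale)
    show "G N v \<in> U0" if "v \<in> U0" for N v
    proof -
      let ?c = "1 / complex_of_real (sqrt 2) * (- (2 * \<i>) * (-1) ^ j)"
      have "e_mode s Phi \<chi> j N (Poly_Mapping.single 0 v) \<in> U"
        using that U(2) by (simp add: U0_def)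
      \<comment> \<open>The vacuum component of the image under e is a nonzero multiple of
        \<open>G N v\<close>.\<close>
      from mem[OF this, of 0] have "s (1 / ?c) (s ?c (G N v)) \<in> U0"
        unfolding lookup_e_mode by (rule scale)
      moreover have "?c \<noteq> 0" by simp
      ultimately show ?thesis by (simp only: scale_scale nonzero_divide_eq_eq divide_self_if) simp
    qed
    have "0 \<in> U" using U(1) by (rule tensor.subspace_0)
    then obtain w where w: "w \<in> U" "w \<noteq> 0" using U(4) by blast
    then obtain b where "Poly_Mapping.lookup w b \<noteq> 0" by (metis lookup_zero poly_mapping_eqI)
    then show "U0 \<noteq> {0}" using mem[OF w(1), of b] by auto
  qed
  then have 0: "Poly_Mapping.single 0 v \<in> U" for v by (auto simp: U0_def)
  have "Poly_Mapping.single b v \<in> U" for b v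
  proof (induction b rule: monomial_induct)
    case (add n b)
    from xmul[OF this, of n] show ?case by (simp only: xmul_single)
  qed (rule 0)
  then have "(\<Sum>c\<in>Poly_Mapping.keys w. Poly_Mapping.single c (Poly_Mapping.lookup w c)) \<in> U" for w
    by (intro tensor.subspace_sum[OF U(1)])
  then have "w \<in> U" for w by (simp only: sum_singles)
  then show ?thesis by blast
qed

end

theorem corollary7p1:
  fixes P :: nat and \<chi> :: "complex fls" and i j :: nat
    and s :: "complex \<Rightarrow> 'v::ab_group_add \<Rightarrow> 'v" and Phi :: "int \<Rightarrow> 'v \<Rightarrow> 'v" and vac :: 'v
    and sV :: "complex \<Rightarrow> 'a::ab_group_add \<Rightarrow> 'a" and vone :: 'a
    and Y :: "'a \<Rightarrow> int \<Rightarrow> 'a \<Rightarrow> 'a" and \<iota> :: "sl2 \<Rightarrow> 'a" and \<Theta> :: "'a \<Rightarrow> 'a"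
  assumes chi: "\<And>N. N > int P \<Longrightarrow> chi_mode \<chi> N = 0"
    and cond:
      "(P > 0 \<and> chi_mode \<chi> (int P) \<noteq> 0) \<or>
       (P = 0 \<and> (2 * chi_mode \<chi> 0 \<notin> \<int> \<or> chi_mode \<chi> 0 = 1/2)) \<or>
       (P = 0 \<and> (\<exists>L::nat. chi_mode \<chi> 0 - 1/2 = of_nat L / 2 \<and> det (A_matrix L \<chi>) \<noteq> 0))"
    and ij: "i \<in> {1, 2}" "j \<in> {1, 2}"
    and FT: "is_FT i s Phi vac"
    and V: "universal_affine_sl2 (-2) sV vone Y \<iota>"
    and Theta: "va_automorphism sV vone Y \<Theta>"
      "\<Theta> (\<iota> sl2_e) = \<iota> sl2_f" "\<Theta> (\<iota> sl2_f) = \<iota> sl2_e" "\<Theta> (\<iota> sl2_h) = - \<iota> sl2_h"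
  shows "atw_irreducible_module s (FT_action s Phi \<chi>) \<and>
    (\<forall>Ytw. twisted_module sV vone Y \<Theta> (pm_scale s) Ytw \<and>
        (\<forall>N. Ytw (\<iota> sl2_e) N = e_mode s Phi \<chi> j N) \<and>
        (\<forall>N. Ytw (\<iota> sl2_f) N = f_mode s Phi \<chi> j N) \<and>
        (\<forall>N. Ytw (\<iota> sl2_h) N = h_mode s \<chi> N)
      \<longrightarrow> irreducible_twisted_module sV vone Y \<Theta> (pm_scale s) Ytw) \<and>
    is_basis_family (pm_scale s) basis_index (basis_vector s Phi vac \<chi> P)"
proof -
  have "vector_space s" using FT by (simp add: is_FT_def CLtw_module_def)
  then interpret clifford_chi_admissible s i Phi vac P \<chi>
    using FT chi cond
    by (simp add: clifford_chi_admissible_def clifford_chi_admissible_axioms_def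
        clifford_chi_def clifford_chi_axioms_def clifford_def clifford_axioms_def admissible_def)
  have "irreducible_twisted_module sV vone Y \<Theta> (pm_scale s) Ytw"
    if tw: "twisted_module sV vone Y \<Theta> (pm_scale s) Ytw"
      and e: "\<forall>N. Ytw (\<iota> sl2_e) N = e_mode s Phi \<chi> j N"
      and h: "\<forall>N. Ytw (\<iota> sl2_h) N = h_mode s \<chi> N" for Ytw
    unfolding irreducible_twisted_module_def irreducible_under_def is_subspace_def
  proof (intro conjI allI impI)
    have "(Poly_Mapping.single 0 vac :: monomial \<Rightarrow>\<^sub>0 'v) \<noteq> 0"
      using vac_nz by (metis lookup_single_eq lookup_zero)
    then show "\<exists>w :: monomial \<Rightarrow>\<^sub>0 'v. w \<noteq> 0" by blast
    \<comment> \<open>A subspace stable under all twisted fields is stable under those of e and h,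
      so \<open>tensor_irreducible\<close> applies.\<close>
    fix U assume U: "tensor.subspace U \<and> (\<forall>T\<in>range (\<lambda>(a, N). Ytw a N). T ` U \<subseteq> U)"
    then have stable: "Ytw a N w \<in> U" if "w \<in> U" for a N w using that by fastforce
    show "U = {0} \<or> U = UNIV"
    proof (cases "U = {0}")
      case False
      have "U = UNIV"
      proof (rule tensor_irreducible[where j = j])
        show "e_mode s Phi \<chi> j N w \<in> U" if "w \<in> U" for N w
          using stable[OF that, of "\<iota> sl2_e" N] e by simp
        show "h_mode s \<chi> N w \<in> U" if "w \<in> U" for N w
          using stable[OF that, of "\<iota> sl2_h" N] h by simp
      qed (use U False in auto)
      then show ?thesis ..
    qed simp
  qed (rule tw)
  then show ?thesis using atw_irreducible_module_rho basis_family by blast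
qed

end
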